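(* Let $b>0$ and let $\varphi=(\varphi_1,\varphi_2)$ be a pair of real-valued functions in $C^1[0,b]$ such that $\varphi_1,\varphi_2$ are increasing, $\varphi_1+\varphi_2$ is strictly increasing, and $\varphi_1'(x)+\varphi_2'(x)>0$ for all $x\in(0,b]$. Let $T\in\mathbb{M}_n[0,b]$ be non-invertible, and let $m^a$ and $m^g$ denote respectively the algebraic and the geometric multiplicity of the eigenvalue $0$ of $T$. Assume one of the following: (1) $m^a=m^g$ and $\varphi_k\in C^{n-1-m^g}[0,b]$ for $k=1,2$; (2) $m^a=m^g+1$, $\varphi_2=0$, and $\varphi_1\in C^{n-1-m^g}[0,b]$. Then the flow $\{F^\varphi_t(T)\}_{t\ge0}$ converges to a normal matrix as $t\to\infty$.
   Context: $\mathbb{M}_n$ is the algebra of $n\times n$ complex matrices, $|X|=(X^*X)^{1/2}$, $\sigma(\cdot)$ is the spectrum, $[A,B]=AB-BA$. $\mathbb{M}_n[0,b]=\{X\in\mathbb{M}_n: \sigma(|X|)\subset[0,b]\}$. For $X\in\mathbb{M}_n[0,b]$, $\varphi(X):=\varphi_1(|X|)-\varphi_2(|X^*|)$. "Increasing" means non-decreasing. The algebraic multiplicity of $0$ is its multiplicity as a root of the characteristic polynomial of $T$; the geometric multiplicity is $\dim\ker T$. (If $T=0$, so that $n-1-m^g=-1$, the smoothness condition is regarded as vacuous.) $F^\varphi_t(T):=X(t)$, where $X:[0,\infty)\to\mathbb{M}_n[0,b]$ is the unique global solution of $\frac{dX(t)}{dt}=[\varphi(X(t)),X(t)]$, $X(0)=T$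 (it exists and is unique whenever $\varphi_1,\varphi_2$ are increasing Lipschitz functions with $\varphi_1+\varphi_2$ strictly increasing). *)

theory Defs
  imports "HOL-Analysis.Analysis" "HOL-Computational_Algebra.Polynomial"
begin

section \<open>Complex matrices\<close>

definition conj_transpose :: "complex ^ 'n ^ 'n \<Rightarrow> complex ^ 'n ^ 'n" where
  "conj_transpose A = (\<chi> i j. cnj (A $ j $ i))"

definition unitary_matrix :: "complex ^ 'n ^ 'n \<Rightarrow> bool" where
  "unitary_matrix U \<longleftrightarrow> conj_transpose U ** U = mat 1 \<and> U ** conj_transpose U = mat 1"

definition normal_matrix :: "complex ^ 'n ^ 'n \<Rightarrow> bool" where
  "normal_matrix A \<longleftrightarrow> conj_transpose A ** A = A ** conj_transpose A"

definition matrix_spectrum :: "complex ^ 'n ^ 'n \<Rightarrow> complex set" where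
  "matrix_spectrum A = {z. \<not> invertible (A - mat z)}"

definition commutator :: "complex ^ 'n ^ 'n \<Rightarrow> complex ^ 'n ^ 'n \<Rightarrow> complex ^ 'n ^ 'n" where
  "commutator A B = A ** B - B ** A"

text \<open>The characteristic polynomial \<open>det (x I - A)\<close>, as a determinant over \<open>complex poly\<close>.\<close>

definition matrix_charpoly :: "complex ^ 'n ^ 'n \<Rightarrow> complex poly" where
  "matrix_charpoly A = det (mat [:0, 1:] - (\<chi> i j. [:A $ i $ j:]))"

definition alg_mult :: "complex ^ 'n ^ 'n \<Rightarrow> complex \<Rightarrow> nat" where
  "alg_mult A z = order z (matrix_charpoly A)"

text \<open>The operation \<open>vec.dim\<close> is the dimension over the complex field (whereas \<open>dim\<close> would be the
  dimension over the reals).\<close>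

definition geom_mult :: "complex ^ 'n ^ 'n \<Rightarrow> complex \<Rightarrow> nat" where
  "geom_mult A z = vec.dim {x. (A - mat z) *v x = 0}"

definition real_diag :: "('n \<Rightarrow> real) \<Rightarrow> complex ^ 'n ^ 'n" where
  "real_diag d = (\<chi> i j. if i = j then complex_of_real (d i) else 0)"

text \<open>Functional calculus for Hermitian matrices: \<open>f (U D U\<^sup>*) = U f(D) U\<^sup>*\<close> for unitary \<open>U\<close> and real
  diagonal \<open>D\<close>. Only the values of \<open>f\<close> on the spectrum matter; independence of the chosen
  diagonalization is proved below. The value is unspecified for matrices that are not Hermitian.\<close>

definition hermitian_fun :: "(real \<Rightarrow> real) \<Rightarrow> complex ^ 'n ^ 'n \<Rightarrow> complex ^ 'n ^ 'n" where
  "hermitian_fun f A = (THE B. \<exists>U d. unitary_matrix U \<and>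
      A = U ** real_diag d ** conj_transpose U \<and>
      B = U ** real_diag (\<lambda>i. f (d i)) ** conj_transpose U)"

lemma real_diag_right: "(A ** real_diag d) $ i $ j = A $ i $ j * complex_of_real (d j)"
  by (simp add: matrix_matrix_mult_def real_diag_def if_distrib[of "\<lambda>x. _ * x"] cong: if_cong)

lemma real_diag_left: "(real_diag d ** A) $ i $ j = complex_of_real (d i) * A $ i $ j"
  by (simp add: matrix_matrix_mult_def real_diag_def if_distrib[of "\<lambda>x. x * _"] cong: if_cong)

lemma hermitian_fun_unitary_diag:
  assumes U: "unitary_matrix U"
  shows "hermitian_fun f (U ** real_diag d ** conj_transpose U) =
    U ** real_diag (\<lambda>i. f (d i)) ** conj_transpose U"
  unfolding hermitian_fun_def
proof (rule the_equality)
  show "\<exists>V e. unitary_matrix V \<and>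
      U ** real_diag d ** conj_transpose U = V ** real_diag e ** conj_transpose V \<and>
      U ** real_diag (\<lambda>i. f (d i)) ** conj_transpose U =
        V ** real_diag (\<lambda>i. f (e i)) ** conj_transpose V"
    using U by blast
next
  fix B
  assume "\<exists>V e. unitary_matrix V \<and>
      U ** real_diag d ** conj_transpose U = V ** real_diag e ** conj_transpose V \<and>
      B = V ** real_diag (\<lambda>i. f (e i)) ** conj_transpose V"
  then obtain V e where V: "unitary_matrix V"
    and eq: "U ** real_diag d ** conj_transpose U = V ** real_diag e ** conj_transpose V"
    and B: "B = V ** real_diag (\<lambda>i. f (e i)) ** conj_transpose V" by blast
  define W where "W = conj_transpose V ** U"
  have VV: "conj_transpose V ** V = mat 1" "V ** conj_transpose V = mat 1"
    and UU: "conj_transpose U ** U = mat 1" "U ** conj_transpose U = mat 1"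
    using U V by (auto simp: unitary_matrix_def)
  have "W ** real_diag d = conj_transpose V ** (U ** real_diag d ** conj_transpose U) ** U"
    unfolding W_def by (metis UU(1) matrix_mul_assoc matrix_mul_rid)
  also have "\<dots> = real_diag e ** W"
    unfolding eq W_def by (metis VV(1) matrix_mul_assoc matrix_mul_lid)
  finally have WD: "W ** real_diag d = real_diag e ** W" .
  have "W $ i $ j * complex_of_real (f (d j)) = complex_of_real (f (e i)) * W $ i $ j" for i j
  proof (cases "W $ i $ j = 0")
    case False
    have "W $ i $ j * complex_of_real (d j) = complex_of_real (e i) * W $ i $ j"
      using arg_cong[OF WD, of "\<lambda>M. M $ i $ j"] by (simp add: real_diag_left real_diag_right)
    with False have "d j = e i" by simp
    then show ?thesis by simp
  qed simp
  then have "W ** real_diag (\<lambda>i. f (d i)) = real_diag (\<lambda>i. f (e i)) ** W"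
    by (simp add: vec_eq_iff real_diag_left real_diag_right)
  then have "V ** (W ** real_diag (\<lambda>i. f (d i))) ** conj_transpose U =
      V ** (real_diag (\<lambda>i. f (e i)) ** W) ** conj_transpose U" by simp
  then show "B = U ** real_diag (\<lambda>i. f (d i)) ** conj_transpose U"
    unfolding B W_def by (metis VV(2) UU(2) matrix_mul_assoc matrix_mul_lid matrix_mul_rid)
qed

definition matrix_abs :: "complex ^ 'n ^ 'n \<Rightarrow> complex ^ 'n ^ 'n" where
  "matrix_abs X = hermitian_fun sqrt (conj_transpose X ** X)"

definition matrices_upto :: "real \<Rightarrow> (complex ^ 'n ^ 'n) set" where
  "matrices_upto b = {X. matrix_spectrum (matrix_abs X) \<subseteq> complex_of_real ` {0..b}}"

section \<open>The flow\<close>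

definition phi_map ::
    "(real \<Rightarrow> real) \<Rightarrow> (real \<Rightarrow> real) \<Rightarrow> complex ^ 'n ^ 'n \<Rightarrow> complex ^ 'n ^ 'n" where
  "phi_map \<phi>1 \<phi>2 X =
    hermitian_fun \<phi>1 (matrix_abs X) - hermitian_fun \<phi>2 (matrix_abs (conj_transpose X))"

definition is_global_solution ::
    "real \<Rightarrow> (real \<Rightarrow> real) \<Rightarrow> (real \<Rightarrow> real) \<Rightarrow> complex ^ 'n ^ 'n \<Rightarrow> (real \<Rightarrow> complex ^ 'n ^ 'n) \<Rightarrow> bool" where
  "is_global_solution b \<phi>1 \<phi>2 T X \<longleftrightarrow>
    X 0 = T \<and>
    (\<forall>t\<ge>0. X t \<in> matrices_upto b \<and>
      (X has_vector_derivative commutator (phi_map \<phi>1 \<phi>2 (X t)) (X t)) (at t within {0..}))"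

text \<open>Solutions are total functions on the reals whose values at negative times are irrelevant, so
  the description ranges over the value at time \<open>t \<ge> 0\<close> instead of over the solution itself.\<close>

definition flow ::
    "real \<Rightarrow> (real \<Rightarrow> real) \<Rightarrow> (real \<Rightarrow> real) \<Rightarrow> real \<Rightarrow> complex ^ 'n ^ 'n \<Rightarrow> complex ^ 'n ^ 'n" where
  "flow b \<phi>1 \<phi>2 t T = (THE Y. \<exists>X. is_global_solution b \<phi>1 \<phi>2 T X \<and> Y = X t)"

section \<open>Functions of class \<open>C\<^sup>k\<close> on a set\<close>

text \<open>The witness \<open>D\<close> is the sequence of successive derivatives of \<open>f\<close>, taken within \<open>S\<close>; on a compact
  interval these are one-sided at the end points.\<close>

definition C_k_on :: "nat \<Rightarrow> real set \<Rightarrow> (real \<Rightarrow> real) \<Rightarrow> bool" where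
  "C_k_on k S f \<longleftrightarrow> (\<exists>D :: nat \<Rightarrow> real \<Rightarrow> real.
    (\<forall>x\<in>S. D 0 x = f x) \<and>
    (\<forall>j<k. \<forall>x\<in>S. (D j has_real_derivative D (Suc j) x) (at x within S)) \<and>
    (\<forall>j\<le>k. continuous_on S (D j)))"

end

theory Submission
  imports Defs "HOL-Computational_Algebra.Fundamental_Theorem_Algebra"
    "HOL-Computational_Algebra.Polynomial_Factorial" "HOL-Computational_Algebra.Field_as_Ring"
begin

text \<open>The flow is isospectral, and the energy \<open>\<bar>X\<bar>\<^sup>2\<close> (Frobenius norm) decreases strictly off the normal
  matrices, so by LaSalle's principle all limit points are normal. A polynomial \<open>h\<close> for which \<open>h(T)\<close> is a
  spectral projection of \<open>T\<close> gives an idempotent \<open>Z = h(X)\<close> with \<open>Z' = [\<phi>(X), Z]\<close>. With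
  \<open>A = Z - Z\<^sup>*\<close> and \<open>B = Z + Z\<^sup>*\<close> one has \<open>d/dt \<bar>A\<bar>\<^sup>2 = 2 \<langle>A, [\<phi>(X), B]\<rangle>\<close>, and in singular coordinates of \<open>X\<close>
  the right-hand side is minus a quadratic form in \<open>A\<close> whose coefficients are divided differences of
  \<open>\<phi>\<^sub>1\<close> and \<open>\<phi>\<^sub>2\<close>. At normal matrices this form is positive on the possible directions of \<open>A\<close>, so
  \<open>\<bar>A\<bar>\<close> decays exponentially. Since \<open>\<bar>Z'\<bar>\<close> is bounded by a multiple of \<open>\<bar>A\<bar>\<close>, every spectral projection converges.
  The nilpotent part of \<open>X\<close> tends to \<open>0\<close> because it vanishes at normal limit points.\<close>

section \<open>Complex matrices and the singular value decomposition\<close>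

text \<open>LaSalle's principle alone leaves many candidates: all unitary conjugates of a normal
  matrix have the same spectrum. What must be excluded is a trajectory of infinite length drifting
  among them. The size of \<open>X - adj X\<close> does not measure non-normality, since a normal
  matrix may have a large skew part. For an idempotent, however, normal means Hermitian, so
  \<open>Z - adj Z\<close> is a linear measure of the defect; hence the projections are followed one
  by one. The obstacle is the kernel: when two singular values vanish together, so does the
  corresponding coefficient of the quadratic form, and at a singular normal matrix the form is only
  semidefinite. Its zero directions commute with that matrix, and the identity
  \<open>A B + B A = 2 A\<close>, valid for idempotents, rules such directions out. Compactness
  turns this into a uniform rate, which is therefore not explicit. Each projection is given by one
  polynomial, the same for all times, because an annihilating polynomial of \<open>T\<close>
  annihilates the whole trajectory.\<close>

abbreviation adj :: "complex ^ 'n ^ 'n \<Rightarrow> complex ^ 'n ^ 'n" where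
  "adj \<equiv> conj_transpose"

lemma adj_nth: "adj A $ i $ j = cnj (A $ j $ i)"
  by (simp add: conj_transpose_def)

lemma adj_adj [simp]: "adj (adj A) = A"
  by (simp add: conj_transpose_def vec_eq_iff)

lemma adj_add: "adj (A + B) = adj A + adj B"
  by (simp add: conj_transpose_def vec_eq_iff)

lemma adj_diff: "adj (A - B) = adj A - adj B"
  by (simp add: conj_transpose_def vec_eq_iff)

lemma adj_scaleR: "adj (r *\<^sub>R A) = r *\<^sub>R adj A"
  by (simp add: conj_transpose_def vec_eq_iff)

lemma adj_mult: "adj (A ** B) = adj B ** adj A"
  by (simp add: conj_transpose_def vec_eq_iff matrix_matrix_mult_def mult.commute)

lemma adj_mat: "adj (mat c) = mat (cnj c)"
  by (simp add: conj_transpose_def vec_eq_iff mat_def)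

lemma adj_real_diag [simp]: "adj (real_diag d) = real_diag d"
  by (simp add: conj_transpose_def vec_eq_iff real_diag_def)

lemma mult_nth: "(A ** B) $ i $ j = (\<Sum>k\<in>UNIV. A $ i $ k * B $ k $ j)"
  by (simp add: matrix_matrix_mult_def)

section \<open>The real Frobenius inner product and its norm\<close>

lemma inner_matrix_eq: "(A::complex^'n^'n) \<bullet> B = Re (\<Sum>i\<in>UNIV. \<Sum>j\<in>UNIV. cnj (A $ i $ j) * B $ i $ j)"
  by (simp add: inner_vec_def inner_complex_def)

lemma norm_matrix_sq: "(norm (A::complex^'n^'n))\<^sup>2 = (\<Sum>i\<in>UNIV. \<Sum>j\<in>UNIV. (cmod (A $ i $ j))\<^sup>2)"
  by (simp add: norm_vec_def L2_set_def sum_nonneg)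

lemma inner_matmul_left: "((A::complex^'n^'n) ** (B::complex^'n^'n)) \<bullet> C = B \<bullet> (adj A ** C)"
proof -
  have "(\<Sum>i\<in>UNIV. \<Sum>j\<in>UNIV. cnj ((A ** B) $ i $ j) * C $ i $ j)
      = (\<Sum>i\<in>UNIV. \<Sum>j\<in>UNIV. \<Sum>k\<in>UNIV. cnj (A $ i $ k) * cnj (B $ k $ j) * C $ i $ j)"
    by (simp add: mult_nth sum_distrib_right)
  also have "\<dots> = (\<Sum>k\<in>UNIV. \<Sum>j\<in>UNIV. \<Sum>i\<in>UNIV. cnj (A $ i $ k) * cnj (B $ k $ j) * C $ i $ j)"
    by (subst sum.swap, subst (2) sum.swap, subst sum.swap) (rule refl)
  also have "\<dots> = (\<Sum>k\<in>UNIV. \<Sum>j\<in>UNIV. cnj (B $ k $ j) * (adj A ** C) $ k $ j)"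
    by (simp add: mult_nth sum_distrib_left adj_nth mult_ac)
  finally show ?thesis by (simp only: inner_matrix_eq)
qed

lemma inner_adj: "adj A \<bullet> adj B = A \<bullet> B"
proof -
  have "adj A \<bullet> adj B = Re (\<Sum>i\<in>UNIV. \<Sum>j\<in>UNIV. A $ j $ i * cnj (B $ j $ i))"
    by (simp add: inner_matrix_eq adj_nth)
  also have "\<dots> = Re (\<Sum>j\<in>UNIV. \<Sum>i\<in>UNIV. A $ j $ i * cnj (B $ j $ i))"
    by (subst sum.swap) (rule refl)
  also have "\<dots> = A \<bullet> B"
    by (simp add: inner_matrix_eq)
  finally show ?thesis .
qed

lemma norm_adj [simp]: "norm (adj A) = norm A"
  by (simp add: norm_eq_sqrt_inner inner_adj)

lemma inner_matmul_right: "((A::complex^'n^'n) ** (B::complex^'n^'n)) \<bullet> C = A \<bullet> (C ** adj B)"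
proof -
  have "(A ** B) \<bullet> C = (adj B ** adj A) \<bullet> adj C"
    by (metis inner_adj adj_mult)
  also have "\<dots> = adj A \<bullet> adj (C ** adj B)"
    by (simp add: inner_matmul_left adj_mult)
  finally show ?thesis by (simp add: inner_adj)
qed

lemma norm_mult_le: "norm ((A::complex^'n^'n) ** (B::complex^'n^'n)) \<le> norm A * norm B"
proof (rule power2_le_imp_le)
  have *: "(cmod ((A ** B) $ i $ j))\<^sup>2 \<le> (\<Sum>k\<in>UNIV. (cmod (A $ i $ k))\<^sup>2) * (\<Sum>k\<in>UNIV. (cmod (B $ k $ j))\<^sup>2)" for i j
  proof -
    have "cmod ((A ** B) $ i $ j) \<le> (\<Sum>k\<in>UNIV. cmod (A $ i $ k) * cmod (B $ k $ j))"
      unfolding mult_nth by (rule order_trans[OF norm_sum]) (simp add: norm_mult)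
    then have "(cmod ((A ** B) $ i $ j))\<^sup>2 \<le> (\<Sum>k\<in>UNIV. cmod (A $ i $ k) * cmod (B $ k $ j))\<^sup>2"
      by (rule power_mono) simp
    also have "\<dots> \<le> (\<Sum>k\<in>UNIV. (cmod (A $ i $ k))\<^sup>2) * (\<Sum>k\<in>UNIV. (cmod (B $ k $ j))\<^sup>2)"
      by (rule Cauchy_Schwarz_ineq_sum)
    finally show ?thesis .
  qed
  have "(norm (A ** B))\<^sup>2 \<le> (\<Sum>i\<in>UNIV. \<Sum>j\<in>UNIV. (\<Sum>k\<in>UNIV. (cmod (A $ i $ k))\<^sup>2) * (\<Sum>k\<in>UNIV. (cmod (B $ k $ j))\<^sup>2))"
    unfolding norm_matrix_sq by (intro sum_mono *)
  also have "\<dots> = (norm A)\<^sup>2 * (\<Sum>j\<in>UNIV. \<Sum>k\<in>UNIV. (cmod (B $ k $ j))\<^sup>2)"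
    by (simp only: norm_matrix_sq sum_product)
  also have "(\<Sum>j\<in>UNIV. \<Sum>k\<in>UNIV. (cmod (B $ k $ j))\<^sup>2) = (norm B)\<^sup>2"
    unfolding norm_matrix_sq by (rule sum.swap)
  finally show "(norm (A ** B))\<^sup>2 \<le> (norm A * norm B)\<^sup>2"
    by (simp add: power_mult_distrib)
qed simp

lemma bounded_bilinear_matrix_mult: "bounded_bilinear ((**) :: complex^'n^'n \<Rightarrow> complex^'n^'n \<Rightarrow> complex^'n^'n)"
proof
  show "\<exists>K. \<forall>a b. norm ((a::complex^'n^'n) ** (b::complex^'n^'n)) \<le> norm a * norm b * K"
    by (rule exI[of _ 1]) (simp add: norm_mult_le)
qed (simp_all add: vec_eq_iff mult_nth sum.distrib algebra_simps scaleR_sum_right)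

interpretation matmul: bounded_bilinear "(**) :: complex^'n^'n \<Rightarrow> complex^'n^'n \<Rightarrow> complex^'n^'n"
  by (rule bounded_bilinear_matrix_mult)

lemma bounded_linear_adj: "bounded_linear (adj :: complex^'n^'n \<Rightarrow> _)"
  by (rule bounded_linear_intro[of _ 1]) (simp_all add: adj_add adj_scaleR)

lemmas matrix_simps = matmul.add_left matmul.add_right matmul.diff_left matmul.diff_right
  matmul.minus_left matmul.minus_right matmul.scaleR_left matmul.scaleR_right
  matmul.zero_left matmul.zero_right matrix_mul_assoc adj_mult adj_add adj_diff adj_scaleR

lemma norm_nth_nth_le: "cmod ((A::complex^'n^'n) $ i $ j) \<le> norm A"
  by (meson Finite_Cartesian_Product.norm_nth_le order_trans)

text \<open>The matrix has n^2 entries. This crude factor is the source of every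
  \<open>(real CARD('n))\<^sup>2\<close> in the estimates below; only its independence of the matrix
  matters.\<close>

lemma norm_le_entries:
  assumes "\<And>i j. cmod ((A::complex^'n^'n) $ i $ j) \<le> c"
  shows "norm A \<le> (real (CARD('n)))\<^sup>2 * c"
proof -
  have "norm A \<le> (\<Sum>i\<in>UNIV. norm (A $ i))"
    unfolding norm_vec_def by (rule L2_set_le_sum) simp
  also have "\<dots> \<le> (\<Sum>i\<in>UNIV. \<Sum>j\<in>UNIV. cmod (A $ i $ j))"
    unfolding norm_vec_def by (intro sum_mono L2_set_le_sum) simp
  also have "\<dots> \<le> (\<Sum>i\<in>(UNIV::'n set). \<Sum>j\<in>(UNIV::'n set). c)"
    by (intro sum_mono assms)
  finally show ?thesis by (simp add: power2_eq_square mult_ac)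
qed

section \<open>Unitary matrices\<close>

lemma unitary_adj: "unitary_matrix U \<Longrightarrow> unitary_matrix (adj U)"
  by (simp add: unitary_matrix_def)

lemma unitary_mult: "unitary_matrix U \<Longrightarrow> unitary_matrix V \<Longrightarrow> unitary_matrix (U ** V)"
  unfolding unitary_matrix_def adj_mult by (metis matrix_mul_assoc matrix_mul_lid)

lemma unitary_cancel:
  assumes "unitary_matrix U"
  shows "adj U ** U = mat 1" "U ** adj U = mat 1"
    "A ** adj U ** U = A" "A ** U ** adj U = A"
  using assms by (auto simp: unitary_matrix_def simp flip: matrix_mul_assoc)

lemma unitary_inner:
  fixes U V A B :: "complex^'n^'n"
  assumes "unitary_matrix U" "unitary_matrix V"
  shows "(U ** A ** V) \<bullet> (U ** B ** V) = A \<bullet> B"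
proof -
  have "(U ** A ** V) \<bullet> (U ** B ** V) = (U ** A) \<bullet> (U ** B)"
    by (subst inner_matmul_right) (simp add: unitary_cancel assms)
  also have "\<dots> = A \<bullet> B"
    by (subst inner_matmul_left) (simp add: matrix_mul_assoc unitary_cancel assms)
  finally show ?thesis .
qed

lemma unitary_norm:
  fixes U V A :: "complex^'n^'n"
  assumes "unitary_matrix U" "unitary_matrix V"
  shows "norm (U ** A ** V) = norm A"
  by (simp add: norm_eq_sqrt_inner unitary_inner assms)

lemma norm_unitary:
  assumes "unitary_matrix (U :: complex^'n^'n)"
  shows "(norm U)\<^sup>2 = CARD('n)"
proof -
  have "(norm U)\<^sup>2 = U \<bullet> U" by (simp add: power2_norm_eq_inner)
  also have "\<dots> = (U ** mat 1) \<bullet> U" by simp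
  also have "\<dots> = mat 1 \<bullet> (mat 1 :: complex^'n^'n)"
    by (simp only: inner_matmul_left unitary_cancel[OF assms])
  also have "\<dots> = CARD('n)"
    by (simp add: inner_matrix_eq mat_def if_distrib[of cnj] if_distrib[of "\<lambda>x. x * _"] cong: if_cong)
  finally show ?thesis .
qed

lemma compact_unitary: "compact {U :: complex^'n^'n. unitary_matrix U}"
proof (rule compact_eq_bounded_closed[THEN iffD2], rule conjI)
  show "bounded {U :: complex^'n^'n. unitary_matrix U}"
    by (rule boundedI[of _ "sqrt CARD('n)"]) (metis mem_Collect_eq norm_unitary order_refl real_sqrt_unique norm_ge_zero)
  have "continuous_on UNIV (\<lambda>U::complex^'n^'n. adj U ** U)" "continuous_on UNIV (\<lambda>U::complex^'n^'n. U ** adj U)"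
    by (intro matmul.continuous_on linear_continuous_on bounded_linear_adj continuous_on_id)+
  then show "closed {U :: complex^'n^'n. unitary_matrix U}"
    unfolding unitary_matrix_def
    by (intro closed_Collect_conj closed_Collect_eq continuous_on_const)
qed

lemma real_diag_mult: "real_diag d ** real_diag e = real_diag (\<lambda>i. d i * e i)"
  by (simp add: vec_eq_iff real_diag_right) (simp add: real_diag_def)

text \<open>The matrix \<open>1 + (w - 1) x x\<^sup>*\<close>. Comparing \<open>Re tr (W B)\<close> with \<open>Re tr B\<close> for these unitary \<open>W\<close> alone
  already tests positivity of \<open>B\<close>, without any differentiation.\<close>

definition phase_reflection :: "complex \<Rightarrow> complex^'n \<Rightarrow> complex^'n^'n" where
  "phase_reflection w x = (\<chi> i j. (if i = j then 1 else 0) + (w - 1) * (x $ i * cnj (x $ j)))"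

lemma unitary_phase_reflection:
  assumes "(\<Sum>i\<in>UNIV. x $ i * cnj (x $ i)) = 1" "w * cnj w = 1"
  shows "unitary_matrix (phase_reflection w x)"
proof -
  \<comment> \<open>For a unit vector \<open>x\<close> the matrix \<open>x x\<^sup>*\<close> is a
    projection, so phase reflections along \<open>x\<close> multiply like their phases, and inverse
    phases give inverse matrices.\<close>
  have key: "phase_reflection v x ** phase_reflection w x = mat 1" if "v * w = 1" for v w
  proof -
    have "(phase_reflection v x ** phase_reflection w x) $ i $ j = mat 1 $ i $ j" for i j
    proof -
      have "(phase_reflection v x ** phase_reflection w x) $ i $ j
        = (\<Sum>k\<in>UNIV. (if i = k then 1 else 0) * (if k = j then 1 else 0)
            + (if i = k then (w - 1) * (x $ k * cnj (x $ j)) else 0)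
            + (if k = j then (v - 1) * (x $ i * cnj (x $ k)) else 0)
            + (v - 1) * (w - 1) * x $ i * cnj (x $ j) * (x $ k * cnj (x $ k)))"
        unfolding mult_nth phase_reflection_def by (intro sum.cong refl) (auto simp: algebra_simps)
      also have "\<dots> = (if i = j then 1 else 0) + (w - 1) * (x $ i * cnj (x $ j)) + (v - 1) * (x $ i * cnj (x $ j))
         + (v - 1) * (w - 1) * x $ i * cnj (x $ j)"
        unfolding sum.distrib sum_distrib_left[symmetric] assms(1)
        by (simp add: if_distrib[of "\<lambda>x. x * _"] cong: if_cong)
      also have "\<dots> = (if i = j then 1 else 0) + (v * w - 1) * (x $ i * cnj (x $ j))"
        by (simp add: algebra_simps)
      finally show ?thesis using that by (simp add: mat_def)
    qed
    then show ?thesis by (simp add: vec_eq_iff)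
  qed
  have adj: "adj (phase_reflection w x) = phase_reflection (cnj w) x"
    by (auto simp: vec_eq_iff adj_nth phase_reflection_def)
  show ?thesis
    unfolding unitary_matrix_def adj using key[of w "cnj w"] key[of "cnj w" w] assms(2)
    by (simp add: mult.commute)
qed

text \<open>Reality of the form is part of the requirement; over the complex numbers this alone
  forces Hermitian symmetry.\<close>

definition psd_matrix :: "complex^'n^'n \<Rightarrow> bool" where
  "psd_matrix B \<longleftrightarrow> (\<forall>x. \<exists>r\<ge>0. (\<Sum>i\<in>UNIV. \<Sum>j\<in>UNIV. cnj (x $ i) * B $ i $ j * x $ j) = complex_of_real r)"

lemma trace_phase_reflection:
  "trace (phase_reflection w x ** B) = trace B + (w - 1) * (\<Sum>i\<in>UNIV. \<Sum>j\<in>UNIV. cnj (x $ i) * B $ i $ j * x $ j)"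
proof -
  have "trace (phase_reflection w x ** B) = (\<Sum>j\<in>UNIV. \<Sum>i\<in>UNIV. (if j = i then B $ i $ j else 0)
      + (w - 1) * (cnj (x $ i) * B $ i $ j * x $ j))"
    unfolding trace_def mult_nth phase_reflection_def by (intro sum.cong refl) (auto simp: algebra_simps)
  also have "\<dots> = trace B + (w - 1) * (\<Sum>j\<in>UNIV. \<Sum>i\<in>UNIV. cnj (x $ i) * B $ i $ j * x $ j)"
    by (simp add: sum.distrib sum_distrib_left trace_def)
  finally show ?thesis by (subst (asm) sum.swap)
qed

lemma phase_exists: obtains w where "w * cnj w = 1" "w * z = complex_of_real (cmod z)"
proof (cases "z = 0")
  case False
  show ?thesis
  proof (rule that[of "cnj z / cmod z"])
    have "z * cnj z = cmod z * cmod z" by (metis complex_norm_square of_real_mult power2_eq_square)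
    with False show "cnj z / cmod z * cnj (cnj z / cmod z) = 1" "cnj z / cmod z * z = cmod z"
      by (simp_all add: mult.commute)
  qed
qed (use that[of 1] in simp)

text \<open>If q is the value of the form at a unit vector, the phase reflections give Re ((w - 1)
  q) \<le> 0 for every phase w. Choosing w with w q = |q| yields |q| \<le> Re q, so q is real and
  nonnegative.\<close>

lemma psd_matrixI:
  fixes B :: "complex^'n^'n"
  assumes "\<And>W. unitary_matrix W \<Longrightarrow> Re (trace (W ** B)) \<le> Re (trace B)"
  shows "psd_matrix B"
  unfolding psd_matrix_def
proof
  fix x :: "complex^'n"
  let ?q = "\<lambda>x::complex^'n. \<Sum>i\<in>UNIV. \<Sum>j\<in>UNIV. cnj (x $ i) * B $ i $ j * x $ j"
  show "\<exists>r\<ge>0. ?q x = complex_of_real r"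
  proof (cases "x = 0")
    case False
    define y where "y = x /\<^sub>R norm x"
    have ny: "norm y = 1" using False by (simp add: y_def)
    have "(\<Sum>i\<in>UNIV. y $ i * cnj (y $ i)) = complex_of_real ((norm y)\<^sup>2)"
      unfolding norm_vec_def L2_set_def complex_norm_square[symmetric] by (simp add: sum_nonneg)
    then have y1: "(\<Sum>i\<in>UNIV. y $ i * cnj (y $ i)) = 1" by (simp add: ny)
    have le: "Re ((w - 1) * ?q y) \<le> 0" if "w * cnj w = 1" for w
      using assms[OF unitary_phase_reflection[OF y1 that]] by (simp add: trace_phase_reflection)
    have q: "z = complex_of_real (cmod z)" if le: "\<And>w. w * cnj w = 1 \<Longrightarrow> Re ((w - 1) * z) \<le> 0" for z
    proof -
      obtain w where w: "w * cnj w = 1" "w * z = cmod z"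
        using phase_exists by blast
      from le[OF w(1)] w(2) have "cmod z \<le> Re z" by (simp add: left_diff_distrib del: times_complex.simps)
      then have "Re z = cmod z" using complex_Re_le_cmod[of z] by linarith
      moreover from this have "Im z = 0"
        using cmod_power2[of z] by simp
      ultimately show ?thesis by (simp add: complex_eq_iff)
    qed
    have "?q x = complex_of_real ((norm x)\<^sup>2) * ?q y"
    proof -
      have "x $ i = complex_of_real (norm x) * y $ i" for i
        using False by (simp add: y_def scaleR_conv_of_real[of _ "x $ i"])
      then show ?thesis
        unfolding sum_distrib_left by (intro sum.cong refl) (simp add: power2_eq_square)
    qed
    then have "?q x = complex_of_real ((norm x)\<^sup>2 * cmod (?q y))" using q[OF le] by (simp only: of_real_mult)
    then show ?thesis by (intro exI[of _ "(norm x)\<^sup>2 * cmod (?q y)"]) simp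
  qed simp
qed

lemma psd_matrix_diag:
  assumes "psd_matrix B" shows "\<exists>r\<ge>0. B $ i $ i = complex_of_real r"
proof -
  have "(\<Sum>k\<in>UNIV. \<Sum>l\<in>UNIV. cnj (axis i 1 $ k) * B $ k $ l * axis i 1 $ l)
    = (\<Sum>k\<in>UNIV. \<Sum>l\<in>UNIV. if k = i then if l = i then B $ k $ l else 0 else 0)"
    by (intro sum.cong refl) (auto simp: axis_def)
  also have "\<dots> = B $ i $ i"
    by (subst sum.swap) simp
  finally show ?thesis using assms unfolding psd_matrix_def by metis
qed

text \<open>Polarisation: the form is real at \<open>axis i 1 + axis j w\<close>. The phase w = 1
  makes the imaginary parts of the two entries opposite, and w = \<i> makes their real parts
  equal.\<close>

lemma psd_matrix_hermitian:
  assumes "psd_matrix B" shows "B $ j $ i = cnj (B $ i $ j)"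
proof (cases "i = j")
  case True
  then show ?thesis using psd_matrix_diag[OF assms, of i] by auto
next
  case False
  have *: "\<exists>r. w * B $ i $ j + cnj w * B $ j $ i = complex_of_real r" if "w * cnj w = 1" for w
  proof -
    let ?x = "axis i 1 + axis j w"
    have "(\<Sum>k\<in>UNIV. \<Sum>l\<in>UNIV. cnj (?x $ k) * B $ k $ l * ?x $ l)
      = (\<Sum>k\<in>UNIV. \<Sum>l\<in>UNIV. if k = i then (if l = i then B $ k $ l else 0) + (if l = j then w * B $ k $ l else 0)
          else if k = j then (if l = i then cnj w * B $ k $ l else 0) + (if l = j then w * cnj w * B $ k $ l else 0) else 0)"
      using False by (intro sum.cong refl) (auto simp: axis_def)
    also have "\<dots> = (\<Sum>k\<in>UNIV. if k = i then B $ k $ i + w * B $ k $ j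
          else if k = j then cnj w * B $ k $ i + B $ k $ j else 0)"
      using that by (intro sum.cong refl) (auto simp: sum.distrib)
    also have "\<dots> = (\<Sum>k\<in>UNIV. (if k = i then B $ k $ i + w * B $ k $ j else 0)
          + (if k = j then cnj w * B $ k $ i + B $ k $ j else 0))"
      using False by (intro sum.cong refl) auto
    also have "\<dots> = B $ i $ i + B $ j $ j + w * B $ i $ j + cnj w * B $ j $ i"
      by (simp add: sum.distrib)
    finally have eq: "B $ i $ i + B $ j $ j + w * B $ i $ j + cnj w * B $ j $ i
      = (\<Sum>k\<in>UNIV. \<Sum>l\<in>UNIV. cnj (?x $ k) * B $ k $ l * ?x $ l)" ..
    obtain r where "B $ i $ i + B $ j $ j + w * B $ i $ j + cnj w * B $ j $ i = complex_of_real r"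
      unfolding eq using assms unfolding psd_matrix_def by metis
    moreover obtain p q where "B $ i $ i = complex_of_real p" "B $ j $ j = complex_of_real q"
      using psd_matrix_diag[OF assms] by metis
    ultimately have "w * B $ i $ j + cnj w * B $ j $ i = complex_of_real (r - p - q)"
      by (simp add: algebra_simps)
    then show ?thesis ..
  qed
  from *[of 1] *[of \<i>] show ?thesis
    by (auto simp: complex_eq_iff)
qed

text \<open>The singular values are indexed by the matrix index type and left unsorted, so limits
  can be taken index by index.\<close>

definition svd :: "complex^'n^'n \<Rightarrow> complex^'n^'n \<Rightarrow> ('n \<Rightarrow> real) \<Rightarrow> complex^'n^'n \<Rightarrow> bool" where
  "svd X U s V \<longleftrightarrow> unitary_matrix U \<and> unitary_matrix V \<and> (\<forall>i. 0 \<le> s i) \<and>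
    X = U ** real_diag s ** adj V"

text \<open>A pair of unitaries maximising \<open>Re tr (C U\<^sup>* X V)\<close>, for a fixed diagonal \<open>C\<close> with distinct positive
  entries, makes both \<open>M C\<close> and \<open>C M\<close> positive semidefinite, where \<open>M = U\<^sup>* X V\<close>; this forces \<open>M\<close> to be
  diagonal.\<close>

lemma svd_exists:
  fixes X :: "complex^'n^'n"
  obtains U s V where "svd X U s V"
proof -
  obtain c0 :: "'n \<Rightarrow> nat" where "inj c0"
    using finite_imp_inj_to_nat_seg[of "UNIV :: 'n set"] by auto
  \<comment> \<open>The successor keeps the entries away from 0; the diagonal of \<open>M\<close> is
    later recovered by dividing by \<open>c i\<close>.\<close>
  define c where "c i = real (Suc (c0 i))" for i
  have cpos: "c i > 0" for i by (simp add: c_def)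
  have cinj: "c i = c j \<longleftrightarrow> i = j" for i j using \<open>inj c0\<close> by (auto simp: c_def inj_def)
  define f where "f = (\<lambda>(U, V). Re (trace (adj U ** X ** V ** real_diag c)))"
  have "continuous_on UNIV f"
    unfolding f_def case_prod_beta trace_def
    by (intro continuous_intros matmul.continuous_on bounded_linear.continuous_on[OF bounded_linear_adj])
  moreover have "compact ({U::complex^'n^'n. unitary_matrix U} \<times> {U::complex^'n^'n. unitary_matrix U})"
    by (intro compact_Times compact_unitary)
  moreover have "unitary_matrix (mat 1 :: complex^'n^'n)"
    by (simp add: unitary_matrix_def adj_mat)
  then have "({U::complex^'n^'n. unitary_matrix U} \<times> {U::complex^'n^'n. unitary_matrix U}) \<noteq> {}" by auto
  ultimately obtain p where p: "p \<in> {U. unitary_matrix U} \<times> {U. unitary_matrix U}"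
    "\<forall>q \<in> {U. unitary_matrix U} \<times> {U. unitary_matrix U}. f q \<le> f p"
    using continuous_attains_sup continuous_on_subset[OF _ subset_UNIV] by meson
  obtain U V where UV: "p = (U, V)" by fastforce
  have U: "unitary_matrix U" and V: "unitary_matrix V" using p UV by auto
  have max: "f (U', V') \<le> f (U, V)" if "unitary_matrix U'" "unitary_matrix V'" for U' V'
    using p(2) that UV by auto
  define M where "M = adj U ** X ** V"
  have "psd_matrix (M ** real_diag c)"
  proof (rule psd_matrixI)
    fix W :: "complex^'n^'n" assume W: "unitary_matrix W"
    have "f (U ** adj W, V) \<le> f (U, V)"
      by (rule max[OF unitary_mult[OF U unitary_adj[OF W]] V])
    then show "Re (trace (W ** (M ** real_diag c))) \<le> Re (trace (M ** real_diag c))"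
      by (simp add: f_def M_def adj_mult matrix_mul_assoc)
  qed
  note MC = this
  have "psd_matrix (real_diag c ** M)"
  proof (rule psd_matrixI)
    fix W :: "complex^'n^'n" assume W: "unitary_matrix W"
    have "f (U, V ** W) \<le> f (U, V)"
      by (rule max[OF U unitary_mult[OF V W]])
    moreover have "trace (M ** W ** real_diag c) = trace (W ** (real_diag c ** M))"
      by (metis matrix_mul_assoc trace_mul_sym)
    moreover have "trace (M ** real_diag c) = trace (real_diag c ** M)"
      by (rule trace_mul_sym)
    ultimately show "Re (trace (W ** (real_diag c ** M))) \<le> Re (trace (real_diag c ** M))"
      by (simp add: f_def M_def matrix_mul_assoc)
  qed
  note CM = this
  have off: "M $ i $ j = 0" if "i \<noteq> j" for i j
  proof -
    have 1: "M $ j $ i * c i = cnj (M $ i $ j) * c j"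
      using psd_matrix_hermitian[OF MC, of j i] by (simp add: real_diag_right)
    have 2: "c j * M $ j $ i = c i * cnj (M $ i $ j)"
      using psd_matrix_hermitian[OF CM, of j i] by (simp add: real_diag_left)
    \<comment> \<open>Both symmetry relations express \<open>c i * c j * M $ j $ i\<close> through
      \<open>cnj (M $ i $ j)\<close>, once with factor \<open>c i\<close> squared and once with
      \<open>c j\<close> squared.\<close>
    have "complex_of_real ((c i)\<^sup>2) * (cnj (M $ i $ j)) = c i * (c j * M $ j $ i)"
      unfolding 2 by (simp add: power2_eq_square)
    also have "\<dots> = c j * (M $ j $ i * c i)" by simp
    also have "\<dots> = complex_of_real ((c j)\<^sup>2) * cnj (M $ i $ j)"
      unfolding 1 by (simp add: power2_eq_square)
    finally have "M $ i $ j = 0 \<or> (c i)\<^sup>2 = (c j)\<^sup>2"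
      unfolding mult_cancel_right of_real_eq_iff by auto
    moreover have "(c i)\<^sup>2 \<noteq> (c j)\<^sup>2" using that cinj cpos[of i] cpos[of j]
      by (metis less_imp_le power2_eq_imp_eq)
    ultimately show ?thesis by simp
  qed
  have diag: "\<exists>r\<ge>0. M $ i $ i = complex_of_real r" for i
  proof -
    obtain r where r: "r \<ge> 0" "M $ i $ i * c i = complex_of_real r"
      using psd_matrix_diag[OF MC, of i] by (auto simp: real_diag_right)
    then have "M $ i $ i = complex_of_real (r / c i)" using cpos[of i]
      by (simp add: field_simps)
    then show ?thesis using r(1) cpos[of i] by (intro exI[of _ "r / c i"]) auto
  qed
  then obtain s where s: "\<And>i. s i \<ge> 0" "\<And>i. M $ i $ i = complex_of_real (s i)" by metis
  have "M = real_diag s" using off s(2) by (auto simp: vec_eq_iff real_diag_def)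
  moreover have "U ** M ** adj V = X"
    by (simp add: M_def matrix_mul_assoc unitary_cancel U V)
  ultimately have "svd X U s V" unfolding svd_def using U V s(1) by simp
  then show ?thesis by (rule that)
qed

section \<open>Functions of the absolute value\<close>

definition abs_fun :: "(real \<Rightarrow> real) \<Rightarrow> complex^'n^'n \<Rightarrow> complex^'n^'n" where
  "abs_fun f X = hermitian_fun f (matrix_abs X)"

lemma phi_map_abs_fun: "phi_map \<phi>1 \<phi>2 X = abs_fun \<phi>1 X - abs_fun \<phi>2 (adj X)"
  by (simp add: phi_map_def abs_fun_def)

lemma svd_adj: "svd X U s V \<Longrightarrow> svd (adj X) V s U"
  by (auto simp: svd_def adj_mult matrix_mul_assoc)

lemma svd_gram: "svd X U s V \<Longrightarrow> adj X ** X = V ** real_diag (\<lambda>i. (s i)\<^sup>2) ** adj V"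
proof -
  assume a: "svd X U s V"
  then have U: "unitary_matrix U" by (simp add: svd_def)
  have "adj X ** X = V ** real_diag s ** (adj U ** U) ** real_diag s ** adj V"
    using a by (simp add: svd_def adj_mult matrix_mul_assoc)
  also have "\<dots> = V ** (real_diag s ** real_diag s) ** adj V"
    by (simp add: unitary_cancel U matrix_mul_assoc)
  finally show ?thesis by (simp add: real_diag_mult power2_eq_square)
qed

lemma svd_matrix_abs: "svd X U s V \<Longrightarrow> matrix_abs X = V ** real_diag s ** adj V"
  unfolding matrix_abs_def
  by (subst svd_gram, assumption, subst hermitian_fun_unitary_diag) (auto simp: svd_def)

text \<open>The right singular vectors diagonalise |X| and, through \<open>svd_adj\<close>, the left
  ones diagonalise |adj X|. Both parts of \<open>phi_map\<close> are thus diagonal in frames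
  supplied by one decomposition.\<close>

lemma svd_abs_fun: "svd X U s V \<Longrightarrow> abs_fun f X = V ** real_diag (\<lambda>i. f (s i)) ** adj V"
  unfolding abs_fun_def by (subst svd_matrix_abs, assumption, subst hermitian_fun_unitary_diag) (auto simp: svd_def)

lemma adj_abs_fun [simp]: "adj (abs_fun f X) = abs_fun f X"
proof -
  obtain U s V where "svd X U s V" by (rule svd_exists)
  from svd_abs_fun[OF this, of f] show ?thesis by (simp add: adj_mult matrix_mul_assoc)
qed

lemma adj_phi_map [simp]: "adj (phi_map \<phi>1 \<phi>2 X) = phi_map \<phi>1 \<phi>2 X"
  by (simp add: phi_map_abs_fun adj_diff)

text \<open>The spectrum of \<open>matrix_abs X\<close> is the set of singular values. From here on
  the spectral condition is only used in this form.\<close>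

lemma svd_matrices_upto_iff:
  fixes X :: "complex^'n^'n"
  assumes "svd X U s V"
  shows "X \<in> matrices_upto b \<longleftrightarrow> (\<forall>i. s i \<le> b)"
proof -
  have V: "unitary_matrix V" using assms by (simp add: svd_def)
  have eq: "matrix_abs X - mat z = V ** (\<chi> i j. if i = j then complex_of_real (s i) - z else 0) ** adj V" for z
  proof -
    have "(\<chi> i j. if i = j then complex_of_real (s i) - z else 0) = real_diag s - mat z"
      by (auto simp: vec_eq_iff real_diag_def mat_def)
    moreover have "V ** mat z ** adj V = mat z"
    proof -
      have "V ** mat z = mat z ** V"
        by (auto simp: vec_eq_iff mult_nth mat_def if_distrib[of "\<lambda>x. _ * x"] if_distrib[of "\<lambda>x. x * _"] cong: if_cong)
      then show ?thesis by (simp add: unitary_cancel V)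
    qed
    ultimately show ?thesis by (simp add: svd_matrix_abs[OF assms] matrix_simps)
  qed
  have "matrix_spectrum (matrix_abs X) = range (\<lambda>i. complex_of_real (s i))"
  proof (intro set_eqI iffI)
    fix z assume z: "z \<in> matrix_spectrum (matrix_abs X)"
    show "z \<in> range (\<lambda>i. complex_of_real (s i))"
    proof (rule ccontr)
      assume n: "z \<notin> range (\<lambda>i. complex_of_real (s i))"
      define D :: "complex^'n^'n" where "D = (\<chi> i j. if i = j then complex_of_real (s i) - z else 0)"
      define E :: "complex^'n^'n" where "E = (\<chi> i j. if i = j then 1 / (complex_of_real (s i) - z) else 0)"
      have "D ** E = mat 1" "E ** D = mat 1"
        using n by (auto simp: D_def E_def vec_eq_iff mult_nth mat_def if_distrib[of "\<lambda>x. x * _"] if_distrib[of "\<lambda>x. _ * x"] cong: if_cong)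
      moreover have "V ** A ** adj V ** (V ** B ** adj V) = V ** (A ** B) ** adj V" for A B
        by (simp add: matrix_mul_assoc unitary_cancel V)
      ultimately have "V ** D ** adj V ** (V ** E ** adj V) = mat 1" "V ** E ** adj V ** (V ** D ** adj V) = mat 1"
        by (simp_all add: unitary_cancel V)
      then have "invertible (matrix_abs X - mat z)" unfolding eq D_def[symmetric] invertible_def by blast
      then show False using z by (simp add: matrix_spectrum_def)
    qed
  next
    fix z assume "z \<in> range (\<lambda>i. complex_of_real (s i))"
    then obtain k where k: "z = complex_of_real (s k)" by auto
    have "\<not> invertible (matrix_abs X - mat z)"
    proof
      define D :: "complex^'n^'n" where "D = (\<chi> i j. if i = j then complex_of_real (s i) - z else 0)"
      assume "invertible (matrix_abs X - mat z)"
      then obtain B where B: "B ** (V ** D ** adj V) = mat 1" unfolding eq D_def invertible_def by blast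
      \<comment> \<open>Column \<open>k\<close> of \<open>D\<close> vanishes, so no matrix times
        \<open>D\<close> can have the entry 1 at position (k, k).\<close>
      have "adj V ** B ** V ** D = adj V ** (B ** (V ** D ** adj V)) ** V"
        by (simp add: matrix_mul_assoc unitary_cancel V)
      also have "\<dots> = mat 1" unfolding B by (simp add: unitary_cancel V)
      finally have "(adj V ** B ** V ** D) $ k $ k = 1" by (simp add: mat_def)
      moreover have "D $ l $ k = 0" for l by (simp add: D_def k)
      ultimately show False by (simp add: mult_nth)
    qed
    then show "z \<in> matrix_spectrum (matrix_abs X)" by (simp add: matrix_spectrum_def)
  qed
  then show ?thesis using assms
    by (simp add: matrices_upto_def svd_def image_subset_iff image_iff)
qed

lemma adj_matrices_upto [simp]: "adj X \<in> matrices_upto b \<longleftrightarrow> X \<in> matrices_upto b"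
proof -
  obtain U s V where "svd X U s V" by (rule svd_exists)
  then show ?thesis using svd_matrices_upto_iff svd_adj by blast
qed

lemma abs_fun_cong:
  assumes "X \<in> matrices_upto b" "\<And>x. x \<in> {0..b} \<Longrightarrow> f x = g x"
  shows "abs_fun f X = abs_fun g X"
proof -
  obtain U s V where s: "svd X U s V" by (rule svd_exists)
  then have "f (s i) = g (s i)" for i using assms svd_matrices_upto_iff[OF s, of b] by (auto simp: svd_def)
  then show ?thesis by (simp add: svd_abs_fun[OF s])
qed

lemma norm_abs_fun_le:
  fixes X :: "complex^'n^'n"
  assumes "\<And>x. 0 \<le> x \<Longrightarrow> \<bar>f x\<bar> \<le> c"
  shows "norm (abs_fun f X) \<le> (real CARD('n))\<^sup>2 * c"
proof -
  obtain U s V where s: "svd X U s V" by (rule svd_exists)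
  then have V: "unitary_matrix V" by (simp add: svd_def)
  have "norm (abs_fun f X) = norm (real_diag (\<lambda>i. f (s i)) :: complex^'n^'n)"
    unfolding svd_abs_fun[OF s] by (rule unitary_norm[OF V unitary_adj[OF V]])
  also have "\<dots> \<le> (real CARD('n))\<^sup>2 * c"
    using s assms order_trans[OF abs_ge_zero assms[OF order_refl]]
    by (intro norm_le_entries) (auto simp: real_diag_def svd_def)
  finally show ?thesis .
qed

lemma norm_svd:
  fixes X :: "complex^'n^'n"
  assumes "svd X U s V" shows "norm X = norm (real_diag s :: complex^'n^'n)"
  using assms unitary_norm unitary_adj by (auto simp: svd_def)

lemma singular_value_le_norm:
  assumes "svd X U s V" shows "s i \<le> norm X"
  using norm_nth_nth_le[of "real_diag s" i i] assms norm_svd[OF assms]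
  by (simp add: real_diag_def svd_def)

lemma norm_matrices_upto_le:
  assumes "(X::complex^'n^'n) \<in> matrices_upto b" "0 \<le> b"
  shows "norm X \<le> (real CARD('n))\<^sup>2 * b"
proof -
  obtain U s V where s: "svd X U s V" by (rule svd_exists)
  then show ?thesis using assms svd_matrices_upto_iff[OF s, of b]
    by (subst norm_svd[OF s], intro norm_le_entries) (auto simp: real_diag_def svd_def)
qed

text \<open>Writing \<open>\<beta> = V\<^sup>* K V'\<close> and \<open>e1, e2\<close> for the coordinates of the two differences on the right, one has
  \<open>(s\<^sub>i\<^sup>2 - t\<^sub>j\<^sup>2) \<beta> = s\<^sub>i e1 + t\<^sub>j e2\<close>, so \<open>\<bar>s\<^sub>i - t\<^sub>j\<bar> \<bar>\<beta>\<bar> \<le> \<bar>e1\<bar> + \<bar>e2\<bar>\<close> because \<open>s\<^sub>i, t\<^sub>j \<ge> 0\<close>.\<close>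

lemma norm_abs_fun_intertwine_le:
  fixes X Y K K' :: "complex^'n^'n"
  assumes lip: "\<And>x y. 0 \<le> x \<Longrightarrow> 0 \<le> y \<Longrightarrow> \<bar>f x - f y\<bar> \<le> L * \<bar>x - y\<bar>" and L: "0 \<le> L"
  shows "norm (abs_fun f X ** K - K ** abs_fun f Y)
    \<le> (real CARD('n))\<^sup>2 * (L * (norm (X ** K - K' ** Y) + norm (adj X ** K' - K ** adj Y)))"
proof -
  obtain U s V where X: "svd X U s V" by (rule svd_exists)
  obtain U' t V' where Y: "svd Y U' t V'" by (rule svd_exists)
  have u: "unitary_matrix U" "unitary_matrix V" "unitary_matrix U'" "unitary_matrix V'"
    and XY: "X = U ** real_diag s ** adj V" "Y = U' ** real_diag t ** adj V'"
    and nonneg: "s i \<ge> 0" "t i \<ge> 0" for i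
    using X Y by (auto simp: svd_def)
  define \<beta> where "\<beta> = adj V ** K ** V'"
  define \<beta>' where "\<beta>' = adj U ** K' ** U'"
  define E1 where "E1 = X ** K - K' ** Y"
  define E2 where "E2 = adj X ** K' - K ** adj Y"
  have e1: "s i * \<beta> $ i $ j - \<beta>' $ i $ j * t j = (adj U ** E1 ** V') $ i $ j" for i j
  proof -
    have "adj U ** E1 ** V' = real_diag s ** \<beta> - \<beta>' ** real_diag t"
      by (simp add: E1_def XY \<beta>_def \<beta>'_def matrix_simps unitary_cancel u)
    then show ?thesis by (simp add: real_diag_left real_diag_right)
  qed
  have e2: "s i * \<beta>' $ i $ j - \<beta> $ i $ j * t j = (adj V ** E2 ** U') $ i $ j" for i j
  proof -
    have "adj V ** E2 ** U' = real_diag s ** \<beta>' - \<beta> ** real_diag t"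
      by (simp add: E2_def XY \<beta>_def \<beta>'_def matrix_simps unitary_cancel u)
    then show ?thesis by (simp add: real_diag_left real_diag_right)
  qed
  let ?M = "adj V ** (abs_fun f X ** K - K ** abs_fun f Y) ** V'"
  have "norm (abs_fun f X ** K - K ** abs_fun f Y) = norm ?M"
    by (simp add: unitary_norm unitary_adj u)
  also have "\<dots> \<le> (real CARD('n))\<^sup>2 * (L * (norm E1 + norm E2))"
  proof (rule norm_le_entries)
    fix i j
    have "?M = real_diag (\<lambda>i. f (s i)) ** \<beta> - \<beta> ** real_diag (\<lambda>i. f (t i))"
      by (simp add: svd_abs_fun[OF X] svd_abs_fun[OF Y] \<beta>_def matrix_simps unitary_cancel u)
    then have "?M $ i $ j = (real_diag (\<lambda>i. f (s i)) ** \<beta> - \<beta> ** real_diag (\<lambda>i. f (t i))) $ i $ j"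
      by (rule arg_cong)
    also have "\<dots> = complex_of_real (f (s i) - f (t j)) * \<beta> $ i $ j"
      by (simp add: real_diag_left real_diag_right algebra_simps)
    finally have "?M $ i $ j = complex_of_real (f (s i) - f (t j)) * \<beta> $ i $ j" .
    then have "cmod (?M $ i $ j) = \<bar>f (s i) - f (t j)\<bar> * cmod (\<beta> $ i $ j)"
      by (simp add: norm_mult del: of_real_diff)
    also have "\<dots> \<le> L * \<bar>s i - t j\<bar> * cmod (\<beta> $ i $ j)"
      by (intro mult_right_mono lip nonneg) auto
    finally have 1: "cmod (?M $ i $ j) \<le> L * \<bar>s i - t j\<bar> * cmod (\<beta> $ i $ j)" .
    have "\<bar>s i - t j\<bar> * cmod (\<beta> $ i $ j) \<le> norm E1 + norm E2"
    proof (cases "s i + t j = 0")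
      case True
      then have "s i = 0" "t j = 0" using nonneg[of i] nonneg[of j] by linarith+
      then show ?thesis by simp
    next
      case False
      then have pos: "s i + t j > 0" using nonneg[of i] nonneg[of j] by linarith
      define x where "x = (adj U ** E1 ** V') $ i $ j"
      define y where "y = (adj V ** E2 ** U') $ i $ j"
      have "complex_of_real (s i - t j) * complex_of_real (s i + t j) * \<beta> $ i $ j = s i * x + t j * y"
        unfolding x_def y_def e1[symmetric] e2[symmetric] by (simp add: algebra_simps)
      then have "cmod (complex_of_real (s i - t j) * complex_of_real (s i + t j) * \<beta> $ i $ j) = cmod (s i * x + t j * y)"
        by simp
      then have "(s i + t j) * (\<bar>s i - t j\<bar> * cmod (\<beta> $ i $ j)) = cmod (s i * x + t j * y)"
        using pos by (simp add: norm_mult mult_ac del: of_real_diff of_real_add)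
      also have "\<dots> \<le> s i * cmod x + t j * cmod y"
        using nonneg[of i] nonneg[of j] by (intro order_trans[OF norm_triangle_ineq]) (simp add: norm_mult)
      also have "\<dots> \<le> s i * norm E1 + t j * norm E2"
        using norm_nth_nth_le[of "adj U ** E1 ** V'" i j] norm_nth_nth_le[of "adj V ** E2 ** U'" i j] nonneg
        by (intro add_mono mult_left_mono) (simp_all add: unitary_norm unitary_adj u x_def y_def)
      also have "\<dots> \<le> (s i + t j) * (norm E1 + norm E2)"
        using nonneg[of i] nonneg[of j] by (simp add: algebra_simps)
      finally show ?thesis using pos by simp
    qed
    from mult_left_mono[OF this L] 1 show "cmod (?M $ i $ j) \<le> L * (norm E1 + norm E2)"
      by (simp only: mult.assoc)
  qed
  finally show ?thesis by (simp add: E1_def E2_def)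
qed

section \<open>Differential equations on a half-line\<close>

lemma at_within_atLeast_interior: "a < t \<Longrightarrow> at t within {a..} = at (t::real)"
  by (rule at_within_interior) simp

text \<open>The derivative at \<open>a\<close> is only one-sided, so the mean value argument uses
  interior points and continuity at the end.\<close>

lemma antimono_on_halfline:
  fixes f :: "real \<Rightarrow> real"
  assumes deriv: "\<And>t. a \<le> t \<Longrightarrow> (f has_vector_derivative f' t) (at t within {a..})"
    and "\<And>t. a \<le> t \<Longrightarrow> f' t \<le> 0"
    and "a \<le> s" "s \<le> t"
  shows "f t \<le> f s"
proof (cases "s < t")
  case True
  show ?thesis
  proof (rule DERIV_nonpos_imp_decreasing_open[OF less_imp_le[OF True]])
    fix x assume x: "s < x" "x < t"
    then have "(f has_real_derivative f' x) (at x)"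
      using deriv[of x] assms(3) at_within_atLeast_interior[of a x]
      by (simp add: has_real_derivative_iff_has_vector_derivative)
    then show "\<exists>y. (f has_real_derivative y) (at x) \<and> y \<le> 0" using assms(2)[of x] x assms(3) by auto
  next
    have "continuous_on {a..} f"
      using deriv by (intro continuous_on_vector_derivative) auto
    then show "continuous_on {s..t} f" by (rule continuous_on_subset) (use assms(3) in auto)
  qed
qed (use assms in auto)

text \<open>The weight \<open>exp (- 2 * C * t)\<close> makes the squared norm non-increasing. This
  serves both for uniqueness of solutions and for the persistence of polynomial identities.\<close>

lemma gronwall_zero:
  fixes u :: "real \<Rightarrow> 'a::real_inner"
  assumes deriv: "\<And>t. 0 \<le> t \<Longrightarrow> (u has_vector_derivative u' t) (at t within {0..})"
    and le: "\<And>t. 0 \<le> t \<Longrightarrow> u t \<bullet> u' t \<le> C * (norm (u t))\<^sup>2"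
    and "u 0 = 0" "0 \<le> t"
  shows "u t = 0"
proof -
  have "exp (- 2 * C * t) * (u t \<bullet> u t) \<le> exp (- 2 * C * 0) * (u 0 \<bullet> u 0)"
  proof (rule antimono_on_halfline[where a = 0 and f = "\<lambda>t. exp (- 2 * C * t) * (u t \<bullet> u t)"
      and f' = "\<lambda>t. exp (- 2 * C * t) * (u t \<bullet> u' t + u' t \<bullet> u t) + exp (- 2 * C * t) * (- 2 * C) * (u t \<bullet> u t)"])
    fix t :: real assume t: "0 \<le> t"
    show "((\<lambda>t. exp (- 2 * C * t) * (u t \<bullet> u t)) has_vector_derivative
        exp (- 2 * C * t) * (u t \<bullet> u' t + u' t \<bullet> u t) + exp (- 2 * C * t) * (- 2 * C) * (u t \<bullet> u t)) (at t within {0..})"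
      by (intro has_vector_derivative_mult bounded_bilinear.has_vector_derivative[OF bounded_bilinear_inner] deriv t)
         (auto intro!: derivative_eq_intros simp flip: has_real_derivative_iff_has_vector_derivative)
    have "u t \<bullet> u' t + u' t \<bullet> u t \<le> 2 * C * (u t \<bullet> u t)"
      using le[OF t] by (simp add: inner_commute power2_norm_eq_inner)
    then have "exp (- 2 * C * t) * (u t \<bullet> u' t + u' t \<bullet> u t) \<le> exp (- 2 * C * t) * (2 * C * (u t \<bullet> u t))"
      by (rule mult_left_mono) simp
    then show "exp (- 2 * C * t) * (u t \<bullet> u' t + u' t \<bullet> u t) + exp (- 2 * C * t) * (- 2 * C) * (u t \<bullet> u t) \<le> 0"
      by (simp add: algebra_simps)
  qed (use assms in auto)
  then have "u t \<bullet> u t \<le> 0" using assms(3) by (simp add: mult_le_0_iff)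
  then show ?thesis by (metis inner_gt_zero_iff not_le)
qed

text \<open>An integrable speed gives finite length: increments of \<open>z\<close> are dominated by
  those of \<open>- (K / c) * exp (- c * t)\<close>. The limit is found along the integers and then
  compared with \<open>z t\<close> by the same bound.\<close>

lemma exponential_decay_convergent:
  fixes z :: "real \<Rightarrow> 'a::banach"
  assumes deriv: "\<And>t. 0 \<le> t \<Longrightarrow> (z has_vector_derivative z' t) (at t within {0..})"
    and le: "\<And>t. t0 \<le> t \<Longrightarrow> norm (z' t) \<le> K * exp (- c * t)"
    and c: "c > 0" and t0: "t0 \<ge> 0"
  shows "\<exists>l. (z \<longlongrightarrow> l) at_top"
proof -
  have z_cont: "continuous_on {0..} z"
    using deriv by (intro continuous_on_vector_derivative) auto
  have K: "K \<ge> 0" using order_trans[OF norm_ge_zero le[OF order_refl]] by (simp add: zero_le_mult_iff)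
  have bound: "norm (z t - z s) \<le> K / c * exp (- c * s)" if "t0 \<le> s" "s \<le> t" for s t
  proof (cases "s = t")
    case False
    have "norm (z t - z s) \<le> - (K / c) * exp (- c * t) - - (K / c) * exp (- c * s)"
    proof (rule differentiable_bound_general)
      show "s < t" using that False by simp
      show "continuous_on {s..t} z" using z_cont by (rule continuous_on_subset) (use that t0 in auto)
      show "continuous_on {s..t} (\<lambda>t. - (K / c) * exp (- c * t))" by (intro continuous_intros)
      fix x assume x: "s < x" "x < t"
      show "(z has_vector_derivative z' x) (at x)"
        using deriv[of x] x that t0 at_within_atLeast_interior[of 0 x] by simp
      show "((\<lambda>t. - (K / c) * exp (- c * t)) has_vector_derivative K * exp (- c * x)) (at x)"
        using c by (auto intro!: derivative_eq_intros simp flip: has_real_derivative_iff_has_vector_derivative)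
      show "norm (z' x) \<le> K * exp (- c * x)" using le x that by simp
    qed
    also have "\<dots> \<le> K / c * exp (- c * s)" using K c by simp
    finally show ?thesis .
  qed (use K c in auto)
  have small: "((\<lambda>t. K / c * exp (- c * t)) \<longlongrightarrow> 0) at_top"
  proof (rule tendsto_mult_right_zero, rule filterlim_compose[OF exp_at_bot])
    show "filterlim (\<lambda>t. - c * t) at_bot at_top"
      by (rule filterlim_tendsto_neg_mult_at_bot[OF tendsto_const _ filterlim_ident]) (use c in auto)
  qed
  have "Cauchy (\<lambda>n. z (real n))"
  proof (rule metric_CauchyI)
    fix e :: real assume "e > 0"
    then have "eventually (\<lambda>t. t \<ge> t0 \<and> K / c * exp (- c * t) < e / 2) at_top"
      using order_tendstoD(2)[OF small, of "e / 2"] by (intro eventually_conj eventually_ge_at_top) simp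
    then obtain T where T: "\<And>t. t \<ge> T \<Longrightarrow> t \<ge> t0 \<and> K / c * exp (- c * t) < e / 2"
      by (auto simp: eventually_at_top_linorder)
    define N where "N = nat \<lceil>T\<rceil>"
    have N: "real N \<ge> T" by (simp add: N_def real_nat_ceiling_ge)
    have *: "dist (z (real n)) (z (real N)) < e / 2" if "n \<ge> N" for n
      unfolding dist_norm by (rule le_less_trans[OF bound[of "real N" "real n"]]) (use T[OF N] that in auto)
    show "\<exists>M. \<forall>m\<ge>M. \<forall>n\<ge>M. dist (z (real m)) (z (real n)) < e"
      using * dist_triangle_half_l by blast
  qed
  then obtain l where l: "(\<lambda>n. z (real n)) \<longlonglongrightarrow> l"
    using Cauchy_convergent_iff convergent_def by blast
  have "norm (z t - l) \<le> K / c * exp (- c * t)" if t: "t \<ge> t0" for t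
  proof (rule tendsto_upperbound)
    show "(\<lambda>n. norm (z t - z (real n))) \<longlonglongrightarrow> norm (z t - l)" by (intro tendsto_intros l)
    show "\<forall>\<^sub>F n in sequentially. norm (z t - z (real n)) \<le> K / c * exp (- c * t)"
      using eventually_ge_at_top[of "nat \<lceil>t\<rceil>"]
    proof eventually_elim
      case (elim n)
      then have "t \<le> real n" by linarith
      then show ?case using bound[OF t, of "real n"] by (simp add: norm_minus_commute)
    qed
  qed simp
  then have "\<forall>\<^sub>F t in at_top. norm (z t - l) \<le> K / c * exp (- c * t)"
    unfolding eventually_at_top_linorder by blast
  then have "((\<lambda>t. z t - l) \<longlongrightarrow> 0) at_top"
    by (rule Lim_null_comparison) (rule small)
  then show ?thesis using LIM_zero_cancel by blast
qed

text \<open>The Picard operator is a contraction for the weighted supremum norm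
  \<open>sup\<^sub>t e\<^bsup>-\<omega>t\<^esup> \<bar>x t\<bar>\<close>; the space of weighted bounded functions is modelled by \<open>y t = e\<^bsup>-\<omega>t\<^esup> x t\<close>.\<close>

lemma picard_global_solution:
  fixes G :: "'a::banach \<Rightarrow> 'a"
  assumes lip: "\<And>x y. norm (G x - G y) \<le> L * norm (x - y)" and M: "\<And>x. norm (G x) \<le> M"
  shows "\<exists>x. x 0 = x0 \<and> (\<forall>t\<ge>0. (x has_vector_derivative G (x t)) (at t within {0..}))"
proof -
  \<comment> \<open>A growth of \<open>exp (\<omega> * s)\<close> integrates to at most
    \<open>exp (\<omega> * t) / \<omega>\<close>, so the Picard operator contracts by
    \<open>\<bar>L\<bar> / \<omega>\<close>, here at most 1/2. The summand 1 keeps the weight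
    positive if \<open>L\<close> is 0.\<close>
  define \<omega> where "\<omega> = 2 * (\<bar>L\<bar> + 1)"
  have \<omega>: "\<omega> > 0" "\<bar>L\<bar> / \<omega> \<le> 1 / 2" by (auto simp: \<omega>_def field_simps)
  have M0: "M \<ge> 0" using order_trans[OF norm_ge_zero M] .
  have lip': "norm (G x - G y) \<le> \<bar>L\<bar> * norm (x - y)" for x y
    using lip[of x y] by (rule order_trans) (intro mult_right_mono, auto)
  have "continuous_on UNIV G"
    unfolding continuous_on_iff
  proof (intro ballI allI impI)
    fix x :: 'a and e :: real assume e: "e > 0"
    show "\<exists>d>0. \<forall>x'\<in>UNIV. dist x' x < d \<longrightarrow> dist (G x') (G x) < e"
    proof (intro exI[of _ "e / (\<bar>L\<bar> + 1)"] conjI ballI impI)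
      show "e / (\<bar>L\<bar> + 1) > 0" using e by (intro divide_pos_pos) auto
      fix x' assume "dist x' x < e / (\<bar>L\<bar> + 1)"
      then have "(\<bar>L\<bar> + 1) * norm (x' - x) < e" by (simp add: dist_norm field_simps add_strict_increasing)
      moreover have "norm (G x' - G x) \<le> (\<bar>L\<bar> + 1) * norm (x' - x)"
        using lip'[of x' x] by (rule order_trans) (intro mult_right_mono, auto)
      ultimately show "dist (G x') (G x) < e" by (simp add: dist_norm)
    qed
  qed
  then have G_cont: "continuous_on S (\<lambda>s. G (f s))" if "continuous_on S f" for S :: "real set" and f
    using that by (rule continuous_on_compose2) auto
  define g where "g y = (\<lambda>s. G (exp (\<omega> * s) *\<^sub>R apply_bcontfun y s))" for y :: "real \<Rightarrow>\<^sub>C 'a"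
  define I where "I y t = integral {0..t} (g y)" for y and t :: real
  have g_cont: "continuous_on S (g y)" for y S
    unfolding g_def by (intro G_cont continuous_intros continuous_on_apply_bcontfun)
  have I_deriv: "(I y has_vector_derivative g y t) (at t within {0..})" if t: "t \<ge> 0" for y t
  proof -
    have "(I y has_vector_derivative g y t) (at t within {0..t + 1})"
      unfolding I_def using t by (intro integral_has_vector_derivative g_cont) auto
    moreover have "at t within {0..t + 1} = at t within {0..}"
      by (rule at_within_nhd[of t "{..< t + 1}"]) auto
    ultimately show ?thesis by simp
  qed
  have I_cont: "continuous_on {0..} (I y)" for y
    using I_deriv by (intro continuous_on_vector_derivative) auto
  have I_bound: "norm (I y t) \<le> M * t" if "t \<ge> 0" for y t
    using integral_bound[OF that g_cont, of y M] M by (simp add: g_def I_def)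
  have I0: "I y 0 = 0" for y by (simp add: I_def)
  have I_lip: "norm (I y t - I z t) \<le> \<bar>L\<bar> / \<omega> * dist y z * exp (\<omega> * t)" if t: "t \<ge> 0" for y z t
  proof (cases "t = 0")
    case False
    have "norm ((I y t - I z t) - (I y 0 - I z 0)) \<le> \<bar>L\<bar> / \<omega> * dist y z * exp (\<omega> * t) - \<bar>L\<bar> / \<omega> * dist y z * exp (\<omega> * 0)"
    proof (rule differentiable_bound_general)
      show "0 < t" using t False by simp
      show "continuous_on {0..t} (\<lambda>t. I y t - I z t)"
        by (intro continuous_intros continuous_on_subset[OF I_cont]) auto
      show "continuous_on {0..t} (\<lambda>t. \<bar>L\<bar> / \<omega> * dist y z * exp (\<omega> * t))"
        by (intro continuous_intros)
      fix x assume x: "0 < x" "x < t"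
      show "((\<lambda>t. I y t - I z t) has_vector_derivative g y x - g z x) (at x)"
        using I_deriv[of x y] I_deriv[of x z] x at_within_atLeast_interior[of 0 x]
        by (auto intro!: derivative_intros)
      show "((\<lambda>t. \<bar>L\<bar> / \<omega> * dist y z * exp (\<omega> * t)) has_vector_derivative \<bar>L\<bar> * (exp (\<omega> * x) * dist y z)) (at x)"
        using \<omega> by (auto intro!: derivative_eq_intros simp flip: has_real_derivative_iff_has_vector_derivative)
      have "norm (g y x - g z x) \<le> \<bar>L\<bar> * norm (exp (\<omega> * x) *\<^sub>R apply_bcontfun y x - exp (\<omega> * x) *\<^sub>R apply_bcontfun z x)"
        unfolding g_def by (rule lip')
      also have "\<dots> = \<bar>L\<bar> * (exp (\<omega> * x) * dist (apply_bcontfun y x) (apply_bcontfun z x))"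
        by (simp add: dist_norm flip: scaleR_diff_right)
      also have "\<dots> \<le> \<bar>L\<bar> * (exp (\<omega> * x) * dist y z)"
        by (intro mult_left_mono dist_bounded) auto
      finally show "norm (g y x - g z x) \<le> \<bar>L\<bar> * (exp (\<omega> * x) * dist y z)" .
    qed
    also have "\<dots> \<le> \<bar>L\<bar> / \<omega> * dist y z * exp (\<omega> * t)" using \<omega> by simp
    finally show ?thesis by (simp add: I0)
  qed (use \<omega> in \<open>simp add: I0\<close>)
  \<comment> \<open>Bounded continuous functions live on the whole line; \<open>max 0 t\<close>
    freezes the values at negative times, which do not enter the integral.\<close>
  define \<Phi> where "\<Phi> y = (\<lambda>t. exp (- \<omega> * max 0 t) *\<^sub>R (x0 + I y (max 0 t)))" for y
  have \<Phi>: "\<Phi> y \<in> bcontfun" for y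
  proof (rule bcontfun_normI)
    show "continuous_on UNIV (\<Phi> y)"
      unfolding \<Phi>_def by (intro continuous_intros continuous_on_compose2[OF I_cont]) auto
    fix t :: real
    let ?t = "max 0 t"
    have "norm (\<Phi> y t) \<le> exp (- \<omega> * ?t) * (norm x0 + M * ?t)"
      unfolding \<Phi>_def using norm_triangle_mono[OF order_refl[of "norm x0"] I_bound[of ?t y]] by simp
    also have "\<dots> \<le> exp (- \<omega> * ?t) * (exp (\<omega> * ?t) * (norm x0 + M / \<omega>))"
    proof (intro mult_left_mono)
      have e: "1 \<le> exp (\<omega> * r)" "r \<le> exp (\<omega> * r) / \<omega>" if "0 \<le> r" for r
      proof -
        have "r * \<omega> \<le> exp (\<omega> * r)"
          using exp_ge_add_one_self[of "\<omega> * r"] unfolding mult.commute[of r] by linarith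
        then show "1 \<le> exp (\<omega> * r)" "r \<le> exp (\<omega> * r) / \<omega>"
          using \<omega>(1) that by (simp_all add: pos_le_divide_eq)
      qed
      have "norm x0 \<le> exp (\<omega> * ?t) * norm x0" using mult_right_mono[OF e(1), of ?t "norm x0"] by simp
      moreover have "M * ?t \<le> M * (exp (\<omega> * ?t) / \<omega>)" using M0 by (intro mult_left_mono e(2)) auto
      ultimately show "norm x0 + M * ?t \<le> exp (\<omega> * ?t) * (norm x0 + M / \<omega>)" by (simp add: algebra_simps)
    qed simp
    also have "\<dots> = norm x0 + M / \<omega>" by (simp flip: mult.assoc exp_add)
    finally show "norm (\<Phi> y t) \<le> norm x0 + M / \<omega>" .
  qed
  have "\<exists>!y. Bcontfun (\<Phi> y) = y"
  proof (rule banach_fix_type[of "1 / 2"], simp, simp, intro allI)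
    fix y z
    show "dist (Bcontfun (\<Phi> y)) (Bcontfun (\<Phi> z)) \<le> 1 / 2 * dist y z"
    proof (rule dist_bound)
      fix t :: real
      let ?t = "max 0 t"
      have "dist (\<Phi> y t) (\<Phi> z t) = exp (- \<omega> * ?t) * norm (I y ?t - I z ?t)"
        by (simp add: \<Phi>_def dist_norm flip: scaleR_diff_right)
      also have "\<dots> \<le> exp (- \<omega> * ?t) * (\<bar>L\<bar> / \<omega> * dist y z * exp (\<omega> * ?t))"
        by (intro mult_left_mono I_lip) auto
      also have "\<dots> = (exp (- \<omega> * ?t) * exp (\<omega> * ?t)) * (\<bar>L\<bar> / \<omega> * dist y z)" by simp
      also have "exp (- \<omega> * ?t) * exp (\<omega> * ?t) = 1" by (simp flip: exp_add)
      also have "1 * (\<bar>L\<bar> / \<omega> * dist y z) \<le> 1 / 2 * dist y z"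
        using mult_right_mono[OF \<omega>(2), of "dist y z"] by simp
      finally show "dist (apply_bcontfun (Bcontfun (\<Phi> y)) t) (apply_bcontfun (Bcontfun (\<Phi> z)) t) \<le> 1 / 2 * dist y z"
        by (simp only: Bcontfun_inverse[OF \<Phi>])
    qed
  qed
  then obtain y where "Bcontfun (\<Phi> y) = y" by blast
  then have y: "apply_bcontfun y = \<Phi> y" by (metis Bcontfun_inverse \<Phi>)
  define x where "x t = x0 + I y t" for t
  have x: "exp (\<omega> * t) *\<^sub>R apply_bcontfun y t = x t" if "t \<ge> 0" for t
    using that by (simp add: y \<Phi>_def x_def flip: exp_add)
  show ?thesis
  proof (intro exI[of _ x] conjI allI impI)
    show "x 0 = x0" by (simp add: x_def I0)
    fix t :: real assume t: "0 \<le> t"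
    have "((\<lambda>t. x0 + I y t) has_vector_derivative 0 + g y t) (at t within {0..})"
      by (intro derivative_intros I_deriv t)
    then show "(x has_vector_derivative G (x t)) (at t within {0..})"
      by (simp add: x_def[abs_def, symmetric] g_def x t)
  qed
qed

section \<open>Decay of the power traces\<close>

text \<open>\<open>F\<close> is an antiderivative of \<open>\<phi>\<close> with respect to d(x^p).
  As \<open>\<phi>\<close> increases, \<open>F\<close> is a convex function of x^p with subgradient
  \<open>\<phi> y\<close>; equivalently, \<open>H\<close> below has its minimum over the interval at
  \<open>y\<close>.\<close>

lemma subgradient_power_exists:
  fixes \<phi> :: "real \<Rightarrow> real"
  assumes mono: "mono \<phi>" and cont: "continuous_on UNIV \<phi>"
  obtains F where "\<And>x y. x \<in> {0..R} \<Longrightarrow> y \<in> {0..R} \<Longrightarrow> \<phi> y * (x ^ p - y ^ p) \<le> F x - F y"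
proof -
  have "continuous_on {0..R} (\<lambda>x. \<phi> x * (real p * x ^ (p - 1)))"
    by (intro continuous_intros continuous_on_subset[OF cont]) auto
  then obtain F where F: "\<And>x. x \<in> {0..R} \<Longrightarrow> (F has_vector_derivative \<phi> x * (real p * x ^ (p - 1))) (at x within {0..R})"
    by (rule antiderivative_continuous) blast
  have F_cont: "continuous_on {0..R} F"
    using F by (rule continuous_on_vector_derivative)
  show ?thesis
  proof (rule that)
    fix x y assume xy: "x \<in> {0..R}" "y \<in> {0..R}"
    define H where "H z = F z - \<phi> y * z ^ p" for z
    have H_cont: "continuous_on {u..v} H" if "u \<in> {0..R}" "v \<in> {0..R}" for u v
      unfolding H_def by (intro continuous_intros continuous_on_subset[OF F_cont]) (use that in auto)
    have H_deriv: "(H has_real_derivative (\<phi> z - \<phi> y) * (real p * z ^ (p - 1))) (at z)" if "0 < z" "z < R" for z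
    proof -
      have "at z within {0..R} = at z" using that by (intro at_within_Icc_at)
      then have "(F has_real_derivative \<phi> z * (real p * z ^ (p - 1))) (at z)"
        using F[of z] that by (simp add: has_real_derivative_iff_has_vector_derivative)
      then show ?thesis unfolding H_def by (auto intro!: derivative_eq_intros simp: algebra_simps)
    qed
    consider "x = y" | "x < y" | "y < x" by linarith
    then have "H y \<le> H x"
    proof cases
      case 2
      show ?thesis
      proof (rule DERIV_nonpos_imp_decreasing_open[where a = x and b = y and f = H])
        fix z assume z: "x < z" "z < y"
        then have "(\<phi> z - \<phi> y) * (real p * z ^ (p - 1)) \<le> 0"
          using xy monoD[OF mono, of z y] by (intro mult_nonpos_nonneg) auto
        then show "\<exists>d. (H has_real_derivative d) (at z) \<and> d \<le> 0" using H_deriv[of z] z xy by auto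
      qed (use 2 xy H_cont in auto)
    next
      case 3
      show ?thesis
      proof (rule DERIV_nonneg_imp_increasing_open[where a = y and b = x and f = H])
        fix z assume z: "y < z" "z < x"
        then have "0 \<le> (\<phi> z - \<phi> y) * (real p * z ^ (p - 1))"
          using xy monoD[OF mono, of y z] by (intro mult_nonneg_nonneg) auto
        then show "\<exists>d. (H has_real_derivative d) (at z) \<and> 0 \<le> d" using H_deriv[of z] z xy by auto
      qed (use 3 xy H_cont in auto)
    qed simp
    then show "\<phi> y * (x ^ p - y ^ p) \<le> F x - F y" by (simp add: H_def algebra_simps)
  qed
qed

text \<open>Equality in a subgradient inequality means that the convex function is affine between
  the two points, so its slope \<open>\<phi>\<close> is constant there. Inserting \<open>m\<close>
  as an intermediate point makes this quantitative.\<close>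

lemma subgradient_equality_const:
  fixes \<phi> F :: "real \<Rightarrow> real"
  assumes sub: "\<And>x y. x \<in> {0..R} \<Longrightarrow> y \<in> {0..R} \<Longrightarrow> \<phi> y * (x\<^sup>2 - y\<^sup>2) \<le> F x - F y"
    and mono: "mono \<phi>" and xy: "x \<in> {0..R}" "y \<in> {0..R}"
    and eq: "\<phi> y * (x\<^sup>2 - y\<^sup>2) = F x - F y"
    and m: "x < m \<and> m < y \<or> y < m \<and> m < x"
  shows "\<phi> m = \<phi> y"
proof -
  have mR: "m \<in> {0..R}" using m xy by auto
  have "\<phi> m * (x\<^sup>2 - m\<^sup>2) + \<phi> y * (m\<^sup>2 - y\<^sup>2) \<le> \<phi> y * (x\<^sup>2 - y\<^sup>2)"
    using sub[OF xy(1) mR] sub[OF mR xy(2)] eq by linarith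
  then have le: "(\<phi> m - \<phi> y) * (x\<^sup>2 - m\<^sup>2) \<le> 0" by (simp add: algebra_simps)
  show ?thesis
  proof (cases "x < m")
    case True
    then have "x\<^sup>2 < m\<^sup>2" using xy by (intro power_strict_mono) auto
    then have "\<phi> y \<le> \<phi> m" using le by (simp add: mult_le_0_iff)
    moreover have "\<phi> m \<le> \<phi> y" using m True by (intro monoD[OF mono]) auto
    ultimately show ?thesis by simp
  next
    case False
    then have "m\<^sup>2 < x\<^sup>2" using m mR by (intro power_strict_mono) auto
    then have "\<phi> m \<le> \<phi> y" using le by (simp add: mult_le_0_iff)
    moreover have "\<phi> y \<le> \<phi> m" using m False by (intro monoD[OF mono]) auto
    ultimately show ?thesis by simp
  qed
qed

section \<open>Squared entries of a unitary matrix as doubly stochastic weights\<close>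

lemma unitary_row_sum:
  assumes "unitary_matrix W"
  shows "(\<Sum>j\<in>UNIV. (cmod (W $ i $ j))\<^sup>2) = 1"
proof -
  have "(W ** adj W) $ i $ i = 1" by (simp add: unitary_cancel assms mat_def)
  then have "complex_of_real (\<Sum>j\<in>UNIV. (cmod (W $ i $ j))\<^sup>2) = 1"
    by (simp add: mult_nth adj_nth flip: complex_norm_square)
  then show ?thesis using of_real_eq_1_iff by blast
qed

lemma unitary_column_sum:
  assumes "unitary_matrix W"
  shows "(\<Sum>i\<in>UNIV. (cmod (W $ i $ j))\<^sup>2) = 1"
  using unitary_row_sum[OF unitary_adj[OF assms], of j] by (simp add: adj_nth)

text \<open>Used in both directions: single sums become weighted double sums, and weighted sums of
  differences h(i) - h(j) vanish.\<close>

lemma doubly_stochastic_sums: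
  fixes W :: "complex^'n^'n" and h :: "'n \<Rightarrow> real"
  assumes "unitary_matrix W"
  shows "(\<Sum>i\<in>UNIV. \<Sum>j\<in>UNIV. h i * (cmod (W $ i $ j))\<^sup>2) = sum h UNIV"
    "(\<Sum>i\<in>UNIV. \<Sum>j\<in>UNIV. h j * (cmod (W $ i $ j))\<^sup>2) = sum h UNIV"
proof -
  show "(\<Sum>i\<in>UNIV. \<Sum>j\<in>UNIV. h i * (cmod (W $ i $ j))\<^sup>2) = sum h UNIV"
    unfolding sum_distrib_left[symmetric] unitary_row_sum[OF assms] by simp
  show "(\<Sum>i\<in>UNIV. \<Sum>j\<in>UNIV. h j * (cmod (W $ i $ j))\<^sup>2) = sum h UNIV"
    by (subst sum.swap) (simp add: unitary_column_sum[OF assms] flip: sum_distrib_left)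
qed

lemma inner_unitary_diag:
  fixes U V :: "complex^'n^'n"
  assumes U: "unitary_matrix U" and V: "unitary_matrix V"
  shows "(U ** real_diag d ** adj U) \<bullet> (V ** real_diag e ** adj V)
    = (\<Sum>i\<in>UNIV. \<Sum>j\<in>UNIV. d i * e j * (cmod ((adj U ** V) $ i $ j))\<^sup>2)"
proof -
  define W where "W = adj U ** V"
  have "(U ** real_diag d ** adj U) \<bullet> (V ** real_diag e ** adj V)
      = (U ** real_diag d ** adj U) \<bullet> (U ** (W ** real_diag e ** adj W) ** adj U)"
    by (simp add: W_def adj_mult matrix_mul_assoc unitary_cancel U)
  also have "\<dots> = real_diag d \<bullet> (W ** real_diag e ** adj W)"
    by (rule unitary_inner[OF U unitary_adj[OF U]])
  also have "\<dots> = Re (\<Sum>i\<in>UNIV. d i * (W ** real_diag e ** adj W) $ i $ i)"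
    unfolding inner_matrix_eq by (simp add: real_diag_def if_distrib[of cnj] if_distrib[of "\<lambda>x. x * _"] cong: if_cong)
  also have "(\<Sum>i\<in>UNIV. d i * (W ** real_diag e ** adj W) $ i $ i)
      = complex_of_real (\<Sum>i\<in>UNIV. \<Sum>j\<in>UNIV. d i * e j * (cmod (W $ i $ j))\<^sup>2)"
    by (simp only: mult_nth[of _ "adj W"] real_diag_right adj_nth sum_distrib_left of_real_sum of_real_mult
        complex_norm_square mult_ac)
  finally show ?thesis by (simp add: W_def)
qed

primrec mpow :: "complex^'n^'n \<Rightarrow> nat \<Rightarrow> complex^'n^'n" where
  "mpow A 0 = mat 1"
| "mpow A (Suc p) = A ** mpow A p"

lemma mpow_add: "mpow A (p + q) = mpow A p ** mpow A q"
  by (induction p) (simp_all add: matrix_mul_assoc)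

lemma mpow_Suc2: "mpow A (Suc p) = mpow A p ** A"
  using mpow_add[of A p 1] by simp

lemma adj_mpow: "adj (mpow A p) = mpow (adj A) p"
proof (induction p)
  case (Suc p)
  then show ?case using mpow_Suc2[of "adj A" p] by (simp add: adj_mult)
qed (simp add: adj_mat)

lemma mpow_unitary_diag:
  fixes V :: "complex^'n^'n"
  assumes "unitary_matrix V"
  shows "mpow (V ** real_diag d ** adj V) p = V ** real_diag (\<lambda>i. d i ^ p) ** adj V"
proof (induction p)
  case 0
  have "real_diag (\<lambda>i. 1) = (mat 1 :: complex^'n^'n)" by (simp add: real_diag_def mat_def vec_eq_iff)
  then show ?case by (simp add: unitary_cancel assms)
next
  case (Suc p)
  have "V ** real_diag d ** adj V ** (V ** real_diag (\<lambda>i. d i ^ p) ** adj V)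
    = V ** (real_diag d ** real_diag (\<lambda>i. d i ^ p)) ** adj V"
    by (simp add: matrix_mul_assoc unitary_cancel assms)
  with Suc show ?case by (simp add: real_diag_mult)
qed

text \<open>Along the flow this is, up to the factor 2p, the derivative of the trace of the p-th
  power of \<open>adj X ** X\<close>, that is of the sum of the 2p-th powers of the singular
  values.\<close>

definition trace_defect :: "(real \<Rightarrow> real) \<Rightarrow> (real \<Rightarrow> real) \<Rightarrow> nat \<Rightarrow> complex^'n^'n \<Rightarrow> real" where
  "trace_defect \<phi>1 \<phi>2 p X = (mpow (X ** adj X) p - mpow (adj X ** X) p) \<bullet> phi_map \<phi>1 \<phi>2 X"

lemma trace_defect_svd:
  assumes X: "svd X U s V"
  shows "trace_defect \<phi>1 \<phi>2 p X = (\<Sum>i\<in>UNIV. \<Sum>j\<in>UNIV.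
    (s i ^ (2 * p) - s j ^ (2 * p)) * (\<phi>1 (s j) - \<phi>2 (s i)) * (cmod ((adj U ** V) $ i $ j))\<^sup>2)"
proof -
  have u: "unitary_matrix U" "unitary_matrix V" using X by (auto simp: svd_def)
  have W: "unitary_matrix (adj U ** V)" by (intro unitary_mult unitary_adj u)
  note X' = svd_adj[OF X]
  have 1: "mpow (adj X ** X) p = V ** real_diag (\<lambda>i. s i ^ (2 * p)) ** adj V"
    using svd_gram[OF X] by (simp add: mpow_unitary_diag u power_mult)
  have 2: "mpow (X ** adj X) p = U ** real_diag (\<lambda>i. s i ^ (2 * p)) ** adj U"
    using svd_gram[OF X'] by (simp add: mpow_unitary_diag u power_mult)
  have diag: "(Q ** real_diag d ** adj Q) \<bullet> (Q ** real_diag e ** adj Q) = (\<Sum>i\<in>UNIV. d i * e i)"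
    if "unitary_matrix Q" for Q :: "complex^'n^'n" and d e
    unfolding inner_unitary_diag[OF that that] unitary_cancel[OF that]
    by (simp add: mat_def if_distrib[of cmod] if_distrib[of "\<lambda>x. x\<^sup>2"] if_distrib[of "\<lambda>x. _ * x"] cong: if_cong)
  have "trace_defect \<phi>1 \<phi>2 p X =
     (\<Sum>i\<in>UNIV. \<Sum>j\<in>UNIV. s i ^ (2 * p) * \<phi>1 (s j) * (cmod ((adj U ** V) $ i $ j))\<^sup>2)
     - (\<Sum>i\<in>UNIV. s i ^ (2 * p) * \<phi>2 (s i))
     - (\<Sum>i\<in>UNIV. s i ^ (2 * p) * \<phi>1 (s i))
     + (\<Sum>i\<in>UNIV. \<Sum>j\<in>UNIV. \<phi>2 (s i) * s j ^ (2 * p) * (cmod ((adj U ** V) $ i $ j))\<^sup>2)"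
    unfolding trace_defect_def phi_map_abs_fun svd_abs_fun[OF X] svd_abs_fun[OF X'] 1 2 inner_diff_left inner_diff_right
    using inner_commute[of "V ** real_diag (\<lambda>i. s i ^ (2 * p)) ** adj V" "U ** real_diag (\<lambda>i. \<phi>2 (s i)) ** adj U"]
    by (simp add: inner_unitary_diag[OF u] diag[OF u(1)] diag[OF u(2)])
  also have "(\<Sum>i\<in>UNIV. s i ^ (2 * p) * \<phi>2 (s i)) = (\<Sum>i\<in>UNIV. \<Sum>j\<in>UNIV. s i ^ (2 * p) * \<phi>2 (s i) * (cmod ((adj U ** V) $ i $ j))\<^sup>2)"
    by (rule doubly_stochastic_sums(1)[OF W, symmetric])
  also have "(\<Sum>i\<in>UNIV. s i ^ (2 * p) * \<phi>1 (s i)) = (\<Sum>i\<in>UNIV. \<Sum>j\<in>UNIV. s j ^ (2 * p) * \<phi>1 (s j) * (cmod ((adj U ** V) $ i $ j))\<^sup>2)"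
    by (rule doubly_stochastic_sums(2)[OF W, symmetric])
  finally show ?thesis
    by (simp add: algebra_simps sum.distrib sum_subtractf)
qed

text \<open>Each summand \<open>f i j\<close> of the defect is bounded by a weighted difference
  \<open>g i j\<close> of values of \<open>F - G\<close>, and these differences sum to 0 by double
  stochasticity. If the defect vanishes, equality holds in every term; for p = 1 and a nonzero
  weight both subgradient inequalities are then equalities, so each potential is constant strictly
  between the two singular values.\<close>

lemma trace_defect_svd_nonpos:
  fixes X :: "complex^'n^'n"
  assumes X: "svd X U s V" and mono: "mono \<phi>1" "mono \<phi>2"
    and cont: "continuous_on UNIV \<phi>1" "continuous_on UNIV \<phi>2"
  shows "trace_defect \<phi>1 \<phi>2 p X \<le> 0"
    and "\<lbrakk>p = 1; trace_defect \<phi>1 \<phi>2 p X = 0; (adj U ** V) $ i $ j \<noteq> 0;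
       s i < m \<and> m < s j \<or> s j < m \<and> m < s i; s i < m' \<and> m' < s j \<or> s j < m' \<and> m' < s i\<rbrakk>
       \<Longrightarrow> \<phi>1 m + \<phi>2 m = \<phi>1 m' + \<phi>2 m'"
proof -
  define W where "W = adj U ** V"
  have W: "unitary_matrix W" using X by (auto simp: svd_def W_def intro: unitary_mult unitary_adj)
  define R where "R = norm X"
  have sR: "s i \<in> {0..R}" for i using X singular_value_le_norm[OF X] by (auto simp: svd_def R_def)
  obtain F where F: "\<And>x y. x \<in> {0..R} \<Longrightarrow> y \<in> {0..R} \<Longrightarrow> \<phi>1 y * (x ^ (2 * p) - y ^ (2 * p)) \<le> F x - F y"
    using subgradient_power_exists[OF mono(1) cont(1)] by metis
  obtain G where G: "\<And>x y. x \<in> {0..R} \<Longrightarrow> y \<in> {0..R} \<Longrightarrow> \<phi>2 y * (x ^ (2 * p) - y ^ (2 * p)) \<le> G x - G y"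
    using subgradient_power_exists[OF mono(2) cont(2)] by metis
  define f where "f i j = (s i ^ (2 * p) - s j ^ (2 * p)) * (\<phi>1 (s j) - \<phi>2 (s i)) * (cmod (W $ i $ j))\<^sup>2" for i j
  define g where "g i j = ((F (s i) - G (s i)) - (F (s j) - G (s j))) * (cmod (W $ i $ j))\<^sup>2" for i j
  have le': "(s i ^ (2 * p) - s j ^ (2 * p)) * (\<phi>1 (s j) - \<phi>2 (s i)) \<le> (F (s i) - G (s i)) - (F (s j) - G (s j))" for i j
    using F[OF sR sR, of j i] G[OF sR sR, of i j] by (simp add: algebra_simps)
  then have le: "f i j \<le> g i j" for i j unfolding f_def g_def by (intro mult_right_mono) auto
  have def: "trace_defect \<phi>1 \<phi>2 p X = (\<Sum>i\<in>UNIV. \<Sum>j\<in>UNIV. f i j)"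
    by (simp add: trace_defect_svd[OF X] f_def W_def)
  have g0: "(\<Sum>i\<in>UNIV. \<Sum>j\<in>UNIV. g i j) = 0"
    unfolding g_def left_diff_distrib[of _ _ "_\<^sup>2"] sum_subtractf doubly_stochastic_sums[OF W] by simp
  show "trace_defect \<phi>1 \<phi>2 p X \<le> 0"
    unfolding def g0[symmetric] by (intro sum_mono le)
  assume p: "p = 1" and 0: "trace_defect \<phi>1 \<phi>2 p X = 0" and w: "(adj U ** V) $ i $ j \<noteq> 0"
    and m: "s i < m \<and> m < s j \<or> s j < m \<and> m < s i" "s i < m' \<and> m' < s j \<or> s j < m' \<and> m' < s i"
  have "(\<Sum>i\<in>UNIV. \<Sum>j\<in>UNIV. g i j - f i j) = 0"
    using 0 g0 unfolding def by (simp add: sum_subtractf)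
  then have "g i j - f i j = 0"
    using le by (simp add: sum_nonneg_eq_0_iff sum_nonneg)
  then have "(F (s i) - G (s i)) - (F (s j) - G (s j)) = (s i ^ (2 * p) - s j ^ (2 * p)) * (\<phi>1 (s j) - \<phi>2 (s i))"
    using w by (simp add: f_def g_def W_def)
  then have eqs: "\<phi>1 (s j) * ((s i)\<^sup>2 - (s j)\<^sup>2) = F (s i) - F (s j)" "\<phi>2 (s i) * ((s j)\<^sup>2 - (s i)\<^sup>2) = G (s j) - G (s i)"
    using F[OF sR sR, of j i] G[OF sR sR, of i j] unfolding p by (simp_all add: algebra_simps power2_eq_square)
  have "\<phi>1 k = \<phi>1 (s j) \<and> \<phi>2 k = \<phi>2 (s i)" if "s i < k \<and> k < s j \<or> s j < k \<and> k < s i" for k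
  proof
    show "\<phi>1 k = \<phi>1 (s j)"
      by (rule subgradient_equality_const[OF _ mono(1) sR sR eqs(1)]) (use F that in \<open>auto simp: p\<close>)
    show "\<phi>2 k = \<phi>2 (s i)"
      by (rule subgradient_equality_const[OF _ mono(2) sR sR eqs(2)]) (use G that in \<open>auto simp: p\<close>)
  qed
  from this[OF m(1)] this[OF m(2)] show "\<phi>1 m + \<phi>2 m = \<phi>1 m' + \<phi>2 m'" by simp
qed

lemma trace_defect_zero_normal:
  fixes X :: "complex^'n^'n"
  assumes mono: "mono \<phi>1" "mono \<phi>2"
    and cont: "continuous_on UNIV \<phi>1" "continuous_on UNIV \<phi>2"
    and strict: "strict_mono_on {0..b} (\<lambda>x. \<phi>1 x + \<phi>2 x)"
    and X: "X \<in> matrices_upto b" and zero: "trace_defect \<phi>1 \<phi>2 1 X = 0"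
  shows "normal_matrix X"
proof -
  obtain U s V where s: "svd X U s V" by (rule svd_exists)
  have u: "unitary_matrix U" "unitary_matrix V" using s by (auto simp: svd_def)
  have sb: "s i \<in> {0..b}" for i using X svd_matrices_upto_iff[OF s] s by (auto simp: svd_def)
  define W where "W = adj U ** V"
  have W_eq: "s i = s j" if "W $ i $ j \<noteq> 0" for i j
  proof (rule ccontr)
    assume ne: "s i \<noteq> s j"
    \<comment> \<open>The equality case gives constancy only in the open interval, so strict
      monotonicity is contradicted at two interior points instead of the end points.\<close>
    define l h where "l = min (s i) (s j)" and "h = max (s i) (s j)"
    have lh: "l < h" using ne by (auto simp: l_def h_def)
    define m m' where "m = (l + h) / 2" and "m' = (l + m) / 2"
    have ord: "l < m'" "m' < m" "m < h" using lh by (auto simp: m_def m'_def field_simps)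
    have "\<phi>1 m + \<phi>2 m = \<phi>1 m' + \<phi>2 m'"
      by (rule trace_defect_svd_nonpos(2)[OF s mono cont refl zero that[unfolded W_def]])
        (use ord in \<open>auto simp: l_def h_def min_def max_def split: if_splits\<close>)
    moreover have "m \<in> {0..b}" "m' \<in> {0..b}" using ord sb[of i] sb[of j] by (auto simp: l_def h_def)
    ultimately show False using strict_mono_onD[OF strict, of m' m] ord(2) by simp
  qed
  have "real_diag (\<lambda>i. (s i)\<^sup>2) ** W = W ** real_diag (\<lambda>i. (s i)\<^sup>2)"
    unfolding vec_eq_iff real_diag_left real_diag_right using W_eq by (metis mult.commute mult_zero_left)
  then have "U ** (real_diag (\<lambda>i. (s i)\<^sup>2) ** W) ** adj V = U ** (W ** real_diag (\<lambda>i. (s i)\<^sup>2)) ** adj V"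
    by simp
  then have "X ** adj X = adj X ** X"
    using svd_gram[OF s] svd_gram[OF svd_adj[OF s]] by (simp add: W_def matrix_mul_assoc unitary_cancel u)
  then show ?thesis by (simp add: normal_matrix_def)
qed

lemma has_vector_derivative_adj:
  "(X has_vector_derivative X') F \<Longrightarrow> ((\<lambda>t. adj (X t)) has_vector_derivative adj X') F"
  by (rule bounded_linear.has_vector_derivative[OF bounded_linear_adj])

text \<open>The derivative of a matrix power has no closed form when \<open>A'\<close> does not
  commute with \<open>A t\<close>. Paired with powers of \<open>A t\<close> it obeys the scalar
  rule; the quantifier over \<open>q\<close> carries the induction, as one factor moves across the
  inner product at each step.\<close>

lemma mpow_derivative:
  assumes A: "(A has_vector_derivative A') (at t within S)" and herm: "adj (A t) = A t"
  shows "\<exists>D. ((\<lambda>t. mpow (A t) p) has_vector_derivative D) (at t within S) \<and>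
    (\<forall>q. mpow (A t) q \<bullet> D = real p * (mpow (A t) (q + p - 1) \<bullet> A'))"
proof (induction p)
  case 0
  show ?case by (intro exI[of _ 0]) (simp add: has_vector_derivative_const)
next
  case (Suc p)
  then obtain D where D: "((\<lambda>t. mpow (A t) p) has_vector_derivative D) (at t within S)"
    "\<And>q. mpow (A t) q \<bullet> D = real p * (mpow (A t) (q + p - 1) \<bullet> A')" by blast
  show ?case
  proof (intro exI conjI allI)
    show "((\<lambda>t. mpow (A t) (Suc p)) has_vector_derivative A t ** D + A' ** mpow (A t) p) (at t within S)"
      using matmul.has_vector_derivative[OF A D(1)] by simp
    fix q
    have "mpow (A t) q \<bullet> (A t ** D) = mpow (A t) (Suc q) \<bullet> D"
      using inner_matmul_left[of "A t" "mpow (A t) q" D] herm by simp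
    moreover have "mpow (A t) q \<bullet> (A' ** mpow (A t) p) = mpow (A t) (q + p) \<bullet> A'"
      using inner_matmul_right[of "mpow (A t) q" "mpow (A t) p" A'] herm by (simp add: mpow_add adj_mpow)
    ultimately show "mpow (A t) q \<bullet> (A t ** D + A' ** mpow (A t) p) = real (Suc p) * (mpow (A t) (q + Suc p - 1) \<bullet> A')"
      using D(2)[of "Suc q"] by (simp add: inner_add_right algebra_simps)
  qed
qed

lemma power_trace_derivative:
  fixes X :: "real \<Rightarrow> complex^'n^'n"
  assumes X: "(X has_vector_derivative commutator (phi_map \<phi>1 \<phi>2 (X t)) (X t)) (at t within S)" and p: "p > 0"
  shows "((\<lambda>t. mat 1 \<bullet> mpow (adj (X t) ** X t) p) has_vector_derivative
      2 * real p * trace_defect \<phi>1 \<phi>2 p (X t)) (at t within S)"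
proof -
  define P where "P = phi_map \<phi>1 \<phi>2 (X t)"
  define X' where "X' = commutator P (X t)"
  define A where "A t = adj (X t) ** X t" for t
  have "(A has_vector_derivative adj (X t) ** X' + adj X' ** X t) (at t within S)"
    unfolding A_def X'_def P_def by (intro matmul.has_vector_derivative has_vector_derivative_adj X)
  moreover have herm: "adj (A t) = A t" for t by (simp add: A_def adj_mult)
  ultimately obtain D where D: "((\<lambda>t. mpow (A t) p) has_vector_derivative D) (at t within S)"
    "mpow (A t) 0 \<bullet> D = real p * (mpow (A t) (0 + p - 1) \<bullet> (adj (X t) ** X' + adj X' ** X t))"
    using mpow_derivative by blast
  obtain q where q: "p = Suc q" using p by (cases p) auto
  let ?B = "mpow (A t) q"
  have hB: "adj ?B = ?B" by (simp add: adj_mpow herm)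
  have "?B \<bullet> (adj X' ** X t) = adj ?B \<bullet> adj (adj X' ** X t)" by (simp only: inner_adj)
  then have "?B \<bullet> (adj (X t) ** X' + adj X' ** X t) = 2 * (?B \<bullet> (adj (X t) ** X'))"
    by (simp add: hB adj_mult inner_add_right)
  also have "?B \<bullet> (adj (X t) ** X') = (X t ** ?B) \<bullet> (P ** X t) - (X t ** ?B) \<bullet> (X t ** P)"
    by (simp add: inner_matmul_left X'_def commutator_def inner_diff_right matrix_simps)
  also have "(X t ** ?B) \<bullet> (X t ** P) = mpow (A t) p \<bullet> P"
    using inner_matmul_left[of "adj (X t)" "X t ** ?B" P] by (simp add: q A_def matrix_mul_assoc)
  also have "(X t ** ?B) \<bullet> (P ** X t) = mpow (X t ** adj (X t)) p \<bullet> P"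
  proof -
    have *: "X t ** mpow (A t) q ** adj (X t) = mpow (X t ** adj (X t)) (Suc q)" for q
    proof (induction q)
      case (Suc q)
      have "X t ** mpow (A t) (Suc q) ** adj (X t) = (X t ** adj (X t)) ** (X t ** mpow (A t) q ** adj (X t))"
        by (simp add: A_def matrix_mul_assoc)
      with Suc show ?case by simp
    qed simp
    have "(X t ** ?B ** adj (X t)) \<bullet> P = (X t ** ?B) \<bullet> (P ** X t)"
      using inner_matmul_right[of "X t ** ?B" "adj (X t)" P] by simp
    then show ?thesis unfolding q * by simp
  qed
  finally have B: "?B \<bullet> (adj (X t) ** X' + adj X' ** X t) = 2 * trace_defect \<phi>1 \<phi>2 p (X t)"
    by (simp only: trace_defect_def P_def A_def inner_diff_left)
  have "mat 1 \<bullet> D = real p * (?B \<bullet> (adj (X t) ** X' + adj X' ** X t))"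
    using D(2) by (simp add: q)
  also have "\<dots> = 2 * real p * trace_defect \<phi>1 \<phi>2 p (X t)"
    unfolding B by simp
  finally have "mat 1 \<bullet> D = 2 * real p * trace_defect \<phi>1 \<phi>2 p (X t)" .
  moreover have "((\<lambda>t. mat 1 \<bullet> mpow (A t) p) has_vector_derivative mat 1 \<bullet> D) (at t within S)"
    by (rule bounded_linear.has_vector_derivative[OF bounded_linear_inner_right D(1)])
  ultimately show ?thesis by (simp add: A_def)
qed

section \<open>Existence and uniqueness of the flow\<close>

lemma commutator_diff_left: "commutator (A - B) C = commutator A C - commutator B C"
  by (simp add: commutator_def matrix_simps)

lemma commutator_diff_right: "commutator A (B - C) = commutator A B - commutator A C"
  by (simp add: commutator_def matrix_simps)

lemma norm_commutator_le: "norm (commutator A (B :: complex^'n^'n)) \<le> 2 * norm A * norm B"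
  unfolding commutator_def
  using norm_triangle_ineq4[of "A ** B" "B ** A"] norm_mult_le[of A B] norm_mult_le[of B A]
  by (simp add: mult_ac)

text \<open>The potentials live on the whole line and are globally bounded and Lipschitz there, so
  the vector field is defined on all matrices and existence needs no prior confinement to
  \<open>matrices_upto b\<close>.\<close>

locale spectral_potentials =
  fixes L M :: real and \<psi>1 \<psi>2 :: "real \<Rightarrow> real"
  assumes mono: "mono \<psi>1" "mono \<psi>2"
    and lipschitz: "\<And>x y. \<bar>\<psi>1 x - \<psi>1 y\<bar> \<le> L * \<bar>x - y\<bar>" "\<And>x y. \<bar>\<psi>2 x - \<psi>2 y\<bar> \<le> L * \<bar>x - y\<bar>"
    and bounded: "\<And>x. \<bar>\<psi>1 x\<bar> \<le> M" "\<And>x. \<bar>\<psi>2 x\<bar> \<le> M"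
begin

abbreviation \<Phi> :: "complex^'n^'n \<Rightarrow> complex^'n^'n" where
  "\<Phi> \<equiv> phi_map \<psi>1 \<psi>2"

definition field :: "complex^'n^'n \<Rightarrow> complex^'n^'n" where
  "field X = commutator (\<Phi> X) X"

lemma L_nonneg: "0 \<le> L"
  using lipschitz(1)[of 1 0] by simp

lemma M_nonneg: "0 \<le> M"
  using bounded(1)[of 0] by linarith

lemma continuous_potentials: "continuous_on UNIV \<psi>1" "continuous_on UNIV \<psi>2"
proof -
  have "L-lipschitz_on UNIV \<psi>1" "L-lipschitz_on UNIV \<psi>2"
    using lipschitz L_nonneg by (auto intro!: lipschitz_onI simp: dist_real_def)
  then show "continuous_on UNIV \<psi>1" "continuous_on UNIV \<psi>2"
    by (auto intro: lipschitz_on_continuous_on)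
qed

lemma norm_phi_le: "norm (\<Phi> (X::complex^'n^'n)) \<le> 2 * (real CARD('n))\<^sup>2 * M"
  unfolding phi_map_abs_fun
  using norm_triangle_ineq4[of "abs_fun \<psi>1 X" "abs_fun \<psi>2 (adj X)"]
    norm_abs_fun_le[of \<psi>1 M X] norm_abs_fun_le[of \<psi>2 M "adj X"] bounded
  by simp

text \<open>With identity matrices as intertwiners, \<open>norm_abs_fun_intertwine_le\<close>
  becomes a Lipschitz bound for functions of the absolute value.\<close>

lemma norm_phi_diff_le:
  "norm (\<Phi> (X::complex^'n^'n) - \<Phi> Y) \<le> 4 * (real CARD('n))\<^sup>2 * L * norm (X - Y)"
proof -
  have 1: "norm (abs_fun \<psi>1 X - abs_fun \<psi>1 Y) \<le> 2 * (real CARD('n))\<^sup>2 * L * norm (X - Y)"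
    using norm_abs_fun_intertwine_le[of \<psi>1 L X "mat 1" Y "mat 1"] lipschitz L_nonneg norm_adj[of "X - Y"]
    by (simp add: adj_diff algebra_simps)
  have 2: "norm (abs_fun \<psi>2 (adj X) - abs_fun \<psi>2 (adj Y)) \<le> 2 * (real CARD('n))\<^sup>2 * L * norm (X - Y)"
    using norm_abs_fun_intertwine_le[of \<psi>2 L "adj X" "mat 1" "adj Y" "mat 1"] lipschitz L_nonneg norm_adj[of "X - Y"]
    by (simp add: adj_diff algebra_simps)
  have "\<Phi> X - \<Phi> Y = (abs_fun \<psi>1 X - abs_fun \<psi>1 Y) - (abs_fun \<psi>2 (adj X) - abs_fun \<psi>2 (adj Y))"
    by (simp add: phi_map_abs_fun)
  then show ?thesis using norm_triangle_ineq4[of "abs_fun \<psi>1 X - abs_fun \<psi>1 Y" "abs_fun \<psi>2 (adj X) - abs_fun \<psi>2 (adj Y)"] 1 2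
    by simp
qed

lemma norm_field_le: "norm (field (X::complex^'n^'n)) \<le> 4 * (real CARD('n))\<^sup>2 * M * norm X"
proof -
  have "norm (field X) \<le> 2 * norm (\<Phi> X) * norm X"
    unfolding field_def by (rule norm_commutator_le)
  also have "\<dots> \<le> 2 * (2 * (real CARD('n))\<^sup>2 * M) * norm X"
    by (intro mult_right_mono mult_left_mono norm_phi_le) auto
  finally show ?thesis by simp
qed

text \<open>Only \<open>X\<close> has to lie in the ball: in the splitting the difference of the
  values of \<open>\<Phi>\<close> is multiplied by \<open>X\<close>, while the other term only needs
  the global bound on \<open>\<Phi> Y\<close>. Hence a solution can be compared with another one not
  yet known to be bounded.\<close>

lemma field_lipschitz_on_ball:
  obtains C where "0 \<le> C" "\<And>X Y :: complex^'n^'n. norm X \<le> R \<Longrightarrow> norm (field X - field Y) \<le> C * norm (X - Y)"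
proof
  let ?n = "(real CARD('n))\<^sup>2"
  let ?C = "2 * (4 * ?n * L) * \<bar>R\<bar> + 2 * (2 * ?n * M)"
  show "0 \<le> ?C" using L_nonneg M_nonneg by auto
  fix X Y :: "complex^'n^'n" assume X: "norm X \<le> R"
  have "field X - field Y = commutator (\<Phi> X - \<Phi> Y) X + commutator (\<Phi> Y) (X - Y)"
    by (simp add: field_def commutator_diff_left commutator_diff_right)
  then have "norm (field X - field Y) \<le> 2 * norm (\<Phi> X - \<Phi> Y) * norm X + 2 * norm (\<Phi> Y) * norm (X - Y)"
    using norm_triangle_mono[OF norm_commutator_le norm_commutator_le] by metis
  also have "\<dots> \<le> 2 * (4 * ?n * L * norm (X - Y)) * \<bar>R\<bar> + 2 * (2 * ?n * M) * norm (X - Y)"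
    using X L_nonneg M_nonneg
    by (intro add_mono mult_mono mult_left_mono norm_phi_diff_le norm_phi_le mult_nonneg_nonneg) auto
  also have "\<dots> = ?C * norm (X - Y)" by (simp add: algebra_simps)
  finally show "norm (field X - field Y) \<le> ?C * norm (X - Y)" .
qed

lemma inner_field: "X \<bullet> field X = trace_defect \<psi>1 \<psi>2 1 X"
proof -
  have "X \<bullet> (\<Phi> X ** X) = (X ** adj X) \<bullet> \<Phi> X"
    using inner_matmul_right[of X "adj X" "\<Phi> X"] by simp
  moreover have "X \<bullet> (X ** \<Phi> X) = (adj X ** X) \<bullet> \<Phi> X"
    using inner_matmul_left[of "adj X" X "\<Phi> X"] by simp
  ultimately show ?thesis
    by (simp add: field_def commutator_def trace_defect_def inner_diff_left inner_diff_right)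
qed

lemma trace_defect_nonpos: "trace_defect \<psi>1 \<psi>2 p X \<le> 0"
proof -
  obtain U s V where s: "svd X U s V" by (rule svd_exists)
  show ?thesis by (rule trace_defect_svd_nonpos(1)[OF s mono continuous_potentials])
qed

text \<open>The cut-off \<open>\<eta>\<close> makes the field globally bounded and Lipschitz. It
  only rescales the field, so the energy still decreases; the solution stays in the ball of radius
  \<open>R\<close>, where the cut-off is 1.\<close>

lemma solution_exists:
  fixes T :: "complex^'n^'n"
  obtains X where "X 0 = T" "\<And>t. 0 \<le> t \<Longrightarrow> (X has_vector_derivative field (X t)) (at t within {0..})"
proof -
  define R where "R = norm T"
  define \<eta> where "\<eta> X = max 0 (min 1 (R + 1 - norm X))" for X :: "complex^'n^'n"
  define G where "G X = \<eta> X *\<^sub>R field X" for X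
  have \<eta>: "0 \<le> \<eta> X" "\<eta> X \<le> 1" for X by (auto simp: \<eta>_def)
  have \<eta>_diff: "\<bar>\<eta> X - \<eta> Y\<bar> \<le> norm (X - Y)" for X Y
    using norm_triangle_ineq3[of X Y] by (auto simp: \<eta>_def)
  obtain C where C: "0 \<le> C" "\<And>X Y :: complex^'n^'n. norm X \<le> R + 1 \<Longrightarrow> norm (field X - field Y) \<le> C * norm (X - Y)"
    using field_lipschitz_on_ball[of "R + 1"] by metis
  define B where "B = 4 * (real CARD('n))\<^sup>2 * M * (R + 1)"
  have B: "norm (field X) \<le> B" if "norm X \<le> R + 1" for X :: "complex^'n^'n"
    unfolding B_def by (rule order_trans[OF norm_field_le]) (intro mult_left_mono that, use M_nonneg in auto)
  have "0 \<le> B" using M_nonneg by (simp add: B_def R_def)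
  have G_bound: "norm (G X) \<le> B" for X
  proof (cases "norm X \<le> R + 1")
    case True
    have "norm (G X) = \<eta> X * norm (field X)" using \<eta>(1) by (simp add: G_def)
    also have "\<dots> \<le> 1 * B" using \<eta> B[OF True] by (intro mult_mono) auto
    finally show ?thesis by simp
  qed (simp add: G_def \<eta>_def \<open>0 \<le> B\<close>)
  have G_lip1: "norm (G X - G Y) \<le> (C + B) * norm (X - Y)" if X: "norm X \<le> R + 1" for X Y
  proof -
    have "G X - G Y = \<eta> Y *\<^sub>R (field X - field Y) + (\<eta> X - \<eta> Y) *\<^sub>R field X"
      by (simp add: G_def algebra_simps)
    then have "norm (G X - G Y) \<le> \<eta> Y * norm (field X - field Y) + \<bar>\<eta> X - \<eta> Y\<bar> * norm (field X)"
      using norm_triangle_ineq[of "\<eta> Y *\<^sub>R (field X - field Y)" "(\<eta> X - \<eta> Y) *\<^sub>R field X"] \<eta>(1) by simp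
    also have "\<dots> \<le> 1 * (C * norm (X - Y)) + norm (X - Y) * B"
      using \<eta> \<eta>_diff C X B by (intro add_mono mult_mono) auto
    finally show ?thesis by (simp add: algebra_simps)
  qed
  have G_lip: "norm (G X - G Y) \<le> (C + B) * norm (X - Y)" for X Y
  proof -
    consider "norm X \<le> R + 1" | "norm Y \<le> R + 1" | "norm X > R + 1" "norm Y > R + 1" by linarith
    then show ?thesis
    proof cases
      case 2
      then show ?thesis using G_lip1[of Y X] by (simp add: norm_minus_commute)
    next
      case 3
      then show ?thesis using C(1) \<open>0 \<le> B\<close> by (simp add: G_def \<eta>_def)
    qed (rule G_lip1)
  qed
  obtain X where X: "X 0 = T" "\<And>t. 0 \<le> t \<Longrightarrow> (X has_vector_derivative G (X t)) (at t within {0..})"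
    using picard_global_solution[OF G_lip G_bound, of T] by metis
  have "X t \<bullet> X t \<le> X 0 \<bullet> X 0" if "0 \<le> t" for t
  proof (rule antimono_on_halfline[where a = 0 and f = "\<lambda>t. X t \<bullet> X t" and f' = "\<lambda>t. X t \<bullet> G (X t) + G (X t) \<bullet> X t"])
    fix t :: real assume "0 \<le> t"
    then show "((\<lambda>t. X t \<bullet> X t) has_vector_derivative X t \<bullet> G (X t) + G (X t) \<bullet> X t) (at t within {0..})"
      by (intro bounded_bilinear.has_vector_derivative[OF bounded_bilinear_inner] X)
    have "X t \<bullet> G (X t) \<le> 0"
      using \<eta>(1)[of "X t"] trace_defect_nonpos[of 1 "X t"] by (simp add: G_def inner_field mult_nonneg_nonpos)
    then show "X t \<bullet> G (X t) + G (X t) \<bullet> X t \<le> 0" by (simp add: inner_commute)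
  qed (use that in auto)
  then have "norm (X t) \<le> R" if "0 \<le> t" for t
    using that by (simp add: R_def X(1) norm_le)
  then have "G (X t) = field (X t)" if "0 \<le> t" for t
    using that by (simp add: G_def \<eta>_def)
  with X show ?thesis by (intro that[of X]) auto
qed

lemma solution_unique:
  fixes X Y :: "real \<Rightarrow> complex^'n^'n"
  assumes X: "\<And>t. 0 \<le> t \<Longrightarrow> (X has_vector_derivative field (X t)) (at t within {0..})"
    and Y: "\<And>t. 0 \<le> t \<Longrightarrow> (Y has_vector_derivative field (Y t)) (at t within {0..})"
    and bound: "\<And>t. 0 \<le> t \<Longrightarrow> norm (X t) \<le> R" and "X 0 = Y 0" "0 \<le> t"
  shows "X t = Y t"
proof -
  obtain C where C: "0 \<le> C" "\<And>X Y :: complex^'n^'n. norm X \<le> R \<Longrightarrow> norm (field X - field Y) \<le> C * norm (X - Y)"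
    using field_lipschitz_on_ball[of R] by metis
  have "X t - Y t = 0"
  proof (rule gronwall_zero[where u = "\<lambda>t. X t - Y t" and u' = "\<lambda>t. field (X t) - field (Y t)" and C = C])
    fix t :: real assume t: "0 \<le> t"
    show "((\<lambda>t. X t - Y t) has_vector_derivative field (X t) - field (Y t)) (at t within {0..})"
      by (intro derivative_intros X Y t)
    have "(X t - Y t) \<bullet> (field (X t) - field (Y t)) \<le> norm (X t - Y t) * norm (field (X t) - field (Y t))"
      by (rule norm_cauchy_schwarz)
    also have "\<dots> \<le> norm (X t - Y t) * (C * norm (X t - Y t))"
      by (intro mult_left_mono C bound t) auto
    finally show "(X t - Y t) \<bullet> (field (X t) - field (Y t)) \<le> C * (norm (X t - Y t))\<^sup>2"
      by (simp add: power2_eq_square mult_ac)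
  qed (use assms in auto)
  then show ?thesis by simp
qed

lemma power_trace_svd:
  fixes X :: "complex^'n^'n"
  assumes s: "svd X U s V"
  shows "mat 1 \<bullet> mpow (adj X ** X) p = (\<Sum>i\<in>UNIV. s i ^ (2 * p))"
proof -
  have V: "unitary_matrix V" using s by (simp add: svd_def)
  have "mat 1 \<bullet> mpow (adj X ** X) p = (V ** mat 1 ** adj V) \<bullet> (V ** real_diag (\<lambda>i. s i ^ (2 * p)) ** adj V)"
    by (simp add: svd_gram[OF s] mpow_unitary_diag V unitary_cancel power_mult)
  also have "\<dots> = mat 1 \<bullet> (real_diag (\<lambda>i. s i ^ (2 * p)) :: complex^'n^'n)"
    by (rule unitary_inner[OF V unitary_adj[OF V]])
  also have "\<dots> = (\<Sum>i\<in>UNIV. s i ^ (2 * p))"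
    unfolding inner_matrix_eq
    by (simp add: mat_def real_diag_def if_distrib[of cnj] if_distrib[of "\<lambda>x. x * _"] cong: if_cong flip: of_real_power)
  finally show ?thesis .
qed

text \<open>All power traces decrease, so a singular value s satisfies s^(2p) \<le> n b^(2p) for
  every positive p. Since the p-th roots of n tend to 1, this forces s \<le> b.\<close>

lemma solution_in_matrices_upto:
  fixes X :: "real \<Rightarrow> complex^'n^'n"
  assumes X: "\<And>t. 0 \<le> t \<Longrightarrow> (X has_vector_derivative field (X t)) (at t within {0..})"
    and 0: "X 0 \<in> matrices_upto b" and b: "b > 0" and t: "0 \<le> t"
  shows "X t \<in> matrices_upto b"
proof -
  obtain U s V where s: "svd (X t) U s V" by (rule svd_exists)
  obtain U0 s0 V0 where s0: "svd (X 0) U0 s0 V0" by (rule svd_exists)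
  have "s i \<le> b" for i
  proof (rule ccontr)
    assume "\<not> s i \<le> b"
    then have "1 < s i / b" using b by simp
    then have "1 < (s i / b)\<^sup>2" by (simp add: one_less_power)
    then obtain p where p: "real CARD('n) < ((s i / b)\<^sup>2) ^ p" using real_arch_pow by blast
    have "p > 0" using p by (cases p) auto
    have "s i ^ (2 * p) \<le> (\<Sum>i\<in>UNIV. s i ^ (2 * p))"
      by (rule member_le_sum) (auto simp: power_mult)
    also have "\<dots> = mat 1 \<bullet> mpow (adj (X t) ** X t) p"
      by (rule power_trace_svd[OF s, symmetric])
    also have "\<dots> \<le> mat 1 \<bullet> mpow (adj (X 0) ** X 0) p"
      by (rule antimono_on_halfline[OF power_trace_derivative[OF X[unfolded field_def] \<open>p > 0\<close>]])
        (use t in \<open>auto simp: trace_defect_nonpos intro!: mult_nonneg_nonpos\<close>)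
    also have "\<dots> = (\<Sum>i\<in>UNIV. s0 i ^ (2 * p))"
      by (rule power_trace_svd[OF s0])
    also have "\<dots> \<le> (\<Sum>i\<in>(UNIV::'n set). b ^ (2 * p))"
      using svd_matrices_upto_iff[OF s0] 0 s0 by (intro sum_mono power_mono) (auto simp: svd_def)
    finally have "s i ^ (2 * p) \<le> real CARD('n) * b ^ (2 * p)" by simp
    then have "(s i / b) ^ (2 * p) \<le> real CARD('n)" using b by (simp add: power_divide field_simps)
    then show False using p by (simp add: power_mult)
  qed
  then show ?thesis using svd_matrices_upto_iff[OF s] by blast
qed

text \<open>On \<open>matrices_upto b\<close> only values of the potentials on \<open>{0..b}\<close>
  enter, so both vector fields agree there. Uniqueness then evaluates the definite description in
  \<open>flow\<close>.\<close>

lemma flow_eq_solution: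
  fixes T :: "complex^'n^'n"
  assumes eq: "\<And>x. x \<in> {0..b} \<Longrightarrow> \<phi>1 x = \<psi>1 x" "\<And>x. x \<in> {0..b} \<Longrightarrow> \<phi>2 x = \<psi>2 x"
    and b: "b > 0" and T: "T \<in> matrices_upto b"
  obtains X where "X 0 = T" "\<And>t. 0 \<le> t \<Longrightarrow> X t \<in> matrices_upto b"
    "\<And>t. 0 \<le> t \<Longrightarrow> (X has_vector_derivative field (X t)) (at t within {0..})"
    "\<And>t. 0 \<le> t \<Longrightarrow> flow b \<phi>1 \<phi>2 t T = X t"
proof -
  obtain X where X: "X 0 = T" "\<And>t. 0 \<le> t \<Longrightarrow> (X has_vector_derivative field (X t)) (at t within {0..})"
    using solution_exists[of T] by blast
  have upto: "X t \<in> matrices_upto b" if "0 \<le> t" for t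
    using solution_in_matrices_upto[OF X(2) _ b that] X(1) T by simp
  have phi: "commutator (phi_map \<phi>1 \<phi>2 Y) Y = field Y" if "Y \<in> matrices_upto b" for Y :: "complex^'n^'n"
  proof -
    have "abs_fun \<phi>1 Y = abs_fun \<psi>1 Y" by (rule abs_fun_cong[OF that eq(1)])
    moreover have "abs_fun \<phi>2 (adj Y) = abs_fun \<psi>2 (adj Y)"
      by (rule abs_fun_cong[OF _ eq(2)]) (use that in simp_all)
    ultimately show ?thesis by (simp add: field_def phi_map_abs_fun)
  qed
  have sol: "is_global_solution b \<phi>1 \<phi>2 T X"
    using X upto by (simp add: is_global_solution_def phi)
  have "flow b \<phi>1 \<phi>2 t T = X t" if t: "0 \<le> t" for t
    unfolding flow_def
  proof (rule the_equality)
    fix Y assume "\<exists>X. is_global_solution b \<phi>1 \<phi>2 T X \<and> Y = X t"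
    then obtain Z where Z: "is_global_solution b \<phi>1 \<phi>2 T Z" "Y = Z t" by blast
    have "X t = Z t"
    proof (rule solution_unique[OF X(2)])
      show "(Z has_vector_derivative field (Z t)) (at t within {0..})" if "0 \<le> t" for t
        using Z(1) that phi by (auto simp: is_global_solution_def)
      show "norm (X t) \<le> (real CARD('n))\<^sup>2 * b" if "0 \<le> t" for t
        using norm_matrices_upto_le[OF upto[OF that]] b by simp
    qed (use X Z t in \<open>auto simp: is_global_solution_def\<close>)
    then show "Y = X t" using Z by simp
  qed (use sol in blast)
  with X upto show ?thesis by (intro that[of X]) auto
qed

end

section \<open>Polynomials in a matrix\<close>

text \<open>Horner's scheme, the matrix counterpart of \<open>poly\<close>, with coefficients
  entering as scalar matrices.\<close>

definition poly_mat :: "complex poly \<Rightarrow> complex^'n^'n \<Rightarrow> complex^'n^'n" where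
  "poly_mat p X = fold_coeffs (\<lambda>a A. mat a + X ** A) p 0"

lemma poly_mat_0 [simp]: "poly_mat 0 X = 0"
  by (simp add: poly_mat_def)

lemma poly_mat_pCons [simp]: "poly_mat (pCons a p) X = mat a + X ** poly_mat p X"
  by (cases "p = 0 \<and> a = 0") (auto simp: poly_mat_def)

lemma mat_add: "mat (a + b) = (mat a + mat b :: complex^'n^'n)"
  by (simp add: mat_def vec_eq_iff)

lemma mat_mult_nth: "(mat c ** (A::complex^'n^'n)) $ i $ j = c * A $ i $ j"
  by (simp add: mult_nth mat_def if_distrib[of "\<lambda>x. x * _"] cong: if_cong)

lemma mult_mat_nth: "((A::complex^'n^'n) ** mat c) $ i $ j = A $ i $ j * c"
  by (simp add: mult_nth mat_def if_distrib[of "\<lambda>x. _ * x"] cong: if_cong)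

lemma mat_commute: "mat c ** (A::complex^'n^'n) = A ** mat c"
  by (simp add: vec_eq_iff mat_mult_nth mult_mat_nth)

lemma mat_of_real_mult: "mat (complex_of_real r) ** (A::complex^'n^'n) = r *\<^sub>R A"
  by (simp add: vec_eq_iff mat_mult_nth scaleR_conv_of_real[of r "_::complex"])

lemma poly_mat_add: "poly_mat (p + q) X = poly_mat p X + poly_mat q X"
  by (induction p q rule: poly_induct2) (simp_all add: mat_add matrix_simps)

lemma poly_mat_smult: "poly_mat (smult c p) X = mat c ** poly_mat p X"
proof (induction p)
  case (pCons a p)
  have "mat (c * a) = mat c ** mat a" by (simp add: vec_eq_iff mat_mult_nth) (simp add: mat_def)
  with pCons show ?case by (simp add: matrix_simps mat_commute[of c X])
qed simp

lemma poly_mat_minus: "poly_mat (- p) X = - poly_mat p X"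
  using poly_mat_smult[of "-1" p X] mat_of_real_mult[of "-1" "poly_mat p X"] by simp

lemma poly_mat_diff: "poly_mat (p - q) X = poly_mat p X - poly_mat q X"
  using poly_mat_add[of p "- q" X] by (simp add: poly_mat_minus)

lemma poly_mat_mult: "poly_mat (p * q) X = poly_mat p X ** poly_mat q X"
  by (induction p) (simp_all add: poly_mat_add poly_mat_smult matrix_simps)

lemma poly_mat_sum: "poly_mat (\<Sum>z\<in>A. h z) X = (\<Sum>z\<in>A. poly_mat (h z) X)"
  by (induction A rule: infinite_finite_induct) (simp_all add: poly_mat_add)

lemma poly_mat_X: "poly_mat [:0, 1:] X = X"
  by (simp add: mat_0 matrix_simps)

lemma poly_mat_power: "poly_mat (p ^ k) X = mpow (poly_mat p X) k"
  by (induction k) (simp_all add: poly_mat_mult one_pCons matrix_simps del: one_poly_eq_simps)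

lemma poly_mat_dvd:
  assumes "p dvd q" "poly_mat p X = 0" shows "poly_mat q X = 0"
  using assms by (auto simp: dvd_def poly_mat_mult)

lemma poly_mat_commute:
  assumes "A ** X = X ** A" shows "A ** poly_mat p X = poly_mat p X ** A"
proof (induction p)
  case (pCons a p)
  have "A ** X ** poly_mat p X = X ** poly_mat p X ** A"
    using pCons assms by (metis matrix_mul_assoc)
  then show ?case by (simp add: matrix_simps mat_commute[of a A])
qed simp

lemma continuous_on_poly_mat: "continuous_on UNIV (poly_mat p)"
  by (induction p) (auto intro!: continuous_intros matmul.continuous_on)

lemma tendsto_poly_mat: "(X \<longlongrightarrow> N) F \<Longrightarrow> ((\<lambda>t. poly_mat p (X t)) \<longlongrightarrow> poly_mat p N) F"
  using continuous_on_tendsto_compose[OF continuous_on_poly_mat] by auto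

text \<open>\<open>commutator P\<close> is a derivation that kills scalar matrices, so a Lax
  equation passes from \<open>X\<close> to every polynomial in \<open>X\<close>.\<close>

lemma poly_mat_derivative:
  assumes X: "(X has_vector_derivative commutator P (X t)) (at t within S)"
  shows "((\<lambda>t. poly_mat p (X t)) has_vector_derivative commutator P (poly_mat p (X t))) (at t within S)"
proof (induction p)
  case (pCons a p)
  have "((\<lambda>t. mat a + X t ** poly_mat p (X t)) has_vector_derivative
      0 + (X t ** commutator P (poly_mat p (X t)) + commutator P (X t) ** poly_mat p (X t))) (at t within S)"
    by (intro has_vector_derivative_add has_vector_derivative_const matmul.has_vector_derivative X pCons)
  moreover have "0 + (X t ** commutator P (poly_mat p (X t)) + commutator P (X t) ** poly_mat p (X t))
      = commutator P (mat a + X t ** poly_mat p (X t))"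
    by (simp add: commutator_def matrix_simps mat_commute[of a P])
  ultimately show ?case by (simp only: poly_mat_pCons)
qed (simp add: commutator_def matrix_simps has_vector_derivative_const)

lemma poly_mat_monom: "poly_mat (monom c i) X = mat c ** mpow X i"
proof (induction i)
  case (Suc i)
  then show ?case by (simp add: monom_Suc matrix_simps mat_0 mat_commute[of c X])
qed (simp add: monom_0 matrix_simps)

text \<open>A count of real dimensions suffices. Linear dependence concerns sets, so coinciding
  powers are treated separately, by a difference of two monomials.\<close>

lemma annihilating_polynomial:
  fixes X :: "complex^'n^'n"
  obtains p where "p \<noteq> 0" "poly_mat p X = 0"
proof (cases "inj_on (mpow X) {..DIM(complex^'n^'n)}")
  case True
  let ?I = "{..DIM(complex^'n^'n)}"
  have "card (mpow X ` ?I) = Suc DIM(complex^'n^'n)"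
    using card_image[OF True] by simp
  then have "dependent (mpow X ` ?I)"
    by (intro dependent_biggerset) auto
  then obtain u v where u: "v \<in> mpow X ` ?I" "u v \<noteq> 0" "(\<Sum>v\<in>mpow X ` ?I. u v *\<^sub>R v) = 0"
    by (subst (asm) dependent_finite) auto
  define p where "p = (\<Sum>i\<in>?I. monom (complex_of_real (u (mpow X i))) i)"
  have "poly_mat p X = (\<Sum>i\<in>?I. u (mpow X i) *\<^sub>R mpow X i)"
    by (simp add: p_def poly_mat_sum poly_mat_monom mat_of_real_mult)
  also have "\<dots> = 0" using u(3) unfolding sum.reindex[OF True] by (simp only: o_def)
  finally have "poly_mat p X = 0" .
  moreover obtain k where k: "k \<in> ?I" "v = mpow X k" using u(1) by blast
  have "coeff p k = complex_of_real (u v)"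
    using k by (simp add: p_def coeff_sum)
  then have "p \<noteq> 0" using u(2) by auto
  ultimately show ?thesis using that by blast
next
  case False
  then obtain i j where ij: "i \<noteq> j" "mpow X i = mpow X j" by (auto simp: inj_on_def)
  let ?p = "monom 1 i - monom 1 j :: complex poly"
  have "coeff ?p i = 1" using ij(1) by simp
  then have "?p \<noteq> 0" by (metis coeff_0 zero_neq_one)
  moreover have "poly_mat ?p X = 0" by (simp add: poly_mat_diff poly_mat_monom ij)
  ultimately show ?thesis using that by blast
qed

text \<open>A Chinese remainder construction: the \<open>h z\<close> become the spectral projections, and
  \<open>x - \<Sum> z h(z)\<close> the nilpotent part, of any matrix annihilated by the product.\<close>

lemma spectral_idempotents:
  fixes e :: "complex \<Rightarrow> nat"
  assumes "finite A"
  shows "\<exists>h k. (\<forall>z\<in>A. (\<Prod>z\<in>A. [:- z, 1:] ^ e z) dvd (h z * h z - h z)) \<and>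
    (\<Prod>z\<in>A. [:- z, 1:] ^ e z) dvd ([:0, 1:] - (\<Sum>z\<in>A. smult z (h z))) ^ k"
  using assms
proof (induction A)
  case empty
  show ?case by auto
next
  case (insert z A)
  define \<kappa> where "\<kappa> = (\<Prod>z\<in>A. [:- z, 1:] ^ e z)"
  define p where "p = [:- z, 1:] ^ e z"
  from insert obtain h k where h: "\<And>w. w \<in> A \<Longrightarrow> \<kappa> dvd (h w * h w - h w)"
    and k: "\<kappa> dvd ([:0, 1:] - (\<Sum>w\<in>A. smult w (h w))) ^ k"
    unfolding \<kappa>_def by blast
  have cop: "coprime p \<kappa>"
  proof -
    have *: "coprime [:- z, 1:] [:- w, 1:]" if "w \<in> A" for w
    proof (rule coprimeI)
      have "z \<noteq> w" using insert that by auto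
      fix d assume "d dvd [:- z, 1:]" "d dvd [:- w, 1:]"
      then have "d dvd [:- z, 1:] - [:- w, 1:]" by (rule dvd_diff)
      then have "d dvd [:w - z:]" by simp
      moreover have "is_unit [:w - z:]" using \<open>z \<noteq> w\<close> by (simp add: is_unit_const_poly_iff dvd_field_iff)
      ultimately show "is_unit d" by (rule dvd_trans)
    qed
    show ?thesis unfolding p_def \<kappa>_def
      by (rule prod_coprime_right, unfold coprime_power_left_iff coprime_power_right_iff) (use * in blast)
  qed
  have "fst (bezout_coefficients p \<kappa>) * p + snd (bezout_coefficients p \<kappa>) * \<kappa> = 1"
    using bezout_coefficients_fst_snd[of p \<kappa>] cop by (simp only: coprime_iff_gcd_eq_1)
  then obtain u v where uv: "u * p + v * \<kappa> = 1" by blast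
  \<comment> \<open>\<open>E\<close> is 1 modulo \<open>p\<close> and 0 modulo
    \<open>\<kappa>\<close>: it becomes the projection for the new root. The old ones are multiplied
    by \<open>1 - E\<close>, which kills them modulo \<open>p\<close> and does not change them
    modulo \<open>\<kappa>\<close>.\<close>
  define E where "E = v * \<kappa>"
  have E: "1 - E = u * p" using uv by (simp add: E_def algebra_simps)
  define r where "r = (\<Sum>w\<in>A. smult w (h w))"
  define h' where "h' w = (if w = z then E else h w * (u * p))" for w
  define Q where "Q = [:0, 1:] - r"
  define Q' where "Q' = [:0, 1:] - (\<Sum>w\<in>insert z A. smult w (h' w))"
  have "(\<Sum>w\<in>A. smult w (h' w)) = (\<Sum>w\<in>A. smult w (h w) * (u * p))"
    using insert by (intro sum.cong) (auto simp: h'_def)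
  also have "\<dots> = r * (u * p)" by (simp add: r_def sum_distrib_right)
  finally have sum: "(\<Sum>w\<in>insert z A. smult w (h' w)) = smult z E + r * (u * p)"
    using insert by (simp add: h'_def)
  have X: "[:0, 1:] = [:- z, 1:] + [:z:]" by simp
  \<comment> \<open>Modulo \<open>p\<close> the new nilpotent part is \<open>[:- z, 1:]\<close>;
    modulo \<open>\<kappa>\<close>, as shown next, it is the old one.\<close>
  have Q'1: "Q' = [:- z, 1:] + u * p * ([:z:] - r)"
  proof -
    have "E = 1 - u * p" unfolding E[symmetric] by simp
    then have "smult z E = smult z (1 - u * p)" by (rule arg_cong)
    also have "\<dots> = [:z:] * (1 - u * p)" by simp
    finally have "smult z E = [:z:] * (1 - u * p)" .
    then have "Q' = [:- z, 1:] + [:z:] - ([:z:] * (1 - u * p) + r * (u * p))"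
      by (simp only: Q'_def sum X)
    moreover have "a + c - (c * (1 - q) + r * q) = a + q * (c - r)" for a c q :: "complex poly"
      by (simp add: algebra_simps)
    ultimately show ?thesis by (rule trans)
  qed
  have Q'2: "Q - Q' = \<kappa> * (v * ([:z:] - r))"
  proof -
    have "Q' = Q - E * ([:z:] - r)"
      unfolding Q'_def sum E[symmetric] Q_def by (simp add: algebra_simps)
    then show ?thesis by (simp add: E_def mult_ac)
  qed
  have "p dvd Q' ^ e z"
  proof (cases "e z = 0")
    case False
    have "[:- z, 1:] dvd p" unfolding p_def using False by (intro dvd_power) auto
    then have "[:- z, 1:] dvd Q'" unfolding Q'1 by (intro dvd_add) auto
    then show ?thesis unfolding p_def by (rule dvd_power_same)
  qed (simp add: p_def)
  \<comment> \<open>Divisibility by \<open>p\<close> needs exponent \<open>e z\<close>, divisibility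
    by \<open>\<kappa>\<close> needs \<open>k\<close>; their sum serves both.\<close>
  then have 1: "p dvd Q' ^ (e z + k)" by (simp add: power_add)
  have "\<kappa> dvd Q ^ k - Q' ^ k"
  proof -
    have "Q - Q' dvd Q ^ k - Q' ^ k" by (simp add: power_diff_sumr2)
    then show ?thesis unfolding Q'2 by (rule dvd_trans[rotated]) simp
  qed
  from dvd_diff[OF k[folded r_def, folded Q_def] this] have "\<kappa> dvd Q' ^ k" by simp
  then have 2: "\<kappa> dvd Q' ^ (e z + k)" by (simp add: power_add)
  have prod: "(\<Prod>w\<in>insert z A. [:- w, 1:] ^ e w) = p * \<kappa>"
    using insert by (simp add: p_def \<kappa>_def)
  show ?case
    unfolding prod
  proof (intro exI conjI ballI)
    show "p * \<kappa> dvd ([:0, 1:] - (\<Sum>w\<in>insert z A. smult w (h' w))) ^ (e z + k)"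
      using divides_mult[OF 1 2 cop] by (simp add: Q'_def)
    fix w assume w: "w \<in> insert z A"
    show "p * \<kappa> dvd h' w * h' w - h' w"
    proof (cases "w = z")
      case True
      have "h' w * h' w - h' w = p * \<kappa> * (- u * v)"
      proof -
        have "E * E - E = - (1 - E) * E" by (simp add: algebra_simps)
        also have "\<dots> = - (u * p) * (v * \<kappa>)" by (simp only: E E_def[symmetric])
        finally show ?thesis using True by (simp add: h'_def algebra_simps)
      qed
      then show ?thesis by simp
    next
      case False
      then have "\<kappa> dvd h w * h w - h w" using w h by simp
      then obtain g where g: "h w * h w - h w = \<kappa> * g" by (auto simp: dvd_def)
      have "h' w * h' w - h' w = (h w * h w - h w) * (u * p) * (u * p) - h w * (u * p) * (1 - u * p)"
        using False by (simp add: h'_def algebra_simps)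
      also have "1 - u * p = v * \<kappa>" using uv by (simp add: algebra_simps)
      finally have "h' w * h' w - h' w = p * \<kappa> * (g * u * (u * p) - h w * u * v)"
        unfolding g by (simp add: algebra_simps)
      then show ?thesis by simp
    qed
  qed
qed

section \<open>Normal matrices\<close>

lemma normal_norm_mult:
  assumes "normal_matrix N" shows "norm (N ** Y) = norm (adj N ** (Y::complex^'n^'n))"
proof -
  have "(N ** Y) \<bullet> (N ** Y) = Y \<bullet> (adj N ** N ** Y)"
    by (simp add: inner_matmul_left matrix_mul_assoc)
  also have "adj N ** N ** Y = N ** adj N ** Y" using assms by (simp add: normal_matrix_def)
  also have "Y \<bullet> (N ** adj N ** Y) = (adj N ** Y) \<bullet> (adj N ** Y)"
    by (simp add: inner_matmul_left[of "adj N"] matrix_mul_assoc)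
  finally show ?thesis by (simp add: norm_eq_sqrt_inner)
qed

text \<open>For normal \<open>N\<close>, vanishing of \<open>N ** (N ** Y)\<close> gives vanishing
  of \<open>adj N ** (N ** Y)\<close>, hence of the squared norm of \<open>N ** Y\<close>. Factors
  are removed one at a time.\<close>

lemma normal_nilpotent_zero:
  fixes N :: "complex^'n^'n"
  assumes N: "normal_matrix N" and "mpow N k = 0"
  shows "N = 0"
proof -
  have step: "N ** Y = 0" if "N ** (N ** Y) = 0" for Y :: "complex^'n^'n"
  proof -
    have "adj N ** (N ** Y) = 0" using normal_norm_mult[OF N, of "N ** Y"] that by simp
    then have "(N ** Y) \<bullet> (N ** Y) = 0" by (simp add: inner_matmul_left)
    then show ?thesis by simp
  qed
  have "N ** mpow N k = 0" using assms(2) by (simp add: matrix_simps)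
  then have "N ** mpow N 0 = 0"
  proof (induction k)
    case (Suc k)
    then have "N ** (N ** mpow N k) = 0" by (simp only: mpow.simps)
    then show ?case using step Suc.IH by blast
  qed simp
  then show ?thesis by simp
qed

text \<open>\<open>N ** (mat 1 - N)\<close> is 0, hence so is \<open>adj N ** (mat 1 - N)\<close>.
  Thus \<open>adj N\<close> equals \<open>adj N ** N\<close>, which is Hermitian.\<close>

lemma normal_idempotent_hermitian:
  assumes N: "normal_matrix N" and "N ** N = N"
  shows "adj N = N"
proof -
  have "norm (adj N ** (mat 1 - N)) = norm (N ** (mat 1 - N))"
    by (rule normal_norm_mult[OF N, symmetric])
  then have eq: "adj N = adj N ** N" using assms(2) by (simp add: matrix_simps)
  then have "adj (adj N) = adj (adj N ** N)" by simp
  then have "N = adj N ** N" by (simp add: adj_mult)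
  with eq show ?thesis by simp
qed

lemma normal_poly_mat:
  assumes "normal_matrix N" shows "normal_matrix (poly_mat p N)"
proof -
  have "adj N ** poly_mat p N = poly_mat p N ** adj N"
    by (rule poly_mat_commute) (use assms in \<open>simp add: normal_matrix_def\<close>)
  from arg_cong[OF this, of adj] have "adj (poly_mat p N) ** N = N ** adj (poly_mat p N)"
    by (simp add: adj_mult)
  then show ?thesis unfolding normal_matrix_def by (rule poly_mat_commute)
qed

section \<open>The linearised decay of the non-Hermitian part\<close>

text \<open>The diagonal value is a prescribed function; when it is the continuous derivative, the
  quotient extends continuously across the diagonal.\<close>

definition diff_quot :: "(real \<Rightarrow> real) \<Rightarrow> (real \<Rightarrow> real) \<Rightarrow> real \<Rightarrow> real \<Rightarrow> real" where
  "diff_quot f f' x y = (if x = y then f' x else (f x - f y) / (x - y))"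

lemma diff_quot_mult: "f x - f y = diff_quot f f' x y * (x - y)"
  by (simp add: diff_quot_def)

lemma diff_quot_commute: "diff_quot f f' x y = diff_quot f f' y x"
  by (simp add: diff_quot_def divide_simps) (simp add: algebra_simps)

lemma diff_quot_mvt:
  assumes deriv: "\<And>x. x \<in> {a..b} \<Longrightarrow> (f has_real_derivative f' x) (at x within {a..b})"
    and "x \<in> {a..b}" "y \<in> {a..b}"
  obtains z where "min x y \<le> z" "z \<le> max x y" "diff_quot f f' x y = f' z"
proof -
  have *: "\<exists>z. x \<le> z \<and> z \<le> y \<and> diff_quot f f' y x = f' z" if xy: "x \<in> {a..b}" "y \<in> {a..b}" "x < y" for x y
  proof -
    have d: "(f has_real_derivative f' z) (at z)" if "x < z" "z < y" for z
      using deriv[of z] xy that at_within_Icc_at[of a z b] by simp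
    have "continuous_on {a..b} f" using deriv by (rule DERIV_continuous_on)
    then have "continuous_on {x..y} f" by (rule continuous_on_subset) (use xy in auto)
    then obtain l z where z: "x < z" "z < y" "(f has_real_derivative l) (at z)" "f y - f x = (y - x) * l"
      using MVT[OF xy(3)] d real_differentiable_def by metis
    then have "l = f' z" using d DERIV_unique by blast
    with z xy(3) show ?thesis by (intro exI[of _ z]) (simp add: diff_quot_def)
  qed
  consider "x = y" | "x < y" | "y < x" by linarith
  then show ?thesis
  proof cases
    case 1
    then show ?thesis by (intro that[of x]) (auto simp: diff_quot_def)
  next
    case 2
    then show ?thesis using *[of x y] assms that diff_quot_commute[of f f' x y] by auto
  next
    case 3
    then show ?thesis using *[of y x] assms that by auto
  qed
qed

text \<open>At a diagonal limit the quotients are derivative values at points squeezed between the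
  two arguments, which covers sequences that hit the diagonal or not.\<close>

lemma tendsto_diff_quot:
  fixes f f' :: "real \<Rightarrow> real"
  assumes deriv: "\<And>x. x \<in> {a..b} \<Longrightarrow> (f has_real_derivative f' x) (at x within {a..b})"
    and cont: "continuous_on {a..b} f'"
    and x: "x \<longlonglongrightarrow> x0" "\<And>n. x n \<in> {a..b}" and y: "y \<longlonglongrightarrow> y0" "\<And>n. y n \<in> {a..b}"
  shows "(\<lambda>n. diff_quot f f' (x n) (y n)) \<longlonglongrightarrow> diff_quot f f' x0 y0"
proof -
  have x0: "x0 \<in> {a..b}" by (rule closed_sequentially[OF closed_atLeastAtMost _ x(1)]) (use x in auto)
  have y0: "y0 \<in> {a..b}" by (rule closed_sequentially[OF closed_atLeastAtMost _ y(1)]) (use y in auto)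
  show ?thesis
  proof (cases "x0 = y0")
    case True
    have "\<exists>z. min (x n) (y n) \<le> z \<and> z \<le> max (x n) (y n) \<and> diff_quot f f' (x n) (y n) = f' z" for n
      using diff_quot_mvt[OF deriv x(2)[of n] y(2)[of n]] by metis
    then obtain z where z: "\<And>n. min (x n) (y n) \<le> z n" "\<And>n. z n \<le> max (x n) (y n)"
      "\<And>n. diff_quot f f' (x n) (y n) = f' (z n)" by metis
    have "z \<longlonglongrightarrow> x0"
    proof (rule tendsto_sandwich)
      show "(\<lambda>n. min (x n) (y n)) \<longlonglongrightarrow> x0" using tendsto_min[OF x(1) y(1)] True by simp
      show "(\<lambda>n. max (x n) (y n)) \<longlonglongrightarrow> x0" using tendsto_max[OF x(1) y(1)] True by simp
    qed (use z in auto)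
    then have "(\<lambda>n. f' (z n)) \<longlonglongrightarrow> f' x0"
    proof (rule continuous_on_tendsto_compose[OF cont])
      show "\<forall>\<^sub>F n in sequentially. z n \<in> {a..b}"
      proof (rule always_eventually, rule allI)
        fix n show "z n \<in> {a..b}" using z(1,2)[of n] x(2)[of n] y(2)[of n] by auto
      qed
    qed (rule x0)
    then show ?thesis using True z(3) by (simp add: diff_quot_def)
  next
    case False
    have f_cont: "continuous_on {a..b} f" using deriv by (rule DERIV_continuous_on)
    have lim: "(\<lambda>n. (f (x n) - f (y n)) / (x n - y n)) \<longlonglongrightarrow> (f x0 - f y0) / (x0 - y0)"
      using False x y
      by (intro tendsto_intros continuous_on_tendsto_compose[OF f_cont] x0 y0) auto
    have "(\<lambda>n. x n - y n) \<longlonglongrightarrow> x0 - y0" by (intro tendsto_intros x y)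
    then have "\<forall>\<^sub>F n in sequentially. x n - y n \<noteq> 0"
      by (rule tendsto_imp_eventually_ne) (use False in simp)
    then have "\<forall>\<^sub>F n in sequentially. (f (x n) - f (y n)) / (x n - y n) = diff_quot f f' (x n) (y n)"
      by eventually_elim (simp add: diff_quot_def)
    from Lim_transform_eventually[OF lim this] show ?thesis using False by (simp add: diff_quot_def)
  qed
qed

text \<open>A numerator of quadratic size makes the quotient tend to 0 at the origin, which is the
  value that division by zero assigns there. So no case distinction at vanishing singular values is
  needed in the limit.\<close>

lemma tendsto_quotient_by_sum:
  fixes x y N :: "nat \<Rightarrow> real"
  assumes x: "x \<longlonglongrightarrow> x0" "\<And>n. 0 \<le> x n" and y: "y \<longlonglongrightarrow> y0" "\<And>n. 0 \<le> y n"
    and N: "N \<longlonglongrightarrow> N0" "\<And>n. \<bar>N n\<bar> \<le> (x n + y n)\<^sup>2"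
  shows "(\<lambda>n. N n / (x n + y n)) \<longlonglongrightarrow> N0 / (x0 + y0)"
proof (cases "x0 + y0 = 0")
  case True
  have "(\<lambda>n. x n + y n) \<longlonglongrightarrow> 0" using tendsto_add[OF x(1) y(1)] True by simp
  then have "(\<lambda>n. N n / (x n + y n)) \<longlonglongrightarrow> 0"
  proof (rule Lim_null_comparison[rotated], intro always_eventually allI)
    fix n
    show "norm (N n / (x n + y n)) \<le> x n + y n"
    proof (cases "x n + y n = 0")
      case False
      then have "x n + y n > 0" using x(2)[of n] y(2)[of n] by linarith
      then show ?thesis using N(2)[of n] by (simp add: pos_divide_le_eq power2_eq_square)
    qed simp
  qed
  with True show ?thesis by simp
qed (intro tendsto_intros assms)

section \<open>The quadratic form governing the decay\<close>

context spectral_potentials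
begin

text \<open>The \<open>\<psi>1\<close> term is computed in the right singular frame
  \<open>V\<close>, where \<open>abs_fun \<psi>1 X\<close> is diagonal, the \<open>\<psi>2\<close>
  term in the left frame \<open>U\<close>. The coefficients \<open>p\<close> and \<open>q\<close>
  arise from solving the commutation relations for \<open>Z + adj Z\<close>. If both singular values
  are 0, division by zero makes \<open>p\<close> and \<open>q\<close> vanish, as it should: the
  differences of the potentials vanish there too.\<close>

definition decay_form ::
    "(real \<Rightarrow> real) \<Rightarrow> (real \<Rightarrow> real) \<Rightarrow> complex^'n^'n \<Rightarrow> complex^'n^'n \<Rightarrow> ('n \<Rightarrow> real) \<Rightarrow> complex^'n^'n \<Rightarrow> real" where
  "decay_form d1 d2 U V s A = (\<Sum>i\<in>UNIV. \<Sum>j\<in>UNIV. let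
      a = (adj V ** A ** V) $ i $ j; a' = (adj U ** A ** U) $ i $ j;
      p = ((s i)\<^sup>2 + (s j)\<^sup>2) / (s i + s j); q = 2 * s i * s j / (s i + s j)
    in diff_quot \<psi>1 d1 (s i) (s j) * (p * (cmod a)\<^sup>2 - q * Re (cnj a * a'))
      + diff_quot \<psi>2 d2 (s i) (s j) * (p * (cmod a')\<^sup>2 - q * Re (cnj a * a')))"

lemma decay_form_scaleR:
  fixes A :: "complex^'n^'n"
  shows "decay_form d1 d2 U V s (r *\<^sub>R A) = r\<^sup>2 * decay_form d1 d2 U V s A"
proof -
  have entry: "(adj Q ** (r *\<^sub>R A) ** Q) $ i $ j = complex_of_real r * (adj Q ** A ** Q) $ i $ j" for Q :: "complex^'n^'n" and i j
    by (simp add: matrix_simps scaleR_conv_of_real[of r "_::complex"])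
  have sq: "(cmod (complex_of_real r * a))\<^sup>2 = r\<^sup>2 * (cmod a)\<^sup>2" for a
    by (simp add: norm_mult power_mult_distrib)
  have re: "Re (cnj (complex_of_real r * a) * (complex_of_real r * a')) = r\<^sup>2 * Re (cnj a * a')" for a a'
    by (simp add: power2_eq_square algebra_simps)
  show ?thesis
    unfolding decay_form_def Let_def sum_distrib_left entry sq re
    by (intro sum.cong refl) (simp only: ring_distribs mult_ac)
qed

lemma inner_commutator_diag:
  assumes Q: "unitary_matrix Q" and H: "H = Q ** real_diag d ** adj Q"
  shows "A \<bullet> commutator H B = (\<Sum>i\<in>UNIV. \<Sum>j\<in>UNIV.
    Re (cnj ((adj Q ** A ** Q) $ i $ j) * ((d i - d j) * (adj Q ** B ** Q) $ i $ j)))"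
proof -
  have "A \<bullet> commutator H B = (adj Q ** A ** Q) \<bullet> (adj Q ** commutator H B ** Q)"
    by (rule unitary_inner[OF unitary_adj[OF Q] Q, symmetric])
  also have "adj Q ** commutator H B ** Q = real_diag d ** (adj Q ** B ** Q) - (adj Q ** B ** Q) ** real_diag d"
    by (simp add: H commutator_def matrix_simps unitary_cancel Q)
  finally show ?thesis
    by (simp add: inner_matrix_eq real_diag_left real_diag_right algebra_simps)
qed

text \<open>The commutation relations \<open>[X, B] = - [X, A]\<close> and \<open>[X\<^sup>*, B] = [X\<^sup>*, A]\<close> determine the coordinates of
  \<open>B\<close> off the diagonal blocks of \<open>\<bar>X\<bar>\<close> in terms of those of \<open>A\<close>.\<close>

lemma inner_phi_commutator:
  fixes X Z :: "complex^'n^'n"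
  assumes s: "svd X U s V" and ZX: "Z ** X = X ** Z"
  defines "A \<equiv> Z - adj Z" and "B \<equiv> Z + adj Z"
  shows "A \<bullet> commutator (\<Phi> X) B = - decay_form d1 d2 U V s A"
proof -
  have u: "unitary_matrix U" "unitary_matrix V" and X: "X = U ** real_diag s ** adj V"
    and nonneg: "s i \<ge> 0" for i
    using s by (auto simp: svd_def)
  define a where "a = adj V ** A ** V"
  define a' where "a' = adj U ** A ** U"
  define \<beta> where "\<beta> = adj V ** B ** V"
  define \<beta>' where "\<beta>' = adj U ** B ** U"
  have ZX': "adj X ** adj Z = adj Z ** adj X" using arg_cong[OF ZX, of adj] by (simp add: adj_mult)
  have 1: "s i * \<beta> $ i $ j - \<beta>' $ i $ j * s j = - (s i * a $ i $ j - a' $ i $ j * s j)" for i j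
  proof -
    have "X ** B - B ** X = - (X ** A - A ** X)" using ZX by (simp add: A_def B_def matrix_simps)
    then have "adj U ** (X ** B - B ** X) ** V = adj U ** (- (X ** A - A ** X)) ** V" by simp
    then have "real_diag s ** \<beta> - \<beta>' ** real_diag s = - (real_diag s ** a - a' ** real_diag s)"
      by (simp add: X \<beta>_def \<beta>'_def a_def a'_def matrix_simps unitary_cancel u)
    from arg_cong[OF this, of "\<lambda>M. M $ i $ j"] show ?thesis by (simp add: real_diag_left real_diag_right)
  qed
  have 2: "s i * \<beta>' $ i $ j - \<beta> $ i $ j * s j = s i * a' $ i $ j - a $ i $ j * s j" for i j
  proof -
    have "adj X ** B - B ** adj X = adj X ** A - A ** adj X" using ZX' by (simp add: A_def B_def matrix_simps)
    then have "adj V ** (adj X ** B - B ** adj X) ** U = adj V ** (adj X ** A - A ** adj X) ** U" by simp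
    then have "real_diag s ** \<beta>' - \<beta> ** real_diag s = real_diag s ** a' - a ** real_diag s"
      by (simp add: X \<beta>_def \<beta>'_def a_def a'_def matrix_simps unitary_cancel u)
    from arg_cong[OF this, of "\<lambda>M. M $ i $ j"] show ?thesis by (simp add: real_diag_left real_diag_right)
  qed
  define p where "p i j = ((s i)\<^sup>2 + (s j)\<^sup>2) / (s i + s j)" for i j
  define q where "q i j = 2 * s i * s j / (s i + s j)" for i j
  \<comment> \<open>Relations \<open>1\<close> and \<open>2\<close> form a linear system with
    determinant of size s_i^2 - s_j^2. Cancelling only the factor s_i + s_j determines
    \<open>(s i - s j) * \<beta> $ i $ j\<close>, also for equal singular values, and this product
    is all that remains once a difference of potentials is written as a divided difference.\<close>
  have \<beta>: "complex_of_real (s i - s j) * \<beta> $ i $ j = - (p i j * a $ i $ j - q i j * a' $ i $ j)"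
   and \<beta>': "complex_of_real (s i - s j) * \<beta>' $ i $ j = p i j * a' $ i $ j - q i j * a $ i $ j" for i j
  proof -
    have pq: "complex_of_real (s i + s j) * complex_of_real (p i j) = complex_of_real ((s i)\<^sup>2 + (s j)\<^sup>2)"
      "complex_of_real (s i + s j) * complex_of_real (q i j) = complex_of_real (2 * s i * s j)"
      if "s i + s j \<noteq> 0"
      using that unfolding of_real_mult[symmetric] by (simp_all add: p_def q_def)
    have "complex_of_real (s i + s j) * (complex_of_real (s i - s j) * \<beta> $ i $ j)
      = s i * (s i * \<beta> $ i $ j - \<beta>' $ i $ j * s j) + s j * (s i * \<beta>' $ i $ j - \<beta> $ i $ j * s j)"
      by (simp add: algebra_simps)
    also have "\<dots> = - (complex_of_real ((s i)\<^sup>2 + (s j)\<^sup>2) * a $ i $ j - complex_of_real (2 * s i * s j) * a' $ i $ j)"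
      unfolding 1 2 by (simp add: algebra_simps power2_eq_square)
    finally have x: "complex_of_real (s i + s j) * (complex_of_real (s i - s j) * \<beta> $ i $ j)
      = - (complex_of_real ((s i)\<^sup>2 + (s j)\<^sup>2) * a $ i $ j - complex_of_real (2 * s i * s j) * a' $ i $ j)" .
    have "complex_of_real (s i + s j) * (complex_of_real (s i - s j) * \<beta>' $ i $ j)
      = s j * (s i * \<beta> $ i $ j - \<beta>' $ i $ j * s j) + s i * (s i * \<beta>' $ i $ j - \<beta> $ i $ j * s j)"
      by (simp add: algebra_simps)
    also have "\<dots> = complex_of_real ((s i)\<^sup>2 + (s j)\<^sup>2) * a' $ i $ j - complex_of_real (2 * s i * s j) * a $ i $ j"
      unfolding 1 2 by (simp add: algebra_simps power2_eq_square)
    finally have y: "complex_of_real (s i + s j) * (complex_of_real (s i - s j) * \<beta>' $ i $ j)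
      = complex_of_real ((s i)\<^sup>2 + (s j)\<^sup>2) * a' $ i $ j - complex_of_real (2 * s i * s j) * a $ i $ j" .
    have "complex_of_real (s i - s j) * \<beta> $ i $ j = - (p i j * a $ i $ j - q i j * a' $ i $ j) \<and>
      complex_of_real (s i - s j) * \<beta>' $ i $ j = p i j * a' $ i $ j - q i j * a $ i $ j"
    proof (cases "s i + s j = 0")
      case True
      then have "s i = 0" "s j = 0" using nonneg[of i] nonneg[of j] by linarith+
      then show ?thesis by (simp add: p_def q_def)
    next
      case False
      have "complex_of_real (s i + s j) * (complex_of_real (s i - s j) * \<beta> $ i $ j)
        = complex_of_real (s i + s j) * - (p i j * a $ i $ j - q i j * a' $ i $ j)"
        unfolding x pq(1)[OF False, symmetric] pq(2)[OF False, symmetric] by (simp add: algebra_simps)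
      moreover have "complex_of_real (s i + s j) * (complex_of_real (s i - s j) * \<beta>' $ i $ j)
        = complex_of_real (s i + s j) * (p i j * a' $ i $ j - q i j * a $ i $ j)"
        unfolding y pq(1)[OF False, symmetric] pq(2)[OF False, symmetric] by (simp add: algebra_simps)
      moreover have "complex_of_real (s i + s j) \<noteq> 0" using False by (simp only: of_real_eq_0_iff not_False_eq_True)
      ultimately show ?thesis unfolding mult_cancel_left by blast
    qed
    then show "complex_of_real (s i - s j) * \<beta> $ i $ j = - (p i j * a $ i $ j - q i j * a' $ i $ j)"
      "complex_of_real (s i - s j) * \<beta>' $ i $ j = p i j * a' $ i $ j - q i j * a $ i $ j" by auto
  qed
  have Re_of_real_mult: "Re (complex_of_real r * z) = r * Re z" for r z by simp
  have re: "Re (cnj z * z) = (cmod z)\<^sup>2" for z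
    unfolding cmod_power2 by (simp add: power2_eq_square)
  have re': "Re (cnj z * w) = Re (cnj w * z)" for z w by simp
  have t1: "Re (cnj (a $ i $ j) * (complex_of_real (\<psi>1 (s i) - \<psi>1 (s j)) * \<beta> $ i $ j))
    = - (diff_quot \<psi>1 d1 (s i) (s j) * (p i j * (cmod (a $ i $ j))\<^sup>2 - q i j * Re (cnj (a $ i $ j) * a' $ i $ j)))" for i j
  proof -
    have "complex_of_real (\<psi>1 (s i) - \<psi>1 (s j)) * \<beta> $ i $ j
      = diff_quot \<psi>1 d1 (s i) (s j) * (complex_of_real (s i - s j) * \<beta> $ i $ j)"
      unfolding diff_quot_mult[of \<psi>1 "s i" "s j" d1] by simp
    also have "\<dots> = - (diff_quot \<psi>1 d1 (s i) (s j) * (p i j * a $ i $ j - q i j * a' $ i $ j))"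
      unfolding \<beta> by (simp add: algebra_simps)
    finally have e: "complex_of_real (\<psi>1 (s i) - \<psi>1 (s j)) * \<beta> $ i $ j
      = - (diff_quot \<psi>1 d1 (s i) (s j) * (p i j * a $ i $ j - q i j * a' $ i $ j))" .
    have "cnj (a $ i $ j) * (complex_of_real (\<psi>1 (s i) - \<psi>1 (s j)) * \<beta> $ i $ j)
      = complex_of_real (- diff_quot \<psi>1 d1 (s i) (s j)) * (complex_of_real (p i j) * (cnj (a $ i $ j) * a $ i $ j)
        - complex_of_real (q i j) * (cnj (a $ i $ j) * a' $ i $ j))"
      unfolding e by (simp add: algebra_simps)
    then show ?thesis by (simp only: Re_of_real_mult minus_complex.sel re mult_minus_left)
  qed
  have t2: "Re (cnj (a' $ i $ j) * (complex_of_real (\<psi>2 (s i) - \<psi>2 (s j)) * \<beta>' $ i $ j))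
    = diff_quot \<psi>2 d2 (s i) (s j) * (p i j * (cmod (a' $ i $ j))\<^sup>2 - q i j * Re (cnj (a $ i $ j) * a' $ i $ j))" for i j
  proof -
    have "complex_of_real (\<psi>2 (s i) - \<psi>2 (s j)) * \<beta>' $ i $ j
      = diff_quot \<psi>2 d2 (s i) (s j) * (complex_of_real (s i - s j) * \<beta>' $ i $ j)"
      unfolding diff_quot_mult[of \<psi>2 "s i" "s j" d2] by simp
    also have "\<dots> = diff_quot \<psi>2 d2 (s i) (s j) * (p i j * a' $ i $ j - q i j * a $ i $ j)"
      unfolding \<beta>' by simp
    finally have e: "complex_of_real (\<psi>2 (s i) - \<psi>2 (s j)) * \<beta>' $ i $ j
      = diff_quot \<psi>2 d2 (s i) (s j) * (p i j * a' $ i $ j - q i j * a $ i $ j)" .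
    have "cnj (a' $ i $ j) * (complex_of_real (\<psi>2 (s i) - \<psi>2 (s j)) * \<beta>' $ i $ j)
      = complex_of_real (diff_quot \<psi>2 d2 (s i) (s j)) * (complex_of_real (p i j) * (cnj (a' $ i $ j) * a' $ i $ j)
        - complex_of_real (q i j) * (cnj (a' $ i $ j) * a $ i $ j))"
      unfolding e by (simp add: algebra_simps)
    then show ?thesis
      by (simp only: Re_of_real_mult minus_complex.sel re re'[of "a' $ i $ j" "a $ i $ j"])
  qed
  have "commutator (\<Phi> X) B = commutator (abs_fun \<psi>1 X) B - commutator (abs_fun \<psi>2 (adj X)) B"
    by (simp add: phi_map_abs_fun commutator_diff_left)
  then have "A \<bullet> commutator (\<Phi> X) B = (\<Sum>i\<in>UNIV. \<Sum>j\<in>UNIV.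
      Re (cnj (a $ i $ j) * (complex_of_real (\<psi>1 (s i) - \<psi>1 (s j)) * \<beta> $ i $ j)))
    - (\<Sum>i\<in>UNIV. \<Sum>j\<in>UNIV.
      Re (cnj (a' $ i $ j) * (complex_of_real (\<psi>2 (s i) - \<psi>2 (s j)) * \<beta>' $ i $ j)))"
    using inner_commutator_diag[OF u(2) svd_abs_fun[OF s, of \<psi>1], of A B]
      inner_commutator_diag[OF u(1) svd_abs_fun[OF svd_adj[OF s], of \<psi>2], of A B]
    by (simp only: inner_diff_right a_def a'_def \<beta>_def \<beta>'_def of_real_diff)
  also have "\<dots> = - decay_form d1 d2 U V s A"
    unfolding t1 t2 decay_form_def Let_def a_def[symmetric] a'_def[symmetric] p_def[symmetric] q_def[symmetric]
    by (simp only: sum.distrib sum_negf)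
  finally show ?thesis .
qed

end

text \<open>For normal \<open>N\<close> both frames diagonalise the same matrix
  \<open>adj N ** N\<close>, so the change of frame only mixes indices with equal singular
  values.\<close>

lemma normal_svd_intertwine:
  fixes N :: "complex^'n^'n"
  assumes N: "normal_matrix N" and s: "svd N U s V" and W: "(adj V ** U) $ i $ j \<noteq> 0"
  shows "s i = s j"
proof -
  have u: "unitary_matrix U" "unitary_matrix V" and nonneg: "s i \<ge> 0" for i using s by (auto simp: svd_def)
  have "V ** real_diag (\<lambda>i. (s i)\<^sup>2) ** adj V = U ** real_diag (\<lambda>i. (s i)\<^sup>2) ** adj U"
    using N svd_gram[OF s] svd_gram[OF svd_adj[OF s]] by (simp add: normal_matrix_def)
  then have "adj V ** (V ** real_diag (\<lambda>i. (s i)\<^sup>2) ** adj V) ** U = adj V ** (U ** real_diag (\<lambda>i. (s i)\<^sup>2) ** adj U) ** U"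
    by simp
  then have "real_diag (\<lambda>i. (s i)\<^sup>2) ** (adj V ** U) = (adj V ** U) ** real_diag (\<lambda>i. (s i)\<^sup>2)"
    by (simp add: matrix_mul_assoc unitary_cancel u)
  from arg_cong[OF this, of "\<lambda>M. M $ i $ j"]
  have "complex_of_real ((s i)\<^sup>2) * (adj V ** U) $ i $ j = (adj V ** U) $ i $ j * complex_of_real ((s j)\<^sup>2)"
    by (simp only: real_diag_left real_diag_right)
  with W have "complex_of_real ((s i)\<^sup>2) = complex_of_real ((s j)\<^sup>2)" by simp
  then have "(s i)\<^sup>2 = (s j)\<^sup>2" by (simp only: of_real_eq_iff)
  then show ?thesis using nonneg by (simp add: power2_eq_iff_nonneg)
qed

text \<open>The two coordinate matrices differ by conjugation with the block-diagonal
  \<open>W\<close>. Entrywise multiplication by weights that are constant on the blocks, called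
  \<open>H\<close> here, commutes with this conjugation.\<close>

lemma sum_weighted_entries_invariant:
  fixes N A :: "complex^'n^'n" and G :: "real \<Rightarrow> real \<Rightarrow> real"
  assumes N: "normal_matrix N" and s: "svd N U s V"
  shows "(\<Sum>i\<in>UNIV. \<Sum>j\<in>UNIV. G (s i) (s j) * (cmod ((adj U ** A ** U) $ i $ j))\<^sup>2)
    = (\<Sum>i\<in>UNIV. \<Sum>j\<in>UNIV. G (s i) (s j) * (cmod ((adj V ** A ** V) $ i $ j))\<^sup>2)"
proof -
  have u: "unitary_matrix U" "unitary_matrix V" using s by (auto simp: svd_def)
  define W where "W = adj V ** U"
  have W: "unitary_matrix W" unfolding W_def by (intro unitary_mult unitary_adj u)
  have Ws: "s i = s j" if "W $ i $ j \<noteq> 0" for i j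
    using normal_svd_intertwine[OF N s] that by (simp add: W_def)
  define H where "H M = (\<chi> i j. complex_of_real (G (s i) (s j)) * M $ i $ j)" for M :: "complex^'n^'n"
  have inner: "M \<bullet> H M = (\<Sum>i\<in>UNIV. \<Sum>j\<in>UNIV. G (s i) (s j) * (cmod (M $ i $ j))\<^sup>2)" for M
  proof -
    have "cnj z * (complex_of_real g * z) = complex_of_real (g * (cmod z)\<^sup>2)" for z g
      by (simp only: of_real_mult complex_norm_square mult_ac)
    then show ?thesis by (simp only: inner_matrix_eq H_def vec_lambda_beta of_real_sum[symmetric] Re_complex_of_real)
  qed
  have H: "H (adj W ** M ** W) = adj W ** H M ** W" for M
  proof -
    have "H (adj W ** M ** W) $ i $ j = (adj W ** H M ** W) $ i $ j" for i j
    proof -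
      have "H (adj W ** M ** W) $ i $ j = (\<Sum>l\<in>UNIV. \<Sum>k\<in>UNIV. complex_of_real (G (s i) (s j)) * (cnj (W $ k $ i) * M $ k $ l * W $ l $ j))"
        by (simp add: H_def mult_nth adj_nth sum_distrib_left sum_distrib_right)
      also have "\<dots> = (\<Sum>l\<in>UNIV. \<Sum>k\<in>UNIV. cnj (W $ k $ i) * (complex_of_real (G (s k) (s l)) * M $ k $ l) * W $ l $ j)"
      proof (intro sum.cong refl)
        fix k l
        show "complex_of_real (G (s i) (s j)) * (cnj (W $ k $ i) * M $ k $ l * W $ l $ j)
          = cnj (W $ k $ i) * (complex_of_real (G (s k) (s l)) * M $ k $ l) * W $ l $ j"
          using Ws[of k i] Ws[of l j] by (cases "W $ k $ i = 0"; cases "W $ l $ j = 0") (auto simp: mult_ac)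
      qed
      also have "\<dots> = (adj W ** H M ** W) $ i $ j"
        by (simp add: H_def mult_nth adj_nth sum_distrib_left sum_distrib_right)
      finally show ?thesis .
    qed
    then show ?thesis by (simp add: vec_eq_iff)
  qed
  have AW: "adj U ** A ** U = adj W ** (adj V ** A ** V) ** W"
    by (simp add: W_def adj_mult matrix_mul_assoc unitary_cancel u)
  show ?thesis
    unfolding inner[symmetric] AW H by (rule unitary_inner[OF unitary_adj[OF W] W])
qed

context spectral_potentials
begin

text \<open>In general the mixed term may outweigh the only square present beside it. At a normal
  matrix the weighted sums of squares in the two frames agree, so each potential may use their
  average; the result is a sum of squares. Their vanishing is the relation
  \<open>N ** A = A ** N\<close> in singular coordinates, an empty condition on the block of zero
  singular values.\<close>

lemma decay_form_normal_nonpos: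
  fixes N A :: "complex^'n^'n"
  assumes N: "normal_matrix N" and s: "svd N U s V" and sb: "\<And>i. s i \<le> b"
    and pos: "\<And>x y. x \<in> {0..b} \<Longrightarrow> y \<in> {0..b} \<Longrightarrow> x + y \<noteq> 0 \<Longrightarrow> diff_quot \<psi>1 d1 x y + diff_quot \<psi>2 d2 x y > 0"
    and le: "decay_form d1 d2 U V s A \<le> 0"
  shows "N ** A = A ** N"
proof -
  have u: "unitary_matrix U" "unitary_matrix V" and X: "N = U ** real_diag s ** adj V"
    and nonneg: "s i \<ge> 0" for i
    using s by (auto simp: svd_def)
  define a where "a = adj V ** A ** V"
  define a' where "a' = adj U ** A ** U"
  define p :: "real \<Rightarrow> real \<Rightarrow> real" where "p x y = (x\<^sup>2 + y\<^sup>2) / (x + y)" for x y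
  define q :: "real \<Rightarrow> real \<Rightarrow> real" where "q x y = 2 * x * y / (x + y)" for x y
  define g where "g x y = diff_quot \<psi>1 d1 x y + diff_quot \<psi>2 d2 x y" for x y
  define f where "f i j = g (s i) (s j) * (p (s i) (s j) * ((cmod (a $ i $ j))\<^sup>2 + (cmod (a' $ i $ j))\<^sup>2) / 2
      - q (s i) (s j) * Re (cnj (a $ i $ j) * a' $ i $ j))" for i j
  have inv: "(\<Sum>i\<in>UNIV. \<Sum>j\<in>UNIV. G (s i) (s j) * (cmod (a' $ i $ j))\<^sup>2)
    = (\<Sum>i\<in>UNIV. \<Sum>j\<in>UNIV. G (s i) (s j) * (cmod (a $ i $ j))\<^sup>2)" for G
    unfolding a_def a'_def by (rule sum_weighted_entries_invariant[OF N s])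
  have alg: "(u * p * x + u * p * y) / 2 + (v * p * x + v * p * y) / 2 - (u + v) * q * z
    = (u + v) * (p * (x + y) / 2 - q * z)" for u v p q x y z :: real
    by (simp add: field_simps)
  have "decay_form d1 d2 U V s A = (\<Sum>i\<in>UNIV. \<Sum>j\<in>UNIV. diff_quot \<psi>1 d1 (s i) (s j) * p (s i) (s j) * (cmod (a $ i $ j))\<^sup>2)
     + (\<Sum>i\<in>UNIV. \<Sum>j\<in>UNIV. diff_quot \<psi>2 d2 (s i) (s j) * p (s i) (s j) * (cmod (a' $ i $ j))\<^sup>2)
     - (\<Sum>i\<in>UNIV. \<Sum>j\<in>UNIV. g (s i) (s j) * q (s i) (s j) * Re (cnj (a $ i $ j) * a' $ i $ j))"
    unfolding decay_form_def Let_def sum.distrib[symmetric] sum_subtractf[symmetric]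
      a_def[symmetric] a'_def[symmetric] p_def[symmetric] q_def[symmetric]
    by (intro sum.cong refl) (simp add: g_def algebra_simps)
  also have "(\<Sum>i\<in>UNIV. \<Sum>j\<in>UNIV. diff_quot \<psi>1 d1 (s i) (s j) * p (s i) (s j) * (cmod (a $ i $ j))\<^sup>2)
    = ((\<Sum>i\<in>UNIV. \<Sum>j\<in>UNIV. diff_quot \<psi>1 d1 (s i) (s j) * p (s i) (s j) * (cmod (a $ i $ j))\<^sup>2)
      + (\<Sum>i\<in>UNIV. \<Sum>j\<in>UNIV. diff_quot \<psi>1 d1 (s i) (s j) * p (s i) (s j) * (cmod (a' $ i $ j))\<^sup>2)) / 2"
    using inv[of "\<lambda>x y. diff_quot \<psi>1 d1 x y * p x y"] by simp
  also have "(\<Sum>i\<in>UNIV. \<Sum>j\<in>UNIV. diff_quot \<psi>2 d2 (s i) (s j) * p (s i) (s j) * (cmod (a' $ i $ j))\<^sup>2)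
    = ((\<Sum>i\<in>UNIV. \<Sum>j\<in>UNIV. diff_quot \<psi>2 d2 (s i) (s j) * p (s i) (s j) * (cmod (a $ i $ j))\<^sup>2)
      + (\<Sum>i\<in>UNIV. \<Sum>j\<in>UNIV. diff_quot \<psi>2 d2 (s i) (s j) * p (s i) (s j) * (cmod (a' $ i $ j))\<^sup>2)) / 2"
    using inv[of "\<lambda>x y. diff_quot \<psi>2 d2 x y * p x y"] by simp
  finally have form: "decay_form d1 d2 U V s A = (\<Sum>i\<in>UNIV. \<Sum>j\<in>UNIV. f i j)"
    unfolding f_def g_def sum.distrib[symmetric] sum_divide_distrib sum_subtractf[symmetric]
    by (simp only: alg)
  \<comment> \<open>With \<open>p\<close> and \<open>q\<close> over the common denominator, the term
    splits into two squares exchanged by swapping s_i and s_j.\<close>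
  have f_eq: "f i j = g (s i) (s j) / (s i + s j) / 2 *
      ((cmod (s i * a $ i $ j - a' $ i $ j * s j))\<^sup>2 + (cmod (s j * a $ i $ j - a' $ i $ j * s i))\<^sup>2)" for i j
  proof -
    have norms: "(cmod (x * z - w * y))\<^sup>2 = x\<^sup>2 * (cmod z)\<^sup>2 - 2 * x * y * Re (cnj z * w) + y\<^sup>2 * (cmod w)\<^sup>2" for x y :: real and z w :: complex
      unfolding cmod_power2 by (simp add: power2_eq_square algebra_simps)
    have alg: "k * ((x\<^sup>2 + y\<^sup>2) * d * (A + A') * inverse 2 - 2 * x * y * d * R)
      = k * d * inverse 2 * ((x\<^sup>2 * A - 2 * x * y * R + y\<^sup>2 * A') + (y\<^sup>2 * A - 2 * y * x * R + x\<^sup>2 * A'))"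
      for k x y d A A' R :: real
      by (simp add: field_simps)
    show ?thesis unfolding f_def p_def q_def norms divide_inverse by (rule alg)
  qed
  have gpos: "g (s i) (s j) / (s i + s j) / 2 > 0" if "s i + s j \<noteq> 0" for i j
  proof -
    have "s i + s j > 0" using that nonneg[of i] nonneg[of j] by linarith
    moreover have "g (s i) (s j) > 0" unfolding g_def by (rule pos) (use that nonneg sb in auto)
    ultimately show ?thesis by simp
  qed
  have f_nonneg: "f i j \<ge> 0" for i j
  proof (cases "s i + s j = 0")
    case False
    show ?thesis unfolding f_eq by (rule mult_nonneg_nonneg) (use gpos[OF False] in auto)
  qed (simp add: f_eq)
  have "(\<Sum>i\<in>UNIV. \<Sum>j\<in>UNIV. f i j) = 0"
    using le f_nonneg unfolding form by (intro antisym sum_nonneg) auto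
  then have f0: "f i j = 0" for i j
    using f_nonneg by (simp add: sum_nonneg_eq_0_iff sum_nonneg)
  have "s i * a $ i $ j = a' $ i $ j * s j" for i j
  proof (cases "s i + s j = 0")
    case True
    then have "s i = 0" "s j = 0" using nonneg[of i] nonneg[of j] by linarith+
    then show ?thesis by simp
  next
    case False
    have "(cmod (s i * a $ i $ j - a' $ i $ j * s j))\<^sup>2 + (cmod (s j * a $ i $ j - a' $ i $ j * s i))\<^sup>2 = 0"
      using f0[of i j] gpos[OF False] unfolding f_eq mult_eq_0_iff by linarith
    then show ?thesis by (simp add: sum_power2_eq_zero_iff)
  qed
  then have "real_diag s ** a = a' ** real_diag s"
    by (simp add: vec_eq_iff real_diag_left real_diag_right)
  then have "U ** (real_diag s ** a) ** adj V = U ** (a' ** real_diag s) ** adj V" by simp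
  then show ?thesis by (simp add: X a_def a'_def matrix_mul_assoc unitary_cancel u)
qed

section \<open>Energy decay and limit points of the flow\<close>

lemma inner_field_nonpos: "X \<bullet> field X \<le> 0"
  unfolding inner_field by (rule trace_defect_nonpos)

lemma continuous_on_field: "continuous_on UNIV (field :: complex^'n^'n \<Rightarrow> _)"
  unfolding continuous_on_eq_continuous_within
proof
  fix X :: "complex^'n^'n"
  obtain C where C: "0 \<le> C" "\<And>Z Y :: complex^'n^'n. norm Z \<le> norm X \<Longrightarrow> norm (field Z - field Y) \<le> C * norm (Z - Y)"
    using field_lipschitz_on_ball[of "norm X"] by metis
  have "((\<lambda>Y. C * norm (X - Y)) \<longlongrightarrow> C * norm (X - X)) (at X)"
    by (intro tendsto_intros)
  then have lim: "((\<lambda>Y. C * norm (X - Y)) \<longlongrightarrow> 0) (at X)" by simp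
  have "((\<lambda>Y. field Y - field X) \<longlongrightarrow> 0) (at X)"
  proof (rule Lim_null_comparison[OF always_eventually lim], rule allI)
    show "norm (field Y - field X) \<le> C * norm (X - Y)" for Y
      using C(2)[of X Y] by (simp add: norm_minus_commute)
  qed
  then show "continuous (at X within UNIV) field"
    unfolding continuous_within by (rule LIM_zero_cancel)
qed

text \<open>LaSalle's invariance principle for the energy \<open>\<bar>X\<bar>\<^sup>2\<close>.\<close>

lemma solution_limit_point_normal:
  fixes X :: "real \<Rightarrow> complex^'n^'n"
  assumes X: "\<And>t. 0 \<le> t \<Longrightarrow> (X has_vector_derivative field (X t)) (at t within {0..})"
    and upto: "\<And>t. 0 \<le> t \<Longrightarrow> X t \<in> matrices_upto b" and b: "b > 0"
    and strict: "strict_mono_on {0..b} (\<lambda>x. \<psi>1 x + \<psi>2 x)"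
    and \<tau>: "filterlim \<tau> at_top sequentially" and lim: "(\<lambda>n. X (\<tau> n)) \<longlonglongrightarrow> N"
    and N: "N \<in> matrices_upto b"
  shows "normal_matrix N"
proof (rule ccontr)
  assume "\<not> normal_matrix N"
  then have "trace_defect \<psi>1 \<psi>2 1 N \<noteq> 0"
    using trace_defect_zero_normal[OF mono continuous_potentials strict N] by blast
  then have neg: "N \<bullet> field N < 0"
    using inner_field_nonpos[of N] unfolding inner_field by linarith
  define \<delta> where "\<delta> = - (N \<bullet> field N)"
  have \<delta>: "\<delta> > 0" using neg by (simp add: \<delta>_def)
  have "continuous_on UNIV (\<lambda>Y::complex^'n^'n. Y \<bullet> field Y)"
    by (intro continuous_intros continuous_on_field)
  then have "((\<lambda>Y. Y \<bullet> field Y) \<longlongrightarrow> N \<bullet> field N) (nhds N)"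
    using tendsto_at_iff_tendsto_nhds[of "\<lambda>Y. Y \<bullet> field Y" N] by (simp add: continuous_on_def)
  then have "\<forall>\<^sub>F Y in nhds N. Y \<bullet> field Y < - \<delta> / 2"
    by (rule order_tendstoD) (use \<delta> in \<open>simp add: \<delta>_def\<close>)
  then obtain r where r: "r > 0" "\<And>Y. dist Y N < r \<Longrightarrow> Y \<bullet> field Y < - \<delta> / 2"
    unfolding eventually_nhds_metric by blast
  define B where "B = 4 * (real CARD('n))\<^sup>2 * M * ((real CARD('n))\<^sup>2 * b) + 1"
  have B: "norm (field (X t)) \<le> B" if "0 \<le> t" for t
  proof -
    have "norm (field (X t)) \<le> 4 * (real CARD('n))\<^sup>2 * M * ((real CARD('n))\<^sup>2 * b)"
      by (rule order_trans[OF norm_field_le])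
        (intro mult_left_mono norm_matrices_upto_le upto that, use b M_nonneg in auto)
    then show ?thesis by (simp add: B_def)
  qed
  have B0: "B > 0" using b M_nonneg unfolding B_def by (intro add_nonneg_pos mult_nonneg_nonneg) auto
  define h where "h = r / (2 * B)"
  have h: "h > 0" using r B0 by (simp add: h_def)
  have X_cont: "continuous_on {0..} X"
    using X by (intro continuous_on_vector_derivative) auto
  have X_deriv: "(X has_vector_derivative field (X t)) (at t)" if "0 < t" for t
    using X[of t] that at_within_atLeast_interior[of 0 t] by simp
  have X_lip: "norm (X t - X s) \<le> B * t - B * s" if "0 \<le> s" "s < t" for s t
  proof (rule differentiable_bound_general[OF that(2)])
    show "continuous_on {s..t} X" by (rule continuous_on_subset[OF X_cont]) (use that in auto)
    show "continuous_on {s..t} ((*) B)" by (intro continuous_intros)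
    fix x assume x: "s < x" "x < t"
    show "(X has_vector_derivative field (X x)) (at x)" using X_deriv x that by simp
    show "((*) B has_vector_derivative B) (at x)"
      using DERIV_cmult_Id[of B x] by (simp add: has_real_derivative_iff_has_vector_derivative)
    show "norm (field (X x)) \<le> B" using B x that by simp
  qed
  have E_deriv: "((\<lambda>t. X t \<bullet> X t) has_vector_derivative 2 * (X t \<bullet> field (X t))) (at t within {0..})" if "0 \<le> t" for t
    using bounded_bilinear.has_vector_derivative[OF bounded_bilinear_inner X[OF that] X[OF that]]
    by (simp add: inner_commute)
  have E_mono: "X t \<bullet> X t \<le> X s \<bullet> X s" if "0 \<le> s" "s \<le> t" for s t
    by (rule antimono_on_halfline[OF E_deriv]) (use that inner_field_nonpos in auto)
  have E_lim: "(\<lambda>n. X (\<tau> n) \<bullet> X (\<tau> n)) \<longlonglongrightarrow> N \<bullet> N"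
    by (intro tendsto_intros lim)
  have E_ge: "N \<bullet> N \<le> X t \<bullet> X t" if "0 \<le> t" for t
  proof (rule tendsto_upperbound[OF E_lim])
    show "\<forall>\<^sub>F n in sequentially. X (\<tau> n) \<bullet> X (\<tau> n) \<le> X t \<bullet> X t"
      using \<tau>[unfolded filterlim_at_top, rule_format, of t]
      by eventually_elim (use E_mono that in auto)
  qed simp
  have "\<forall>\<^sub>F n in sequentially. \<tau> n \<ge> 1 \<and> dist (X (\<tau> n)) N < r / 2 \<and> X (\<tau> n) \<bullet> X (\<tau> n) < N \<bullet> N + \<delta> * h"
    using \<tau>[unfolded filterlim_at_top, rule_format, of 1] tendstoD[OF lim, of "r / 2"] r(1)
      order_tendstoD(2)[OF E_lim, of "N \<bullet> N + \<delta> * h"] \<delta> h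
    by (intro eventually_conj) auto
  then obtain n where n: "\<tau> n \<ge> 1" "dist (X (\<tau> n)) N < r / 2" "X (\<tau> n) \<bullet> X (\<tau> n) < N \<bullet> N + \<delta> * h"
    using eventually_happens sequentially_bot by blast
  define s where "s = \<tau> n"
  \<comment> \<open>The energy drops by at least \<open>\<delta> * h\<close> during this time,
    although at time \<open>s\<close> it exceeds its lower bound \<open>N \<bullet> N\<close> by
    less than that.\<close>
  have "X (s + h) \<bullet> X (s + h) + \<delta> * (s + h) \<le> X s \<bullet> X s + \<delta> * s"
  proof (rule DERIV_nonpos_imp_decreasing_open[where f = "\<lambda>t. X t \<bullet> X t + \<delta> * t"])
    show "s \<le> s + h" using h by simp
    show "continuous_on {s..s + h} (\<lambda>t. X t \<bullet> X t + \<delta> * t)"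
      by (intro continuous_intros continuous_on_subset[OF X_cont]) (use n s_def in auto)
    fix x assume x: "s < x" "x < s + h"
    have x0: "0 < x" using x n s_def by simp
    have "norm (X x - X s) \<le> B * (x - s)" using X_lip[of s x] x n s_def by (simp add: algebra_simps)
    also have "\<dots> \<le> B * h" using x B0 by (intro mult_left_mono) auto
    also have "B * h = r / 2" using B0 by (simp add: h_def)
    finally have "dist (X x) (X s) \<le> r / 2" by (simp add: dist_norm)
    then have "dist (X x) N < r" using dist_triangle[of "X x" N "X s"] n(2) s_def by simp
    then have "2 * (X x \<bullet> field (X x)) + \<delta> \<le> 0" using r(2)[of "X x"] by simp
    moreover have "((\<lambda>t. X t \<bullet> X t + \<delta> * t) has_real_derivative 2 * (X x \<bullet> field (X x)) + \<delta>) (at x)"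
      using E_deriv[of x] x0 at_within_atLeast_interior[of 0 x]
      by (intro DERIV_add DERIV_cmult_Id) (simp add: has_real_derivative_iff_has_vector_derivative)
    ultimately show "\<exists>y. ((\<lambda>t. X t \<bullet> X t + \<delta> * t) has_real_derivative y) (at x) \<and> y \<le> 0" by blast
  qed
  moreover have "N \<bullet> N \<le> X (s + h) \<bullet> X (s + h)" using E_ge n h s_def by simp
  ultimately show False using n(3) by (simp add: s_def algebra_simps)
qed

end

section \<open>Convergence\<close>

text \<open>Only the unitary factors need compactness; the singular values converge automatically as
  diagonal entries of \<open>adj U ** X ** V\<close>.\<close>

lemma svd_subsequence:
  fixes X :: "nat \<Rightarrow> complex^'n^'n"
  assumes X: "X \<longlonglongrightarrow> N" and s: "\<And>n. svd (X n) (U n) (s n) (V n)"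
  obtains r U0 s0 V0 where "strict_mono r" "(\<lambda>n. U (r n)) \<longlonglongrightarrow> U0" "(\<lambda>n. V (r n)) \<longlonglongrightarrow> V0"
    "\<And>i. (\<lambda>n. s (r n) i) \<longlonglongrightarrow> s0 i" "svd N U0 s0 V0"
proof -
  let ?S = "{U::complex^'n^'n. unitary_matrix U}"
  have "seq_compact (?S \<times> ?S)" by (intro compact_imp_seq_compact compact_Times compact_unitary)
  moreover have f: "\<forall>n. (U n, V n) \<in> ?S \<times> ?S" using s by (auto simp: svd_def)
  ultimately obtain l r where l: "l \<in> ?S \<times> ?S" "strict_mono r" "((\<lambda>n. (U n, V n)) \<circ> r) \<longlonglongrightarrow> l"
    by (rule seq_compactE)
  obtain U0 V0 where l_eq: "l = (U0, V0)" by (cases l)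
  have u: "unitary_matrix U0" "unitary_matrix V0" using l l_eq by auto
  have U: "(\<lambda>n. U (r n)) \<longlonglongrightarrow> U0" and V: "(\<lambda>n. V (r n)) \<longlonglongrightarrow> V0"
    using tendsto_fst[OF l(3)] tendsto_snd[OF l(3)] by (simp_all add: l_eq o_def)
  have Xr: "(\<lambda>n. X (r n)) \<longlonglongrightarrow> N" using LIMSEQ_subseq_LIMSEQ[OF X l(2)] by (simp add: o_def)
  define s0 where "s0 i = Re ((adj U0 ** N ** V0) $ i $ i)" for i
  have diag: "adj (U n) ** X n ** V n = real_diag (s n)" for n
    using s[of n] by (simp add: svd_def matrix_mul_assoc unitary_cancel)
  have lim: "(\<lambda>n. adj (U (r n)) ** X (r n) ** V (r n)) \<longlonglongrightarrow> adj U0 ** N ** V0"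
    by (intro matmul.tendsto bounded_linear.tendsto[OF bounded_linear_adj] U V Xr)
  have s0: "(\<lambda>n. s (r n) i) \<longlonglongrightarrow> s0 i" for i
    using tendsto_Re[OF tendsto_vec_nth[OF tendsto_vec_nth[OF lim, of i], of i]]
    by (simp add: diag s0_def real_diag_def)
  have "(\<lambda>n. real_diag (s (r n)) :: complex^'n^'n) \<longlonglongrightarrow> real_diag s0"
  proof (intro vec_tendstoI)
    fix i j
    show "(\<lambda>n. (real_diag (s (r n)) :: complex^'n^'n) $ i $ j) \<longlonglongrightarrow> real_diag s0 $ i $ j"
      by (cases "i = j") (simp_all add: real_diag_def tendsto_of_real s0)
  qed
  then have "(\<lambda>n. U (r n) ** real_diag (s (r n)) ** adj (V (r n))) \<longlonglongrightarrow> U0 ** real_diag s0 ** adj V0"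
    by (intro matmul.tendsto bounded_linear.tendsto[OF bounded_linear_adj] U V)
  moreover have "U (r n) ** real_diag (s (r n)) ** adj (V (r n)) = X (r n)" for n
    using s[of "r n"] by (simp add: svd_def)
  ultimately have "(\<lambda>n. X (r n)) \<longlonglongrightarrow> U0 ** real_diag s0 ** adj V0" by (simp only:)
  with Xr have "N = U0 ** real_diag s0 ** adj V0" by (rule LIMSEQ_unique)
  moreover have "0 \<le> s0 i" for i
    by (rule LIMSEQ_le_const[OF s0]) (use s in \<open>auto simp: svd_def\<close>)
  ultimately have "svd N U0 s0 V0" using u by (simp add: svd_def)
  with l(2) U V s0 show ?thesis by (rule that)
qed

lemma closed_matrices_upto_sequentially:
  fixes X :: "nat \<Rightarrow> complex^'n^'n"
  assumes "X \<longlonglongrightarrow> N" and upto: "\<And>n. X n \<in> matrices_upto b"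
  shows "N \<in> matrices_upto b"
proof -
  have "\<exists>U s V. svd (X n) U s V" for n using svd_exists by metis
  then obtain U s V where s: "\<And>n. svd (X n) (U n) (s n) (V n)" by metis
  from svd_subsequence[OF assms(1) s]
  obtain r U0 s0 V0 where lim: "\<And>i. (\<lambda>n. s (r n) i) \<longlonglongrightarrow> s0 i" and svd: "svd N U0 s0 V0" by metis
  have "s0 i \<le> b" for i
    by (rule LIMSEQ_le_const2[OF lim]) (use svd_matrices_upto_iff[OF s] upto in auto)
  then show ?thesis using svd_matrices_upto_iff[OF svd] by blast
qed

lemma violation_sequence:
  fixes P q :: "real \<Rightarrow> real"
  assumes "\<not> (\<exists>c>0. \<exists>t0\<ge>0. \<forall>t\<ge>t0. P t \<le> - c * q t)"
  shows "\<exists>t\<ge>real n. - (1 / real (Suc n)) * q t < P t"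
proof (rule ccontr)
  assume "\<not> ?thesis"
  then have "\<forall>t\<ge>real n. P t \<le> - (1 / real (Suc n)) * q t" by (meson not_le)
  moreover have "1 / real (Suc n) > 0" "real n \<ge> 0" by simp_all
  ultimately show False using assms by blast
qed

text \<open>The mixed products cancel and leave twice the difference of the squares of
  \<open>Z\<close> and \<open>adj Z\<close>. The relation is linear in the defect for fixed
  \<open>Z + adj Z\<close>, so it survives normalisation and passage to the limit.\<close>

lemma idempotent_anticommutator:
  assumes "Z ** Z = Z"
  shows "(Z - adj Z) ** (Z + adj Z) + (Z + adj Z) ** (Z - adj Z) = 2 *\<^sub>R (Z - adj Z)"
proof -
  have "adj Z ** adj Z = adj Z" using arg_cong[OF assms, of adj] by (simp add: adj_mult)
  with assms show ?thesis by (simp add: matrix_simps scaleR_2)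
qed

context spectral_potentials
begin

text \<open>The delicate points are coinciding and vanishing singular values, covered by
  \<open>tendsto_diff_quot\<close> and \<open>tendsto_quotient_by_sum\<close>.\<close>

lemma tendsto_decay_form:
  fixes U V A :: "nat \<Rightarrow> complex^'n^'n"
  assumes d1: "\<And>x. x \<in> {0..b} \<Longrightarrow> (\<psi>1 has_real_derivative d1 x) (at x within {0..b})" "continuous_on {0..b} d1"
    and d2: "\<And>x. x \<in> {0..b} \<Longrightarrow> (\<psi>2 has_real_derivative d2 x) (at x within {0..b})" "continuous_on {0..b} d2"
    and lims: "U \<longlonglongrightarrow> U0" "V \<longlonglongrightarrow> V0" "A \<longlonglongrightarrow> A0" "\<And>i. (\<lambda>n. s n i) \<longlonglongrightarrow> s0 i"
    and s: "\<And>n i. s n i \<in> {0..b}"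
  shows "(\<lambda>n. decay_form d1 d2 (U n) (V n) (s n) (A n)) \<longlonglongrightarrow> decay_form d1 d2 U0 V0 s0 A0"
proof -
  have p: "(\<lambda>n. ((s n i)\<^sup>2 + (s n j)\<^sup>2) / (s n i + s n j)) \<longlonglongrightarrow> ((s0 i)\<^sup>2 + (s0 j)\<^sup>2) / (s0 i + s0 j)" for i j
    by (rule tendsto_quotient_by_sum; (intro tendsto_intros lims)?) (use s in \<open>auto simp: power2_sum\<close>)
  have q: "(\<lambda>n. 2 * s n i * s n j / (s n i + s n j)) \<longlonglongrightarrow> 2 * s0 i * s0 j / (s0 i + s0 j)" for i j
    by (rule tendsto_quotient_by_sum; (intro tendsto_intros lims)?) (use s in \<open>auto simp: power2_sum\<close>)
  have a: "(\<lambda>n. (adj (Q n) ** A n ** Q n) $ i $ j) \<longlonglongrightarrow> (adj Q0 ** A0 ** Q0) $ i $ j"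
    if "Q \<longlonglongrightarrow> Q0" for Q :: "nat \<Rightarrow> complex^'n^'n" and Q0 i j
    by (intro tendsto_vec_nth matmul.tendsto bounded_linear.tendsto[OF bounded_linear_adj] that lims)
  have dq1: "(\<lambda>n. diff_quot \<psi>1 d1 (s n i) (s n j)) \<longlonglongrightarrow> diff_quot \<psi>1 d1 (s0 i) (s0 j)" for i j
    by (rule tendsto_diff_quot[OF d1]) (use lims s in auto)
  have dq2: "(\<lambda>n. diff_quot \<psi>2 d2 (s n i) (s n j)) \<longlonglongrightarrow> diff_quot \<psi>2 d2 (s0 i) (s0 j)" for i j
    by (rule tendsto_diff_quot[OF d2]) (use lims s in auto)
  show ?thesis
    unfolding decay_form_def Let_def by (intro tendsto_intros p q a dq1 dq2 lims)
qed

lemma norm_phi_commutator_le: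
  fixes Y :: "complex^'n^'n"
  shows "norm (commutator (\<Phi> X) Y) \<le> 4 * (real CARD('n))\<^sup>2 * M * norm Y"
proof -
  have "norm (commutator (\<Phi> X) Y) \<le> 2 * norm (\<Phi> X) * norm Y" by (rule norm_commutator_le)
  also have "\<dots> \<le> 2 * (2 * (real CARD('n))\<^sup>2 * M) * norm Y"
    by (intro mult_right_mono mult_left_mono norm_phi_le) auto
  finally show ?thesis by simp
qed

text \<open>Commutators of \<open>X\<close> and \<open>adj X\<close> with \<open>Z + adj Z\<close>
  equal, up to sign, those with the defect \<open>Z - adj Z\<close>. The intertwining bound
  transfers this to functions of the absolute values.\<close>

lemma norm_phi_commutator_le_defect:
  fixes X Z :: "complex^'n^'n"
  assumes ZX: "Z ** X = X ** Z"
  shows "norm (commutator (\<Phi> X) (Z + adj Z)) \<le> 8 * (real CARD('n))\<^sup>2 * L * norm X * norm (Z - adj Z)"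
proof -
  define A where "A = Z - adj Z"
  define B where "B = Z + adj Z"
  have ZX': "adj X ** adj Z = adj Z ** adj X" using arg_cong[OF ZX, of adj] by (simp add: adj_mult)
  have c: "norm (Y ** A - A ** Y) \<le> 2 * norm X * norm A" if "norm Y = norm X" for Y :: "complex^'n^'n"
    using norm_commutator_le[of Y A] that by (simp add: commutator_def)
  have "X ** B - B ** X = - (X ** A - A ** X)" using ZX by (simp add: A_def B_def matrix_simps)
  then have 1: "norm (X ** B - B ** X) \<le> 2 * norm X * norm A" using c[of X] by (metis norm_minus_cancel)
  have "adj X ** B - B ** adj X = adj X ** A - A ** adj X" using ZX' by (simp add: A_def B_def matrix_simps)
  then have 2: "norm (adj X ** B - B ** adj X) \<le> 2 * norm X * norm A" using c[of "adj X"] by simp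
  have int: "norm (abs_fun f Y ** B - B ** abs_fun f Y) \<le> (real CARD('n))\<^sup>2 * (L * (2 * norm X * norm A + 2 * norm X * norm A))"
    if "\<And>x y. \<bar>f x - f y\<bar> \<le> L * \<bar>x - y\<bar>" "Y = X \<or> Y = adj X" for f Y
  proof -
    have "norm (abs_fun f Y ** B - B ** abs_fun f Y) \<le> (real CARD('n))\<^sup>2 * (L * (norm (Y ** B - B ** Y) + norm (adj Y ** B - B ** adj Y)))"
      by (rule norm_abs_fun_intertwine_le) (use that L_nonneg in auto)
    also have "\<dots> \<le> (real CARD('n))\<^sup>2 * (L * (2 * norm X * norm A + 2 * norm X * norm A))"
      using that(2) 1 2 L_nonneg by (intro mult_left_mono add_mono) auto
    finally show ?thesis .
  qed
  have "commutator (\<Phi> X) B = (abs_fun \<psi>1 X ** B - B ** abs_fun \<psi>1 X) - (abs_fun \<psi>2 (adj X) ** B - B ** abs_fun \<psi>2 (adj X))"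
    by (simp add: phi_map_abs_fun commutator_def matrix_simps)
  then have "norm (commutator (\<Phi> X) B) \<le> norm (abs_fun \<psi>1 X ** B - B ** abs_fun \<psi>1 X) + norm (abs_fun \<psi>2 (adj X) ** B - B ** abs_fun \<psi>2 (adj X))"
    by (simp only: norm_triangle_ineq4)
  also have "\<dots> \<le> 8 * (real CARD('n))\<^sup>2 * L * norm X * norm A"
    using int[of \<psi>1 X] int[of \<psi>2 "adj X"] lipschitz by (simp add: mult_ac)
  finally show ?thesis by (simp add: A_def B_def)
qed

end

section \<open>A trajectory with continuously differentiable potentials\<close>

locale convergent_flow = spectral_potentials +
  fixes b :: real and d1 d2 :: "real \<Rightarrow> real" and X :: "real \<Rightarrow> complex^'n^'n"
  assumes b: "b > 0" and strict: "strict_mono_on {0..b} (\<lambda>x. \<psi>1 x + \<psi>2 x)"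
    and d1: "\<And>x. x \<in> {0..b} \<Longrightarrow> (\<psi>1 has_real_derivative d1 x) (at x within {0..b})" "continuous_on {0..b} d1"
    and d2: "\<And>x. x \<in> {0..b} \<Longrightarrow> (\<psi>2 has_real_derivative d2 x) (at x within {0..b})" "continuous_on {0..b} d2"
    and pos: "\<And>x. x \<in> {0<..b} \<Longrightarrow> d1 x + d2 x > 0"
    and solution: "\<And>t. 0 \<le> t \<Longrightarrow> (X has_vector_derivative field (X t)) (at t within {0..})"
    and upto: "\<And>t. 0 \<le> t \<Longrightarrow> X t \<in> matrices_upto b"
begin

definition R :: real where "R = (real CARD('n))\<^sup>2 * b"

lemma norm_le_R: "0 \<le> t \<Longrightarrow> norm (X t) \<le> R"
  unfolding R_def using b by (intro norm_matrices_upto_le upto) auto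

lemma subsequence_limit:
  assumes \<tau>: "\<And>n. \<tau> n \<ge> real n"
  obtains r N where "strict_mono r" "(\<lambda>n. X (\<tau> (r n))) \<longlonglongrightarrow> N" "normal_matrix N" "N \<in> matrices_upto b"
proof -
  have \<tau>0: "\<tau> n \<ge> 0" for n using \<tau>[of n] by (rule order_trans[rotated]) simp
  have "compact (cball (0::complex^'n^'n) R)" by simp
  moreover have "\<forall>n. X (\<tau> n) \<in> cball 0 R" using norm_le_R \<tau>0 by simp
  ultimately obtain N r where r: "strict_mono r" "((\<lambda>n. X (\<tau> n)) \<circ> r) \<longlonglongrightarrow> N"
    unfolding compact_def by metis
  then have lim: "(\<lambda>n. X (\<tau> (r n))) \<longlonglongrightarrow> N" by (simp add: o_def)
  have N: "N \<in> matrices_upto b" by (rule closed_matrices_upto_sequentially[OF lim]) (use upto \<tau>0 in auto)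
  have fl: "filterlim (\<lambda>n. \<tau> (r n)) at_top sequentially"
  proof (rule filterlim_at_top_mono[OF filterlim_real_sequentially], rule always_eventually, rule allI)
    fix n
    have "real n \<le> real (r n)" using seq_suble[OF r(1)] by simp
    with \<tau>[of "r n"] show "real n \<le> \<tau> (r n)" by linarith
  qed
  have "normal_matrix N"
    by (rule solution_limit_point_normal[OF solution upto b strict fl lim N])
  with r(1) lim N show ?thesis by (intro that)
qed

lemma poly_mat_solution_derivative:
  assumes "0 \<le> t"
  shows "((\<lambda>t. poly_mat p (X t)) has_vector_derivative commutator (\<Phi> (X t)) (poly_mat p (X t))) (at t within {0..})"
  using poly_mat_derivative[of X "\<Phi> (X t)" t "{0..}" p] solution[OF assms] by (simp add: field_def)

text \<open>This is the form in which isospectrality is used: \<open>poly_mat p (X t)\<close> solves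
  a linear equation with bounded coefficients, so it stays 0 once it is 0.\<close>

lemma poly_mat_zero_preserved:
  assumes "poly_mat p (X 0) = 0" and t: "0 \<le> t"
  shows "poly_mat p (X t) = 0"
proof (rule gronwall_zero[OF poly_mat_solution_derivative])
  fix t :: real
  let ?Y = "poly_mat p (X t)"
  have "?Y \<bullet> commutator (\<Phi> (X t)) ?Y \<le> norm ?Y * norm (commutator (\<Phi> (X t)) ?Y)"
    by (rule norm_cauchy_schwarz)
  also have "\<dots> \<le> norm ?Y * (4 * (real CARD('n))\<^sup>2 * M * norm ?Y)"
    by (intro mult_left_mono norm_phi_commutator_le) auto
  finally show "?Y \<bullet> commutator (\<Phi> (X t)) ?Y \<le> (4 * (real CARD('n))\<^sup>2 * M) * (norm ?Y)\<^sup>2"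
    by (simp add: power2_eq_square mult_ac)
qed (use assms in auto)

lemma diff_quot_sum_pos:
  assumes "x \<in> {0..b}" "y \<in> {0..b}" "x + y \<noteq> 0"
  shows "diff_quot \<psi>1 d1 x y + diff_quot \<psi>2 d2 x y > 0"
proof (cases "x = y")
  case True
  then show ?thesis using pos[of x] assms by (auto simp: diff_quot_def)
next
  case False
  then have "diff_quot \<psi>1 d1 x y + diff_quot \<psi>2 d2 x y = ((\<psi>1 x + \<psi>2 x) - (\<psi>1 y + \<psi>2 y)) / (x - y)"
    by (simp add: diff_quot_def add_divide_distrib[symmetric])
  moreover have "((\<psi>1 x + \<psi>2 x) - (\<psi>1 y + \<psi>2 y)) / (x - y) > 0"
  proof (cases "x < y")
    case True
    then show ?thesis using strict_mono_onD[OF strict assms(1,2) True] by (intro divide_neg_neg) auto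
  next
    case yx: False
    then have "y < x" using False by simp
    then show ?thesis using strict_mono_onD[OF strict assms(2,1)] by (intro divide_pos_pos) auto
  qed
  ultimately show ?thesis by simp
qed

text \<open>Otherwise a sequence of normalised defects \<open>A / \<bar>A\<bar>\<close> would accumulate at some \<open>A\<^sub>0\<close> of norm one on
  which the limiting decay form vanishes. Then \<open>A\<^sub>0\<close> commutes with the limit point of \<open>X\<close>, hence with the
  limiting Hermitian idempotent \<open>Z\<^sub>0\<close>, while \<open>A\<^sub>0 Z\<^sub>0 + Z\<^sub>0 A\<^sub>0 = A\<^sub>0\<close>.\<close>

lemma idempotent_defect_decay:
  assumes idem: "\<And>t. 0 \<le> t \<Longrightarrow> poly_mat h (X t) ** poly_mat h (X t) = poly_mat h (X t)"
  defines "Z \<equiv> \<lambda>t. poly_mat h (X t)"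
  shows "\<exists>c>0. \<exists>t0\<ge>0. \<forall>t\<ge>t0. (Z t - adj (Z t)) \<bullet> commutator (\<Phi> (X t)) (Z t + adj (Z t)) \<le> - c * (norm (Z t - adj (Z t)))\<^sup>2"
proof (rule ccontr)
  assume contr: "\<not> ?thesis"
  have "\<exists>t\<ge>real n. (Z t - adj (Z t)) \<bullet> commutator (\<Phi> (X t)) (Z t + adj (Z t)) > - (1 / real (Suc n)) * (norm (Z t - adj (Z t)))\<^sup>2" for n
    by (rule violation_sequence[OF contr])
  then obtain \<tau> where \<tau>: "\<And>n. \<tau> n \<ge> real n"
    "\<And>n. (Z (\<tau> n) - adj (Z (\<tau> n))) \<bullet> commutator (\<Phi> (X (\<tau> n))) (Z (\<tau> n) + adj (Z (\<tau> n))) > - (1 / real (Suc n)) * (norm (Z (\<tau> n) - adj (Z (\<tau> n))))\<^sup>2"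
    by metis
  have \<tau>0: "\<tau> n \<ge> 0" for n using \<tau>(1)[of n] by (rule order_trans[rotated]) simp
  define A where "A n = Z (\<tau> n) - adj (Z (\<tau> n))" for n
  define a where "a n = A n /\<^sub>R norm (A n)" for n
  have A_ne: "A n \<noteq> 0" for n
  proof
    assume "A n = 0"
    then show False using \<tau>(2)[of n] unfolding A_def[symmetric] by simp
  qed
  have a_norm: "norm (a n) = 1" and A_a: "A n = norm (A n) *\<^sub>R a n" for n using A_ne[of n] by (auto simp: a_def)
  obtain r1 N where r1: "strict_mono r1" "(\<lambda>n. X (\<tau> (r1 n))) \<longlonglongrightarrow> N" and N: "normal_matrix N" "N \<in> matrices_upto b"
    using subsequence_limit[OF \<tau>(1)] by metis
  have "\<exists>U s V. svd (X (\<tau> (r1 n))) U s V" for n using svd_exists by metis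
  then obtain U s V where s: "\<And>n. svd (X (\<tau> (r1 n))) (U n) (s n) (V n)" by metis
  obtain r2 U0 s0 V0 where r2: "strict_mono r2" "(\<lambda>n. U (r2 n)) \<longlonglongrightarrow> U0" "(\<lambda>n. V (r2 n)) \<longlonglongrightarrow> V0"
    "\<And>i. (\<lambda>n. s (r2 n) i) \<longlonglongrightarrow> s0 i" and s0: "svd N U0 s0 V0"
    using svd_subsequence[OF r1(2) s] by metis
  have "compact (sphere (0::complex^'n^'n) 1)" by simp
  moreover have "\<forall>n. a (r1 (r2 n)) \<in> sphere 0 1" using a_norm by simp
  ultimately obtain a0 r3 where r3: "a0 \<in> sphere 0 1" "strict_mono r3" "((\<lambda>n. a (r1 (r2 n))) \<circ> r3) \<longlonglongrightarrow> a0"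
    unfolding compact_def by metis
  \<comment> \<open>Three successive extractions: for the trajectory, for its singular frames, and
    for the normalised defects.\<close>
  define k where "k n = r1 (r2 (r3 n))" for n
  have k: "strict_mono k" unfolding k_def using strict_mono_o[OF r1(1) strict_mono_o[OF r2(1) r3(2)]] by (simp add: o_def)
  have a_lim: "(\<lambda>n. a (k n)) \<longlonglongrightarrow> a0" using r3(3) by (simp add: k_def o_def)
  have r23: "strict_mono (r2 \<circ> r3)" by (rule strict_mono_o[OF r2(1) r3(2)])
  have X_lim: "(\<lambda>n. X (\<tau> (k n))) \<longlonglongrightarrow> N"
    using LIMSEQ_subseq_LIMSEQ[OF r1(2) r23] by (simp add: k_def o_def)
  have sb: "s n i \<in> {0..b}" for n i
    using svd_matrices_upto_iff[OF s[of n], of b] upto[OF \<tau>0] s[of n] by (auto simp: svd_def)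
  have form_lim: "(\<lambda>n. decay_form d1 d2 (U (r2 (r3 n))) (V (r2 (r3 n))) (s (r2 (r3 n))) (a (k n))) \<longlonglongrightarrow> decay_form d1 d2 U0 V0 s0 a0"
  proof (rule tendsto_decay_form[OF d1 d2])
    show "(\<lambda>n. U (r2 (r3 n))) \<longlonglongrightarrow> U0" "(\<lambda>n. V (r2 (r3 n))) \<longlonglongrightarrow> V0"
      "(\<lambda>n. s (r2 (r3 n)) i) \<longlonglongrightarrow> s0 i" for i
      using LIMSEQ_subseq_LIMSEQ[OF r2(2) r3(2)] LIMSEQ_subseq_LIMSEQ[OF r2(3) r3(2)]
        LIMSEQ_subseq_LIMSEQ[OF r2(4)[of i] r3(2)] by (simp_all add: o_def)
  qed (use a_lim sb in auto)
  have form_less: "decay_form d1 d2 (U (r2 (r3 n))) (V (r2 (r3 n))) (s (r2 (r3 n))) (a (k n)) \<le> 1 / real (Suc (k n))" for n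
  proof -
    let ?D = "decay_form d1 d2 (U (r2 (r3 n))) (V (r2 (r3 n))) (s (r2 (r3 n)))"
    have comm: "Z (\<tau> (k n)) ** X (\<tau> (k n)) = X (\<tau> (k n)) ** Z (\<tau> (k n))"
      unfolding Z_def by (rule poly_mat_commute[symmetric]) (rule refl)
    have "- ?D (A (k n)) > - (1 / real (Suc (k n))) * (norm (A (k n)))\<^sup>2"
      using \<tau>(2)[of "k n"] inner_phi_commutator[OF s[of "r2 (r3 n)", folded k_def] comm, of d1 d2]
      unfolding A_def by simp
    moreover have "?D (A (k n)) = (norm (A (k n)))\<^sup>2 * ?D (a (k n))"
      by (subst A_a) (rule decay_form_scaleR)
    ultimately have "(norm (A (k n)))\<^sup>2 * ?D (a (k n)) < (norm (A (k n)))\<^sup>2 * (1 / real (Suc (k n)))"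
      by (simp add: mult.commute)
    then show ?thesis using A_ne[of "k n"] by (simp only: mult_less_cancel_left) auto
  qed
  have "(\<lambda>n. 1 / real (Suc (k n))) \<longlonglongrightarrow> 0"
    using LIMSEQ_subseq_LIMSEQ[OF LIMSEQ_inverse_real_of_nat k] by (simp add: o_def inverse_eq_divide)
  from LIMSEQ_le[OF form_lim this] form_less have "decay_form d1 d2 U0 V0 s0 a0 \<le> 0" by auto
  then have Na: "N ** a0 = a0 ** N"
    using svd_matrices_upto_iff[OF s0] N(2) diff_quot_sum_pos
    by (intro decay_form_normal_nonpos[OF N(1) s0 _ _ \<open>decay_form d1 d2 U0 V0 s0 a0 \<le> 0\<close>, of b]) auto
  define Z0 where "Z0 = poly_mat h N"
  have Z_lim: "(\<lambda>n. Z (\<tau> (k n))) \<longlonglongrightarrow> Z0" unfolding Z_def Z0_def by (rule tendsto_poly_mat[OF X_lim])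
  have "(\<lambda>n. Z (\<tau> (k n)) ** Z (\<tau> (k n))) \<longlonglongrightarrow> Z0 ** Z0" by (intro matmul.tendsto Z_lim)
  moreover have "Z (\<tau> (k n)) ** Z (\<tau> (k n)) = Z (\<tau> (k n))" for n unfolding Z_def by (rule idem[OF \<tau>0])
  ultimately have "(\<lambda>n. Z (\<tau> (k n))) \<longlonglongrightarrow> Z0 ** Z0" by (simp only:)
  then have idem0: "Z0 ** Z0 = Z0" using Z_lim by (rule LIMSEQ_unique)
  have herm0: "adj Z0 = Z0"
    by (rule normal_idempotent_hermitian[OF _ idem0]) (simp add: Z0_def normal_poly_mat N)
  have aZ: "a0 ** Z0 = Z0 ** a0" unfolding Z0_def by (rule poly_mat_commute) (rule Na[symmetric])
  let ?B = "\<lambda>n. Z (\<tau> (k n)) + adj (Z (\<tau> (k n)))"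
  have B_lim: "?B \<longlonglongrightarrow> Z0 + adj Z0"
    by (intro tendsto_intros Z_lim bounded_linear.tendsto[OF bounded_linear_adj])
  have "(\<lambda>n. a (k n) ** ?B n + ?B n ** a (k n)) \<longlonglongrightarrow> a0 ** (Z0 + adj Z0) + (Z0 + adj Z0) ** a0"
    by (intro tendsto_intros matmul.tendsto a_lim B_lim)
  moreover have "a (k n) ** ?B n + ?B n ** a (k n) = 2 *\<^sub>R a (k n)" for n
  proof -
    have "Z (\<tau> (k n)) ** Z (\<tau> (k n)) = Z (\<tau> (k n))" unfolding Z_def by (rule idem[OF \<tau>0])
    from idempotent_anticommutator[OF this]
    have "A (k n) ** ?B n + ?B n ** A (k n) = 2 *\<^sub>R A (k n)" by (simp only: A_def)
    moreover have "a (k n) ** ?B n + ?B n ** a (k n) = (A (k n) ** ?B n + ?B n ** A (k n)) /\<^sub>R norm (A (k n))"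
      by (simp only: a_def matmul.scaleR_left matmul.scaleR_right scaleR_add_right)
    ultimately show ?thesis by (simp add: a_def)
  qed
  ultimately have "(\<lambda>n. 2 *\<^sub>R a (k n)) \<longlonglongrightarrow> a0 ** (Z0 + adj Z0) + (Z0 + adj Z0) ** a0" by simp
  moreover have "(\<lambda>n. 2 *\<^sub>R a (k n)) \<longlonglongrightarrow> 2 *\<^sub>R a0" by (intro tendsto_intros a_lim)
  ultimately have "2 *\<^sub>R a0 = a0 ** (Z0 + adj Z0) + (Z0 + adj Z0) ** a0" using LIMSEQ_unique by blast
  \<comment> \<open>Since \<open>Z0\<close> is Hermitian and commutes with \<open>a0\<close>, the
    limit of the anticommutator relation reads \<open>a0 = 2 *\<^sub>R (Z0 ** a0)\<close>.
    Multiplying by the idempotent \<open>Z0\<close> forces \<open>Z0 ** a0 = 0\<close>, hence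
    \<open>a0 = 0\<close>.\<close>
  also have "\<dots> = 4 *\<^sub>R (Z0 ** a0)"
  proof -
    have "4 *\<^sub>R (Z0 ** a0) = 2 *\<^sub>R (2 *\<^sub>R (Z0 ** a0))" by simp
    then show ?thesis by (simp only: scaleR_2 herm0 matmul.add_left matmul.add_right aZ)
  qed
  finally have "2 *\<^sub>R a0 = 2 *\<^sub>R (2 *\<^sub>R (Z0 ** a0))" by simp
  then have eq: "a0 = 2 *\<^sub>R (Z0 ** a0)" by (simp only: scaleR_cancel_left) simp
  have "Z0 ** a0 = Z0 ** (2 *\<^sub>R (Z0 ** a0))" using arg_cong[OF eq, of "\<lambda>M. Z0 ** M"] .
  then have "Z0 ** a0 = 2 *\<^sub>R (Z0 ** a0)" by (simp add: matmul.scaleR_right matrix_mul_assoc idem0)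
  then have "Z0 ** a0 = 0" by (simp add: scaleR_2)
  then have "a0 = 0" using eq by simp
  then show False using r3(1) by simp
qed

lemma idempotent_converges:
  assumes idem: "\<And>t. 0 \<le> t \<Longrightarrow> poly_mat h (X t) ** poly_mat h (X t) = poly_mat h (X t)"
  shows "\<exists>l. ((\<lambda>t. poly_mat h (X t)) \<longlongrightarrow> l) at_top"
proof -
  define Z where "Z t = poly_mat h (X t)" for t
  define A where "A t = Z t - adj (Z t)" for t
  define B where "B t = Z t + adj (Z t)" for t
  obtain c t0 where c: "c > 0" "t0 \<ge> 0" "\<And>t. t0 \<le> t \<Longrightarrow> A t \<bullet> commutator (\<Phi> (X t)) (B t) \<le> - c * (norm (A t))\<^sup>2"
    using idempotent_defect_decay[OF idem] unfolding A_def B_def Z_def by blast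
  have Z_deriv: "(Z has_vector_derivative commutator (\<Phi> (X t)) (Z t)) (at t within {0..})" if "0 \<le> t" for t
    unfolding Z_def by (rule poly_mat_solution_derivative[OF that])
  have A_deriv: "(A has_vector_derivative commutator (\<Phi> (X t)) (B t)) (at t within {0..})" if "0 \<le> t" for t
  proof -
    have "(A has_vector_derivative commutator (\<Phi> (X t)) (Z t) - adj (commutator (\<Phi> (X t)) (Z t))) (at t within {0..})"
      unfolding A_def by (intro has_vector_derivative_diff has_vector_derivative_adj Z_deriv that)
    moreover have "commutator (\<Phi> (X t)) (Z t) - adj (commutator (\<Phi> (X t)) (Z t)) = commutator (\<Phi> (X t)) (B t)"
      by (simp add: commutator_def B_def matrix_simps)
    ultimately show ?thesis by simp
  qed
  define K where "K = exp (c * t0) * norm (A t0)"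
  have A_le: "norm (A t) \<le> K * exp (- c * t)" if t: "t0 \<le> t" for t
  proof -
    have "exp (2 * c * t) * (A t \<bullet> A t) \<le> exp (2 * c * t0) * (A t0 \<bullet> A t0)"
    proof (rule antimono_on_halfline[where a = t0 and f = "\<lambda>t. exp (2 * c * t) * (A t \<bullet> A t)"
        and f' = "\<lambda>t. exp (2 * c * t) * (A t \<bullet> commutator (\<Phi> (X t)) (B t) + commutator (\<Phi> (X t)) (B t) \<bullet> A t)
          + exp (2 * c * t) * (2 * c) * (A t \<bullet> A t)"])
      fix t assume t: "t0 \<le> t"
      then have A': "(A has_vector_derivative commutator (\<Phi> (X t)) (B t)) (at t within {t0..})"
        by (intro has_vector_derivative_within_subset[OF A_deriv]) (use c(2) in auto)
      show "((\<lambda>t. exp (2 * c * t) * (A t \<bullet> A t)) has_vector_derivative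
          exp (2 * c * t) * (A t \<bullet> commutator (\<Phi> (X t)) (B t) + commutator (\<Phi> (X t)) (B t) \<bullet> A t)
          + exp (2 * c * t) * (2 * c) * (A t \<bullet> A t)) (at t within {t0..})"
        by (intro has_vector_derivative_mult bounded_bilinear.has_vector_derivative[OF bounded_bilinear_inner] A')
          (auto intro!: derivative_eq_intros simp flip: has_real_derivative_iff_has_vector_derivative)
      have "A t \<bullet> commutator (\<Phi> (X t)) (B t) + commutator (\<Phi> (X t)) (B t) \<bullet> A t \<le> - (2 * c * (A t \<bullet> A t))"
        using c(3)[OF t] by (simp add: inner_commute power2_norm_eq_inner)
      then have "exp (2 * c * t) * (A t \<bullet> commutator (\<Phi> (X t)) (B t) + commutator (\<Phi> (X t)) (B t) \<bullet> A t)
        \<le> exp (2 * c * t) * - (2 * c * (A t \<bullet> A t))" by (rule mult_left_mono) simp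
      then show "exp (2 * c * t) * (A t \<bullet> commutator (\<Phi> (X t)) (B t) + commutator (\<Phi> (X t)) (B t) \<bullet> A t)
          + exp (2 * c * t) * (2 * c) * (A t \<bullet> A t) \<le> 0" by simp
    qed (use t in auto)
    moreover have "(exp (c * u) * norm (A u))\<^sup>2 = exp (2 * c * u) * (A u \<bullet> A u)" for u
      unfolding power_mult_distrib power2_norm_eq_inner exp_double[symmetric] mult.assoc[symmetric] by (rule refl)
    ultimately have "(exp (c * t) * norm (A t))\<^sup>2 \<le> (exp (c * t0) * norm (A t0))\<^sup>2" by (simp only:)
    then have "exp (c * t) * norm (A t) \<le> K"
      unfolding K_def by (rule power2_le_imp_le) simp
    then have "exp (- c * t) * (exp (c * t) * norm (A t)) \<le> exp (- c * t) * K"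
      by (rule mult_left_mono) simp
    moreover have "exp (- c * t) * exp (c * t) = 1" by (simp flip: exp_add)
    ultimately have "1 * norm (A t) \<le> exp (- c * t) * K" unfolding mult.assoc[symmetric] by (simp only:)
    then show ?thesis by (simp add: mult.commute[of K])
  qed
  \<comment> \<open>As 2 Z = A + B, the speed of \<open>Z\<close> splits into the \<open>B\<close>
    part, bounded by \<open>norm_phi_commutator_le_defect\<close>, and the \<open>A\<close> part,
    bounded by the size of \<open>\<Phi>\<close>. The factor 2 is not exploited.\<close>
  define C where "C = 8 * (real CARD('n))\<^sup>2 * L * R + 4 * (real CARD('n))\<^sup>2 * M"
  have C0: "C \<ge> 0"
    using L_nonneg M_nonneg b by (simp add: C_def R_def)
  have Z'_le: "norm (commutator (\<Phi> (X t)) (Z t)) \<le> C * norm (A t)" if "0 \<le> t" for t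
  proof -
    have "commutator (\<Phi> (X t)) (B t) + commutator (\<Phi> (X t)) (A t) = 2 *\<^sub>R commutator (\<Phi> (X t)) (Z t)"
      by (simp add: A_def B_def commutator_def matrix_simps scaleR_2)
    then have "2 * norm (commutator (\<Phi> (X t)) (Z t)) = norm (commutator (\<Phi> (X t)) (B t) + commutator (\<Phi> (X t)) (A t))"
      by simp
    also have "\<dots> \<le> norm (commutator (\<Phi> (X t)) (B t)) + norm (commutator (\<Phi> (X t)) (A t))"
      by (rule norm_triangle_ineq)
    also have "\<dots> \<le> 8 * (real CARD('n))\<^sup>2 * L * norm (X t) * norm (A t) + 4 * (real CARD('n))\<^sup>2 * M * norm (A t)"
    proof (rule add_mono)
      have "Z t ** X t = X t ** Z t" unfolding Z_def by (rule poly_mat_commute[symmetric]) (rule refl)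
      then show "norm (commutator (\<Phi> (X t)) (B t)) \<le> 8 * (real CARD('n))\<^sup>2 * L * norm (X t) * norm (A t)"
        unfolding A_def B_def by (rule norm_phi_commutator_le_defect)
    qed (rule norm_phi_commutator_le)
    also have "\<dots> \<le> 8 * (real CARD('n))\<^sup>2 * L * R * norm (A t) + 4 * (real CARD('n))\<^sup>2 * M * norm (A t)"
      using L_nonneg norm_le_R[OF that] by (intro add_mono mult_right_mono mult_left_mono) auto
    also have "\<dots> = C * norm (A t)" by (simp add: C_def algebra_simps)
    finally have "2 * norm (commutator (\<Phi> (X t)) (Z t)) \<le> C * norm (A t)" .
    then show ?thesis using norm_ge_zero[of "commutator (\<Phi> (X t)) (Z t)"] by linarith
  qed
  have "\<exists>l. (Z \<longlongrightarrow> l) at_top"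
  proof (rule exponential_decay_convergent[OF Z_deriv _ c(1,2)])
    fix t assume t: "t0 \<le> t"
    then have "norm (commutator (\<Phi> (X t)) (Z t)) \<le> C * norm (A t)" using c(2) by (intro Z'_le) auto
    also have "\<dots> \<le> C * (K * exp (- c * t))" by (intro mult_left_mono A_le t C0)
    finally show "norm (commutator (\<Phi> (X t)) (Z t)) \<le> (C * K) * exp (- c * t)" by (simp add: mult.assoc)
  qed
  then show ?thesis by (simp add: Z_def[abs_def])
qed

text \<open>\<open>X t\<close> is the sum of \<open>Y t\<close>, a fixed linear combination of
  convergent projections, and the nilpotent part \<open>poly_mat Q (X t)\<close>, which is handled
  through limit points only.\<close>

lemma solution_converges: "\<exists>N. normal_matrix N \<and> (X \<longlongrightarrow> N) at_top"
proof -
  obtain p where p: "p \<noteq> 0" "poly_mat p (X 0) = 0" by (rule annihilating_polynomial)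
  define S where "S = {z. poly p z = 0}"
  have S: "finite S" using p(1) by (simp add: S_def poly_roots_finite)
  define \<kappa> where "\<kappa> = (\<Prod>z\<in>S. [:- z, 1:] ^ order z p)"
  have decomp: "smult (lead_coeff p) \<kappa> = p" unfolding \<kappa>_def S_def by (rule complex_poly_decompose)
  have "smult (lead_coeff p) \<kappa> dvd \<kappa>" by (rule smult_dvd) (use p(1) in auto)
  then have "p dvd \<kappa>" by (simp only: decomp)
  then have \<kappa>: "poly_mat \<kappa> (X 0) = 0" by (rule poly_mat_dvd) (rule p(2))
  obtain h k where h: "\<And>z. z \<in> S \<Longrightarrow> \<kappa> dvd (h z * h z - h z)"
    and k: "\<kappa> dvd ([:0, 1:] - (\<Sum>z\<in>S. smult z (h z))) ^ k"
    using spectral_idempotents[OF S, of "\<lambda>z. order z p"] unfolding \<kappa>_def by blast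
  define Q where "Q = [:0, 1:] - (\<Sum>z\<in>S. smult z (h z))"
  have "\<exists>l. ((\<lambda>t. poly_mat (h z) (X t)) \<longlongrightarrow> l) at_top" if z: "z \<in> S" for z
  proof (rule idempotent_converges)
    fix t :: real assume "0 \<le> t"
    then have "poly_mat (h z * h z - h z) (X t) = 0"
      by (rule poly_mat_zero_preserved[OF poly_mat_dvd[OF h[OF z] \<kappa>]])
    then show "poly_mat (h z) (X t) ** poly_mat (h z) (X t) = poly_mat (h z) (X t)"
      by (simp add: poly_mat_diff poly_mat_mult)
  qed
  then obtain l where l: "\<And>z. z \<in> S \<Longrightarrow> ((\<lambda>t. poly_mat (h z) (X t)) \<longlongrightarrow> l z) at_top" by metis
  define Y where "Y t = (\<Sum>z\<in>S. mat z ** poly_mat (h z) (X t))" for t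
  have Y: "(Y \<longlongrightarrow> (\<Sum>z\<in>S. mat z ** l z)) at_top"
    unfolding Y_def by (intro tendsto_sum matmul.tendsto tendsto_const l)
  have XY: "X t - Y t = poly_mat Q (X t)" for t
    unfolding Q_def Y_def poly_mat_diff poly_mat_X poly_mat_sum poly_mat_smult by simp
  have Qk: "mpow (poly_mat Q (X t)) k = 0" if "0 \<le> t" for t
    unfolding poly_mat_power[symmetric] Q_def by (rule poly_mat_zero_preserved[OF poly_mat_dvd[OF k \<kappa>] that])
  have "((\<lambda>t. poly_mat Q (X t)) \<longlongrightarrow> 0) at_top"
  proof (rule ccontr)
    assume "\<not> ((\<lambda>t. poly_mat Q (X t)) \<longlongrightarrow> 0) at_top"
    then obtain e where e: "e > 0" "\<not> (\<forall>\<^sub>F t in at_top. dist (poly_mat Q (X t)) 0 < e)"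
      unfolding tendsto_iff by blast
    then have "\<exists>t\<ge>real n. e \<le> norm (poly_mat Q (X t))" for n
      unfolding eventually_at_top_linorder by (force simp: not_less)
    then obtain \<tau> where \<tau>: "\<And>n. \<tau> n \<ge> real n" "\<And>n. e \<le> norm (poly_mat Q (X (\<tau> n)))" by metis
    have \<tau>0: "\<tau> n \<ge> 0" for n using \<tau>(1)[of n] by (rule order_trans[rotated]) simp
    obtain r N where r: "strict_mono r" "(\<lambda>n. X (\<tau> (r n))) \<longlonglongrightarrow> N" and N: "normal_matrix N"
      using subsequence_limit[OF \<tau>(1)] by metis
    have "(\<lambda>n. poly_mat (Q ^ k) (X (\<tau> (r n)))) \<longlonglongrightarrow> poly_mat (Q ^ k) N"
      by (rule tendsto_poly_mat[OF r(2)])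
    \<comment> \<open>Nilpotency with the fixed exponent \<open>k\<close> passes to the limit point,
      where a normal nilpotent matrix must vanish.\<close>
    then have "mpow (poly_mat Q N) k = 0"
      unfolding poly_mat_power Qk[OF \<tau>0] by (simp add: LIMSEQ_const_iff)
    then have QN: "poly_mat Q N = 0"
      by (rule normal_nilpotent_zero[OF normal_poly_mat[OF N]])
    have "(\<lambda>n. norm (poly_mat Q (X (\<tau> (r n))))) \<longlonglongrightarrow> norm (poly_mat Q N)"
      by (intro tendsto_norm tendsto_poly_mat[OF r(2)])
    from LIMSEQ_le_const[OF this, of e] \<tau>(2) QN e(1) show False by auto
  qed
  then have "((\<lambda>t. poly_mat Q (X t) + Y t) \<longlongrightarrow> 0 + (\<Sum>z\<in>S. mat z ** l z)) at_top"
    by (intro tendsto_add Y)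
  then have lim: "(X \<longlongrightarrow> (\<Sum>z\<in>S. mat z ** l z)) at_top" by (simp flip: XY)
  \<comment> \<open>Convergence is settled; normality of the limit is inherited from any limit
    point, here along integer times.\<close>
  obtain r N where r: "strict_mono r" "(\<lambda>n. X (real (r n))) \<longlonglongrightarrow> N" and N: "normal_matrix N"
    by (rule subsequence_limit[of real]) (simp, blast)
  have "(\<lambda>n. X (real (r n))) \<longlonglongrightarrow> (\<Sum>z\<in>S. mat z ** l z)"
    by (rule filterlim_compose[OF lim])
      (rule filterlim_compose[OF filterlim_real_sequentially filterlim_subseq[OF r(1)]])
  then have "N = (\<Sum>z\<in>S. mat z ** l z)" using r(2) LIMSEQ_unique by blast
  with N lim show ?thesis by blast
qed

end

text \<open>Compactness of the interval bounds the function and its derivative; the latter bound is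
  the Lipschitz constant, by convexity of the interval.\<close>

lemma C_1_on_bounds:
  assumes f: "C_k_on 1 {0..b} f" and b: "b > 0"
  obtains f' L M where "\<And>x. x \<in> {0..b} \<Longrightarrow> (f has_real_derivative f' x) (at x within {0..b})"
    "continuous_on {0..b} f'"
    "\<And>x y. x \<in> {0..b} \<Longrightarrow> y \<in> {0..b} \<Longrightarrow> \<bar>f x - f y\<bar> \<le> L * \<bar>x - y\<bar>"
    "\<And>x. x \<in> {0..b} \<Longrightarrow> \<bar>f x\<bar> \<le> M"
proof -
  obtain D where D: "\<And>x. x \<in> {0..b} \<Longrightarrow> D 0 x = f x"
    "\<And>x. x \<in> {0..b} \<Longrightarrow> (D 0 has_real_derivative D (Suc 0) x) (at x within {0..b})"
    "continuous_on {0..b} (D 1)"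
  proof -
    obtain D where "\<forall>x\<in>{0..b}. D 0 x = f x"
      "\<forall>j<1. \<forall>x\<in>{0..b}. (D j has_real_derivative D (Suc j) x) (at x within {0..b})"
      "\<forall>j\<le>1. continuous_on {0..b} (D j)"
      using f unfolding C_k_on_def by blast
    then show ?thesis by (intro that[of D]) simp_all
  qed
  have deriv: "(f has_real_derivative D 1 x) (at x within {0..b})" if "x \<in> {0..b}" for x
    using has_field_derivative_transform_within[OF D(2)[OF that] zero_less_one that, of f] D(1) by simp
  have "bounded (D 1 ` {0..b})" by (intro compact_imp_bounded compact_continuous_image D) simp
  then have "\<exists>B. \<forall>x\<in>{0..b}. \<bar>D 1 x\<bar> \<le> B" by (simp add: bounded_iff)
  then obtain L where L: "\<And>x. x \<in> {0..b} \<Longrightarrow> \<bar>D 1 x\<bar> \<le> L" by blast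
  have f_cont: "continuous_on {0..b} f" using deriv by (rule DERIV_continuous_on)
  then have "bounded (f ` {0..b})" by (intro compact_imp_bounded compact_continuous_image compact_Icc)
  then have "\<exists>B. \<forall>x\<in>{0..b}. \<bar>f x\<bar> \<le> B" by (simp add: bounded_iff)
  then obtain M where M: "\<And>x. x \<in> {0..b} \<Longrightarrow> \<bar>f x\<bar> \<le> M" by blast
  have "\<bar>f x - f y\<bar> \<le> L * \<bar>x - y\<bar>" if "x \<in> {0..b}" "y \<in> {0..b}" for x y
    using field_differentiable_bound[of "{0..b}" f "D 1" L x y, OF _ deriv] L that by simp
  then show ?thesis using that[OF deriv D(3)] M by blast
qed

theorem theorem3p13:
  fixes b :: real
    and \<phi>1 \<phi>2 :: "real \<Rightarrow> real"
    and T :: "complex ^ 'n ^ 'n"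
  assumes "b > 0"
    and "C_k_on 1 {0..b} \<phi>1" and "C_k_on 1 {0..b} \<phi>2"
    and "mono_on {0..b} \<phi>1" and "mono_on {0..b} \<phi>2"
    and "strict_mono_on {0..b} (\<lambda>x. \<phi>1 x + \<phi>2 x)"
    and "\<And>x. x \<in> {0<..b} \<Longrightarrow>
           vector_derivative \<phi>1 (at x within {0..b}) + vector_derivative \<phi>2 (at x within {0..b}) > 0"
    and "T \<in> matrices_upto b" and "\<not> invertible T"
    and "(alg_mult T 0 = geom_mult T 0 \<and>
          (T \<noteq> 0 \<longrightarrow> C_k_on (CARD('n) - 1 - geom_mult T 0) {0..b} \<phi>1 \<and>
                   C_k_on (CARD('n) - 1 - geom_mult T 0) {0..b} \<phi>2))
       \<or> (alg_mult T 0 = geom_mult T 0 + 1 \<and>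
          (\<forall>x\<in>{0..b}. \<phi>2 x = 0) \<and>
          C_k_on (CARD('n) - 1 - geom_mult T 0) {0..b} \<phi>1)"
  shows "\<exists>N. normal_matrix N \<and> ((\<lambda>t. flow b \<phi>1 \<phi>2 t T) \<longlongrightarrow> N) at_top"
proof -
  note b = assms(1)
  obtain d1 L1 M1 where d1: "\<And>x. x \<in> {0..b} \<Longrightarrow> (\<phi>1 has_real_derivative d1 x) (at x within {0..b})"
    "continuous_on {0..b} d1"
    and L1: "\<And>x y. x \<in> {0..b} \<Longrightarrow> y \<in> {0..b} \<Longrightarrow> \<bar>\<phi>1 x - \<phi>1 y\<bar> \<le> L1 * \<bar>x - y\<bar>"
    and M1: "\<And>x. x \<in> {0..b} \<Longrightarrow> \<bar>\<phi>1 x\<bar> \<le> M1"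
    by (rule C_1_on_bounds[OF assms(2) b]) blast
  obtain d2 L2 M2 where d2: "\<And>x. x \<in> {0..b} \<Longrightarrow> (\<phi>2 has_real_derivative d2 x) (at x within {0..b})"
    "continuous_on {0..b} d2"
    and L2: "\<And>x y. x \<in> {0..b} \<Longrightarrow> y \<in> {0..b} \<Longrightarrow> \<bar>\<phi>2 x - \<phi>2 y\<bar> \<le> L2 * \<bar>x - y\<bar>"
    and M2: "\<And>x. x \<in> {0..b} \<Longrightarrow> \<bar>\<phi>2 x\<bar> \<le> M2"
    by (rule C_1_on_bounds[OF assms(3) b]) blast
  \<comment> \<open>The nearest-point retraction onto \<open>{0..b}\<close> is increasing and
    1-Lipschitz. Composing with it extends the potentials to the whole line with the properties that
    \<open>spectral_potentials\<close> demands.\<close>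
  define cl where "cl x = max 0 (min b x)" for x :: real
  have cl: "cl x \<in> {0..b}" for x using b by (auto simp: cl_def)
  have cl_id: "cl x = x" if "x \<in> {0..b}" for x using that by (simp add: cl_def)
  have cl_lip: "\<bar>cl x - cl y\<bar> \<le> \<bar>x - y\<bar>" for x y by (auto simp: cl_def)
  have cl_mono: "cl x \<le> cl y" if "x \<le> y" for x y using that by (auto simp: cl_def)
  define \<psi>1 where "\<psi>1 x = \<phi>1 (cl x)" for x
  define \<psi>2 where "\<psi>2 x = \<phi>2 (cl x)" for x
  define L where "L = max 0 (max L1 L2)"
  have lip: "\<bar>f (cl x) - f (cl y)\<bar> \<le> L * \<bar>x - y\<bar>"
    if "\<And>x y. x \<in> {0..b} \<Longrightarrow> y \<in> {0..b} \<Longrightarrow> \<bar>f x - f y\<bar> \<le> K * \<bar>x - y\<bar>" "K \<le> L" for f :: "real \<Rightarrow> real" and K x y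
  proof -
    have "\<bar>f (cl x) - f (cl y)\<bar> \<le> K * \<bar>cl x - cl y\<bar>" by (rule that(1)) (rule cl)+
    also have "\<dots> \<le> L * \<bar>x - y\<bar>" using that(2) cl_lip by (intro mult_mono) (auto simp: L_def)
    finally show ?thesis .
  qed
  interpret spectral_potentials L "max M1 M2" \<psi>1 \<psi>2
  proof
    show "mono \<psi>1" "mono \<psi>2"
      using mono_onD[OF assms(4)] mono_onD[OF assms(5)] cl cl_mono by (auto intro!: monoI simp: \<psi>1_def \<psi>2_def)
    show "\<bar>\<psi>1 x - \<psi>1 y\<bar> \<le> L * \<bar>x - y\<bar>" "\<bar>\<psi>2 x - \<psi>2 y\<bar> \<le> L * \<bar>x - y\<bar>" for x y
      unfolding \<psi>1_def \<psi>2_def by (rule lip[OF L1] lip[OF L2]; simp add: L_def)+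
    show "\<bar>\<psi>1 x\<bar> \<le> max M1 M2" "\<bar>\<psi>2 x\<bar> \<le> max M1 M2" for x
      unfolding \<psi>1_def \<psi>2_def using M1[OF cl] M2[OF cl] by (simp_all add: le_max_iff_disj)
  qed
  have eq1: "\<phi>1 x = \<psi>1 x" and eq2: "\<phi>2 x = \<psi>2 x" if "x \<in> {0..b}" for x
    using that by (simp_all add: \<psi>1_def \<psi>2_def cl_id)
  obtain X where X: "X 0 = T" "\<And>t. 0 \<le> t \<Longrightarrow> X t \<in> matrices_upto b"
    "\<And>t. 0 \<le> t \<Longrightarrow> (X has_vector_derivative field (X t)) (at t within {0..})"
    "\<And>t. 0 \<le> t \<Longrightarrow> flow b \<phi>1 \<phi>2 t T = X t"
    using flow_eq_solution[OF eq1 eq2 b assms(8)] by metis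
  interpret convergent_flow L "max M1 M2" \<psi>1 \<psi>2 b d1 d2 X
  proof
    show "strict_mono_on {0..b} (\<lambda>x. \<psi>1 x + \<psi>2 x)"
      using strict_mono_onD[OF assms(6)] by (intro strict_mono_onI) (simp flip: eq1 eq2)
    show "(\<psi>1 has_real_derivative d1 x) (at x within {0..b})" if "x \<in> {0..b}" for x
      by (rule has_field_derivative_transform_within[OF d1(1)[OF that] zero_less_one that eq1])
    show "(\<psi>2 has_real_derivative d2 x) (at x within {0..b})" if "x \<in> {0..b}" for x
      by (rule has_field_derivative_transform_within[OF d2(1)[OF that] zero_less_one that eq2])
    show "0 < d1 x + d2 x" if "x \<in> {0<..b}" for x
    proof -
      have x: "x \<in> {0..b}" using that by auto
      \<comment> \<open>Derivatives within a nondegenerate interval are unique, also at the end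
        point \<open>b\<close>, which identifies the one-sided derivatives with \<open>d1\<close>
        and \<open>d2\<close>.\<close>
      have "vector_derivative \<phi>1 (at x within {0..b}) = d1 x" "vector_derivative \<phi>2 (at x within {0..b}) = d2 x"
        using d1(1)[OF x] d2(1)[OF x] b x
        by (auto intro!: vector_derivative_within_closed_interval simp: has_real_derivative_iff_has_vector_derivative)
      then show ?thesis using assms(7)[OF that] by simp
    qed
  qed (use b d1 d2 X in auto)
  obtain N where N: "normal_matrix N" "(X \<longlongrightarrow> N) at_top" using solution_converges by blast
  have "\<forall>\<^sub>F t in at_top. X t = flow b \<phi>1 \<phi>2 t T"
    using eventually_ge_at_top[of 0] by eventually_elim (simp add: X(4))
  from Lim_transform_eventually[OF N(2) this] N(1) show ?thesis by blast
qed

end
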